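(* Let $k$ be a field with $\operatorname{char} k\neq 2$ and let $A=Cl(\alpha,\beta_i,\gamma_i,\lambda_{ij})$ be a $2^{n+1}$-dimensional Clifford algebra over $k$. Then $A$ is a bialgebra (i.e. the algebra $A$ admits a comultiplication and a counit making it a bialgebra) if and only if $A$ is isomorphic, as an algebra (not necessarily as a bialgebra), to $E(n)=Cl(1,0,0,0)$.
   Context: Given a non-negative integer $n$ and scalars $\alpha,\beta_i,\gamma_i\in k$ ($1\le i\le n$) and $\lambda_{ij}\in k$ ($1\le i<j\le n$), $Cl(\alpha,\beta_i,\gamma_i,\lambda_{ij})$ is the unital associative $k$-algebra generated by $G,X_1,\ldots,X_n$ with relations $G^2=\alpha$, $X_i^2=\beta_i$, $GX_i+X_iG=\gamma_i$ for all $i$, and $X_iX_j+X_jX_i=\lambda_{ij}$ for $i<j$. It has dimension $2^{n+1}$. As an algebra, $E(n)=Cl(1,0,0,0)$ is the one with $\alpha=1$ and all $\beta_i=\gamma_i=\lambda_{ij}=0$, i.e. generated by $g,x_1,\ldots,x_n$ with $g^2=1$, $x_i^2=0$, $gx_i=-x_ig$, $x_ix_j=-x_jx_i$. *)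

theory Defs
  imports "HOL-Algebra.QuotRing" "HOL-Algebra.Module"
begin

section \<open>Associative algebras\<close>

text \<open>The library's locale \<open>algebra\<close> requires multiplication to be commutative; the following
  is its non-commutative analogue over a field.\<close>

locale assoc_algebra = field K + module K A + ring A
  for K (structure) and A (structure) +
  assumes smult_mult_left:
      "\<lbrakk> c \<in> carrier K; x \<in> carrier A; y \<in> carrier A \<rbrakk> \<Longrightarrow>
        (c \<odot>\<^bsub>A\<^esub> x) \<otimes>\<^bsub>A\<^esub> y = c \<odot>\<^bsub>A\<^esub> (x \<otimes>\<^bsub>A\<^esub> y)"
    and smult_mult_right:
      "\<lbrakk> c \<in> carrier K; x \<in> carrier A; y \<in> carrier A \<rbrakk> \<Longrightarrow>
        x \<otimes>\<^bsub>A\<^esub> (c \<odot>\<^bsub>A\<^esub> y) = c \<odot>\<^bsub>A\<^esub> (x \<otimes>\<^bsub>A\<^esub> y)"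

definition alg_hom ::
  "('k, 'r) ring_scheme \<Rightarrow> ('k, 'a, 's) module_scheme \<Rightarrow> ('k, 'b, 't) module_scheme \<Rightarrow> ('a \<Rightarrow> 'b) set"
  where "alg_hom K A B =
    {h \<in> ring_hom A B. \<forall>c\<in>carrier K. \<forall>x\<in>carrier A. h (c \<odot>\<^bsub>A\<^esub> x) = c \<odot>\<^bsub>B\<^esub> h x}"

definition alg_isomorphic ::
  "('k, 'r) ring_scheme \<Rightarrow> ('k, 'a, 's) module_scheme \<Rightarrow> ('k, 'b, 't) module_scheme \<Rightarrow> bool"
  where "alg_isomorphic K A B \<longleftrightarrow>
    (\<exists>h. h \<in> alg_hom K A B \<and> bij_betw h (carrier A) (carrier B))"

definition base_algebra :: "('k, 'r) ring_scheme \<Rightarrow> ('k, 'k) module"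
  where "base_algebra K =
    \<lparr>carrier = carrier K, mult = mult K, one = one K, zero = zero K, add = add K, smult = mult K\<rparr>"

text \<open>\<open>A / I\<close>: the library's quotient ring, equipped with the induced scalar multiplication
  (the union over representatives has the same form as in \<^const>\<open>rcoset_mult\<close>).\<close>

definition quotient_algebra :: "('k, 'a, 's) module_scheme \<Rightarrow> 'a set \<Rightarrow> ('k, 'a set) module"
  where "quotient_algebra A I =
    \<lparr>carrier = carrier (A Quot I), mult = mult (A Quot I), one = one (A Quot I),
     zero = zero (A Quot I), add = add (A Quot I),
     smult = (\<lambda>c X. \<Union>x\<in>X. I +>\<^bsub>A\<^esub> (c \<odot>\<^bsub>A\<^esub> x))\<rparr>"


section \<open>Monoid algebras and free algebras\<close>

text \<open>The free vector space on the carrier of a monoid \<open>M\<close> with the convolution product.  Its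
  elements are the finitely supported \<open>K\<close>-valued functions on \<open>carrier M\<close>, extended by zero to the
  whole type so that equality of functions is equality in the algebra.\<close>

definition monoid_algebra :: "('k, 'r) ring_scheme \<Rightarrow> ('m, 's) monoid_scheme \<Rightarrow> ('k, 'm \<Rightarrow> 'k) module"
  where "monoid_algebra K M =
    \<lparr>carrier = {f. (\<forall>m\<in>carrier M. f m \<in> carrier K) \<and> (\<forall>m. m \<notin> carrier M \<longrightarrow> f m = \<zero>\<^bsub>K\<^esub>)
                  \<and> finite {m. f m \<noteq> \<zero>\<^bsub>K\<^esub>}},
     mult = (\<lambda>f g m.
       \<Oplus>\<^bsub>K\<^esub>p\<in>{(a, b). f a \<noteq> \<zero>\<^bsub>K\<^esub> \<and> g b \<noteq> \<zero>\<^bsub>K\<^esub> \<and> a \<otimes>\<^bsub>M\<^esub> b = m}. f (fst p) \<otimes>\<^bsub>K\<^esub> g (snd p)),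
     one = (\<lambda>m. if m = \<one>\<^bsub>M\<^esub> then \<one>\<^bsub>K\<^esub> else \<zero>\<^bsub>K\<^esub>),
     zero = (\<lambda>m. \<zero>\<^bsub>K\<^esub>),
     add = (\<lambda>f g m. f m \<oplus>\<^bsub>K\<^esub> g m),
     smult = (\<lambda>c f m. c \<otimes>\<^bsub>K\<^esub> f m)\<rparr>"

definition basis_elem :: "('k, 'r) ring_scheme \<Rightarrow> 'm \<Rightarrow> ('m \<Rightarrow> 'k)"
  where "basis_elem K m = (\<lambda>x. if x = m then \<one>\<^bsub>K\<^esub> else \<zero>\<^bsub>K\<^esub>)"

definition word_monoid :: "'g set \<Rightarrow> 'g list monoid"
  where "word_monoid S = \<lparr>carrier = lists S, mult = (@), one = []\<rparr>"

text \<open>The free associative unital algebra on a set of generators (non-commutative polynomials).\<close>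

definition free_algebra :: "('k, 'r) ring_scheme \<Rightarrow> 'g set \<Rightarrow> ('k, 'g list \<Rightarrow> 'k) module"
  where "free_algebra K S = monoid_algebra K (word_monoid S)"

definition free_gen :: "('k, 'r) ring_scheme \<Rightarrow> 'g \<Rightarrow> ('g list \<Rightarrow> 'k)"
  where "free_gen K s = basis_elem K [s]"


section \<open>Tensor products\<close>

text \<open>\<open>A \<otimes> B\<close> is the free vector space on the set \<open>A \<times> B\<close> modulo the linear span of the bilinearity
  relations.  The algebra structure comes from the product monoid \<open>(A, \<cdot>) \<times> (B, \<cdot>)\<close>, so that
  \<open>(a \<otimes> b) (a' \<otimes> b') = a a' \<otimes> b b'\<close>; the span of the relations is an ideal of the monoid algebra.\<close>

definition linear_span :: "('k, 'r) ring_scheme \<Rightarrow> ('k, 'v, 's) module_scheme \<Rightarrow> 'v set \<Rightarrow> 'v set"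
  where "linear_span K V S = \<Inter>{N. submodule N K V \<and> S \<subseteq> N}"

abbreviation pair_algebra ::
  "('k, 'r) ring_scheme \<Rightarrow> ('k, 'a, 's) module_scheme \<Rightarrow> ('k, 'b, 't) module_scheme
    \<Rightarrow> ('k, 'a \<times> 'b \<Rightarrow> 'k) module"
  where "pair_algebra K A B \<equiv> monoid_algebra K (A \<times>\<times> B)"

definition bilinear_rels ::
  "('k, 'r) ring_scheme \<Rightarrow> ('k, 'a, 's) module_scheme \<Rightarrow> ('k, 'b, 't) module_scheme
    \<Rightarrow> ('a \<times> 'b \<Rightarrow> 'k) set"
  where "bilinear_rels K A B = (let F = pair_algebra K A B; e = basis_elem K in
     {e (a \<oplus>\<^bsub>A\<^esub> a', b) \<ominus>\<^bsub>F\<^esub> (e (a, b) \<oplus>\<^bsub>F\<^esub> e (a', b)) | a a' b.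
        a \<in> carrier A \<and> a' \<in> carrier A \<and> b \<in> carrier B}
   \<union> {e (a, b \<oplus>\<^bsub>B\<^esub> b') \<ominus>\<^bsub>F\<^esub> (e (a, b) \<oplus>\<^bsub>F\<^esub> e (a, b')) | a b b'.
        a \<in> carrier A \<and> b \<in> carrier B \<and> b' \<in> carrier B}
   \<union> {e (c \<odot>\<^bsub>A\<^esub> a, b) \<ominus>\<^bsub>F\<^esub> c \<odot>\<^bsub>F\<^esub> e (a, b) | c a b.
        c \<in> carrier K \<and> a \<in> carrier A \<and> b \<in> carrier B}
   \<union> {e (a, c \<odot>\<^bsub>B\<^esub> b) \<ominus>\<^bsub>F\<^esub> c \<odot>\<^bsub>F\<^esub> e (a, b) | c a b.
        c \<in> carrier K \<and> a \<in> carrier A \<and> b \<in> carrier B})"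

definition tensor_null ::
  "('k, 'r) ring_scheme \<Rightarrow> ('k, 'a, 's) module_scheme \<Rightarrow> ('k, 'b, 't) module_scheme
    \<Rightarrow> ('a \<times> 'b \<Rightarrow> 'k) set"
  where "tensor_null K A B = linear_span K (pair_algebra K A B) (bilinear_rels K A B)"

definition tensor ::
  "('k, 'r) ring_scheme \<Rightarrow> ('k, 'a, 's) module_scheme \<Rightarrow> ('k, 'b, 't) module_scheme
    \<Rightarrow> ('k, ('a \<times> 'b \<Rightarrow> 'k) set) module"
  where "tensor K A B = quotient_algebra (pair_algebra K A B) (tensor_null K A B)"

definition pure_tensor ::
  "('k, 'r) ring_scheme \<Rightarrow> ('k, 'a, 's) module_scheme \<Rightarrow> ('k, 'b, 't) module_scheme
    \<Rightarrow> 'a \<Rightarrow> 'b \<Rightarrow> ('a \<times> 'b \<Rightarrow> 'k) set"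
  where "pure_tensor K A B a b = tensor_null K A B +>\<^bsub>pair_algebra K A B\<^esub> basis_elem K (a, b)"

text \<open>The linear map \<open>A \<otimes> B \<rightarrow> C\<close>, \<open>a \<otimes> b \<mapsto> \<phi> a b\<close>, induced by a bilinear map \<open>\<phi>\<close>: evaluate on
  a representative \<open>f\<close> of the coset \<open>T\<close>.  For bilinear \<open>\<phi>\<close> the choice of \<open>f\<close> does not matter.\<close>

definition tensor_lift ::
  "('k, 'r) ring_scheme \<Rightarrow> ('k, 'c, 's) module_scheme \<Rightarrow> ('a \<Rightarrow> 'b \<Rightarrow> 'c) \<Rightarrow> ('a \<times> 'b \<Rightarrow> 'k) set \<Rightarrow> 'c"
  where "tensor_lift K C \<phi> T = (let f = (SOME f. f \<in> T) in
    \<Oplus>\<^bsub>C\<^esub>p\<in>{p. f p \<noteq> \<zero>\<^bsub>K\<^esub>}. f p \<odot>\<^bsub>C\<^esub> \<phi> (fst p) (snd p))"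


section \<open>Bialgebras\<close>

text \<open>The associativity isomorphism \<open>(A \<otimes> A) \<otimes> A \<rightarrow> A \<otimes> (A \<otimes> A)\<close>.\<close>

definition tensor_assoc ::
  "('k, 'r) ring_scheme \<Rightarrow> ('k, 'a, 's) module_scheme
    \<Rightarrow> (('a \<times> 'a \<Rightarrow> 'k) set \<times> 'a \<Rightarrow> 'k) set \<Rightarrow> ('a \<times> ('a \<times> 'a \<Rightarrow> 'k) set \<Rightarrow> 'k) set"
  where "tensor_assoc K A = (let AA = tensor K A A; A_AA = tensor K A AA in
    tensor_lift K A_AA
      (\<lambda>t c. tensor_lift K A_AA (\<lambda>a b. pure_tensor K A AA a (pure_tensor K A A b c)) t))"

text \<open>In the third condition the left-hand side is the associator after \<open>(\<Delta> \<otimes> id) \<circ> \<Delta>\<close> and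
  the right-hand side is \<open>(id \<otimes> \<Delta>) \<circ> \<Delta>\<close>; the last two are \<open>(\<epsilon> \<otimes> id) \<circ> \<Delta> = id = (id \<otimes> \<epsilon>) \<circ> \<Delta>\<close>
  under the identifications \<open>K \<otimes> A = A = A \<otimes> K\<close>.\<close>

definition bialgebra ::
  "('k, 'r) ring_scheme \<Rightarrow> ('k, 'a, 's) module_scheme
    \<Rightarrow> ('a \<Rightarrow> ('a \<times> 'a \<Rightarrow> 'k) set) \<Rightarrow> ('a \<Rightarrow> 'k) \<Rightarrow> bool"
  where "bialgebra K A \<Delta> \<epsilon> \<longleftrightarrow>
    (let AA = tensor K A A in
      assoc_algebra K A
    \<and> \<Delta> \<in> alg_hom K A AA
    \<and> \<epsilon> \<in> alg_hom K A (base_algebra K)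
    \<and> (\<forall>x\<in>carrier A.
         tensor_assoc K A (tensor_lift K (tensor K AA A) (\<lambda>a b. pure_tensor K AA A (\<Delta> a) b) (\<Delta> x))
         = tensor_lift K (tensor K A AA) (\<lambda>a b. pure_tensor K A AA a (\<Delta> b)) (\<Delta> x))
    \<and> (\<forall>x\<in>carrier A. tensor_lift K A (\<lambda>a b. \<epsilon> a \<odot>\<^bsub>A\<^esub> b) (\<Delta> x) = x)
    \<and> (\<forall>x\<in>carrier A. tensor_lift K A (\<lambda>a b. \<epsilon> b \<odot>\<^bsub>A\<^esub> a) (\<Delta> x) = x))"


section \<open>Clifford algebras\<close>

datatype clifford_gen = Gen_G | Gen_X nat

definition clifford_gens :: "nat \<Rightarrow> clifford_gen set"
  where "clifford_gens n = insert Gen_G (Gen_X ` {1..n})"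

definition clifford_rels ::
  "('k, 'r) ring_scheme \<Rightarrow> nat \<Rightarrow> 'k \<Rightarrow> (nat \<Rightarrow> 'k) \<Rightarrow> (nat \<Rightarrow> 'k) \<Rightarrow> (nat \<Rightarrow> nat \<Rightarrow> 'k)
    \<Rightarrow> (clifford_gen list \<Rightarrow> 'k) set"
  where "clifford_rels K n \<alpha> \<beta> \<gamma> l =
    (let F = free_algebra K (clifford_gens n); g = free_gen K Gen_G; x = (\<lambda>i. free_gen K (Gen_X i)) in
       {g \<otimes>\<^bsub>F\<^esub> g \<ominus>\<^bsub>F\<^esub> \<alpha> \<odot>\<^bsub>F\<^esub> \<one>\<^bsub>F\<^esub>}
     \<union> {x i \<otimes>\<^bsub>F\<^esub> x i \<ominus>\<^bsub>F\<^esub> \<beta> i \<odot>\<^bsub>F\<^esub> \<one>\<^bsub>F\<^esub> | i. 1 \<le> i \<and> i \<le> n}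
     \<union> {(g \<otimes>\<^bsub>F\<^esub> x i \<oplus>\<^bsub>F\<^esub> x i \<otimes>\<^bsub>F\<^esub> g) \<ominus>\<^bsub>F\<^esub> \<gamma> i \<odot>\<^bsub>F\<^esub> \<one>\<^bsub>F\<^esub> | i. 1 \<le> i \<and> i \<le> n}
     \<union> {(x i \<otimes>\<^bsub>F\<^esub> x j \<oplus>\<^bsub>F\<^esub> x j \<otimes>\<^bsub>F\<^esub> x i) \<ominus>\<^bsub>F\<^esub> l i j \<odot>\<^bsub>F\<^esub> \<one>\<^bsub>F\<^esub> | i j. 1 \<le> i \<and> i < j \<and> j \<le> n})"

definition clifford ::
  "('k, 'r) ring_scheme \<Rightarrow> nat \<Rightarrow> 'k \<Rightarrow> (nat \<Rightarrow> 'k) \<Rightarrow> (nat \<Rightarrow> 'k) \<Rightarrow> (nat \<Rightarrow> nat \<Rightarrow> 'k)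
    \<Rightarrow> ('k, (clifford_gen list \<Rightarrow> 'k) set) module"
  where "clifford K n \<alpha> \<beta> \<gamma> l =
    (let F = free_algebra K (clifford_gens n) in
       quotient_algebra F (Idl\<^bsub>F\<^esub> (clifford_rels K n \<alpha> \<beta> \<gamma> l)))"

definition E_algebra :: "('k, 'r) ring_scheme \<Rightarrow> nat \<Rightarrow> ('k, (clifford_gen list \<Rightarrow> 'k) set) module"
  where "E_algebra K n = clifford K n \<one>\<^bsub>K\<^esub> (\<lambda>i. \<zero>\<^bsub>K\<^esub>) (\<lambda>i. \<zero>\<^bsub>K\<^esub>) (\<lambda>i j. \<zero>\<^bsub>K\<^esub>)"

end

theory Submission
  imports Defs "HOL-Combinatorics.Transposition"
begin

text \<open>
  Write \<open>Y s\<close> for the generators of the Clifford algebra and \<open>V\<close> for their span.  The relations say that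
  \<open>v \<mapsto> v\<^sup>2\<close> is a prescribed quadratic form on \<open>V\<close>.

  \<^bold>\<open>The counit determines the form.\<close>  A counit \<open>\<epsilon>\<close> is an algebra homomorphism to \<open>K\<close>, so with
  \<open>c s = \<epsilon> (Y s)\<close> the form is the square of the linear form \<open>c\<close>: all anticommutators are
  \<open>Y s \<cdot> Y t + Y t \<cdot> Y s = 2 c s c t\<close> (a \<open>rank_one_family\<close>).  If \<open>c \<noteq> 0\<close>, a linear change of generators moves
  \<open>c\<close> to the linear form with value 1 at \<open>g\<close> and 0 at the \<open>x\<^sub>i\<close>, whose square is the form of \<open>E(n)\<close>; by the
  universal property this is an isomorphism of algebras (\<open>isomorphic_E_algebra\<close>).

  \<^bold>\<open>The case \<open>c = 0\<close> is excluded by the comultiplication.\<close>  Then the algebra is an exterior algebra,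
  and \<open>G\<close> is a square-zero element with an \<open>\<epsilon>\<close>-derivation \<open>\<delta>\<close> such that \<open>\<delta> G = 1\<close>, read off from the homomorphism
  to the dual numbers that sends \<open>G\<close> to \<open>t\<close> and every \<open>X\<^sub>i\<close> to 0.  The counit axioms force
  \<open>\<Delta> G = G \<otimes> 1 + 1 \<otimes> G + \<dots>\<close> with a remainder in the tensor square of the augmentation ideal, hence
  \<open>(\<delta> \<otimes> \<delta>) ((\<Delta> G)\<^sup>2) = 2\<close>, whereas \<open>(\<Delta> G)\<^sup>2 = \<Delta> (G\<^sup>2) = 0\<close>
  (\<open>no_comultiplication_square_zero\<close>), and 2 is nonzero in \<open>K\<close>.

  \<^bold>\<open>Conversely\<close>, \<open>E(n)\<close> carries the comultiplication \<open>\<Delta> g = g \<otimes> g\<close>, \<open>\<Delta> x\<^sub>i = x\<^sub>i \<otimes> g + 1 \<otimes> x\<^sub>i\<close>.  An algebra isomorphic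
  to \<open>E(n)\<close> inherits generators with the same universal property, so \<open>\<Delta>\<close> and \<open>\<epsilon>\<close> are defined on it by their
  values on generators, and each axiom, being an equality of two algebra homomorphisms, is checked on
  generators (\<open>bialgebra_exists\<close>).

  The groundwork is the linear algebra of the concrete models.  Monoid algebras are free vector
  spaces, which gives associativity of convolution, the universal properties of free algebras and
  Clifford algebras, and the fact that the bilinearity relations span an ideal, always by comparing linear maps
  on a basis.
\<close>

section \<open>Linear maps and algebra homomorphisms\<close>

definition lin_map ::
  "('k, 'r) ring_scheme \<Rightarrow> ('k, 'a, 's) module_scheme \<Rightarrow> ('k, 'b, 't) module_scheme \<Rightarrow> ('a \<Rightarrow> 'b) set"
  where "lin_map K A B =
    {h \<in> carrier A \<rightarrow> carrier B. (\<forall>x\<in>carrier A. \<forall>y\<in>carrier A. h (x \<oplus>\<^bsub>A\<^esub> y) = h x \<oplus>\<^bsub>B\<^esub> h y)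
       \<and> (\<forall>c\<in>carrier K. \<forall>x\<in>carrier A. h (c \<odot>\<^bsub>A\<^esub> x) = c \<odot>\<^bsub>B\<^esub> h x)}"

lemma lin_mapI:
  assumes "\<And>x. x \<in> carrier A \<Longrightarrow> h x \<in> carrier B"
    and "\<And>x y. \<lbrakk>x \<in> carrier A; y \<in> carrier A\<rbrakk> \<Longrightarrow> h (x \<oplus>\<^bsub>A\<^esub> y) = h x \<oplus>\<^bsub>B\<^esub> h y"
    and "\<And>c x. \<lbrakk>c \<in> carrier K; x \<in> carrier A\<rbrakk> \<Longrightarrow> h (c \<odot>\<^bsub>A\<^esub> x) = c \<odot>\<^bsub>B\<^esub> h x"
  shows "h \<in> lin_map K A B"
  using assms by (auto simp: lin_map_def)

lemma lin_mapD:
  assumes "h \<in> lin_map K A B"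
  shows "x \<in> carrier A \<Longrightarrow> h x \<in> carrier B"
    and "\<lbrakk>x \<in> carrier A; y \<in> carrier A\<rbrakk> \<Longrightarrow> h (x \<oplus>\<^bsub>A\<^esub> y) = h x \<oplus>\<^bsub>B\<^esub> h y"
    and "\<lbrakk>c \<in> carrier K; x \<in> carrier A\<rbrakk> \<Longrightarrow> h (c \<odot>\<^bsub>A\<^esub> x) = c \<odot>\<^bsub>B\<^esub> h x"
  using assms by (auto simp: lin_map_def)

lemma lin_map_comp:
  assumes "h \<in> lin_map K A B" "g \<in> lin_map K B C"
  shows "(\<lambda>x. g (h x)) \<in> lin_map K A C"
  by (rule lin_mapI) (simp_all add: lin_mapD[OF assms(1)] lin_mapD[OF assms(2)])

lemma lin_map_zero:
  assumes "module K A" "module K B" "h \<in> lin_map K A B"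
  shows "h \<zero>\<^bsub>A\<^esub> = \<zero>\<^bsub>B\<^esub>"
proof -
  interpret A: module K A by fact
  interpret B: module K B by fact
  have "h (\<zero>\<^bsub>K\<^esub> \<odot>\<^bsub>A\<^esub> \<zero>\<^bsub>A\<^esub>) = \<zero>\<^bsub>K\<^esub> \<odot>\<^bsub>B\<^esub> h \<zero>\<^bsub>A\<^esub>"
    by (rule lin_mapD(3)[OF assms(3)]) auto
  then show ?thesis using lin_mapD(1)[OF assms(3)] by simp
qed

lemma lin_map_diff:
  assumes "module K A" "module K B" "h \<in> lin_map K A B" "x \<in> carrier A" "y \<in> carrier A"
  shows "h (x \<ominus>\<^bsub>A\<^esub> y) = h x \<ominus>\<^bsub>B\<^esub> h y"
proof -
  interpret A: module K A by fact
  interpret B: module K B by fact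
  note h = lin_mapD[OF assms(3)]
  have "h (x \<ominus>\<^bsub>A\<^esub> y) \<oplus>\<^bsub>B\<^esub> h y = h (x \<ominus>\<^bsub>A\<^esub> y \<oplus>\<^bsub>A\<^esub> y)"
    using assms(4,5) by (simp add: h)
  also have "x \<ominus>\<^bsub>A\<^esub> y \<oplus>\<^bsub>A\<^esub> y = x"
    using assms(4,5) by (simp add: A.M.minus_eq A.M.a_assoc A.M.l_neg)
  finally show ?thesis
    using assms(4,5) h(1) by (metis A.M.minus_closed B.M.add.inv_solve_right' B.M.minus_eq)
qed

lemma submodule_closed:
  assumes "module K A" "submodule N K A"
  shows "N \<subseteq> carrier A" "\<zero>\<^bsub>A\<^esub> \<in> N"
    and "\<lbrakk>x \<in> N; y \<in> N\<rbrakk> \<Longrightarrow> x \<oplus>\<^bsub>A\<^esub> y \<in> N"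
    and "\<lbrakk>c \<in> carrier K; x \<in> N\<rbrakk> \<Longrightarrow> c \<odot>\<^bsub>A\<^esub> x \<in> N"
proof -
  interpret A: module K A by fact
  note N = A.submoduleE[OF assms(2)]
  show "N \<subseteq> carrier A" by (rule N(1))
  show "\<zero>\<^bsub>A\<^esub> \<in> N"
    using N(1-3,5) by (metis A.M.l_neg ex_in_conv subsetD)
qed (use assms(2) module.submoduleE[OF assms] in auto)

text \<open>Closure under negatives follows from closure under scalars.\<close>

lemma submodule_by_smult:
  assumes "module K A" and sub: "N \<subseteq> carrier A" and zero: "\<zero>\<^bsub>A\<^esub> \<in> N"
    and add: "\<And>x y. \<lbrakk>x \<in> N; y \<in> N\<rbrakk> \<Longrightarrow> x \<oplus>\<^bsub>A\<^esub> y \<in> N"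
    and smult: "\<And>c x. \<lbrakk>c \<in> carrier K; x \<in> N\<rbrakk> \<Longrightarrow> c \<odot>\<^bsub>A\<^esub> x \<in> N"
  shows "submodule N K A"
proof -
  interpret A: module K A by fact
  show ?thesis
  proof (rule A.submoduleI[OF sub zero _ add smult])
    fix x assume x: "x \<in> N"
    then have "(\<ominus>\<^bsub>K\<^esub> \<one>\<^bsub>K\<^esub>) \<odot>\<^bsub>A\<^esub> x = \<ominus>\<^bsub>A\<^esub> x"
      using sub by (subst A.smult_l_minus) auto
    then show "\<ominus>\<^bsub>A\<^esub> x \<in> N" using smult[OF _ x, of "\<ominus>\<^bsub>K\<^esub> \<one>\<^bsub>K\<^esub>"] by simp
  qed
qed

lemma vimage_submodule:
  assumes A: "module K A" and B: "module K B" and h: "h \<in> lin_map K A B" and N: "submodule N K B"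
  shows "submodule {x \<in> carrier A. h x \<in> N} K A"
proof -
  interpret A: module K A by fact
  show ?thesis
    by (rule submodule_by_smult[OF A])
      (auto simp: lin_mapD[OF h] lin_map_zero[OF A B h] submodule_closed[OF B N])
qed

lemma equalizer_submodule:
  assumes A: "module K A" and B: "module K B" and g: "g \<in> lin_map K A B" and h: "h \<in> lin_map K A B"
  shows "submodule {x \<in> carrier A. g x = h x} K A"
proof -
  interpret A: module K A by fact
  show ?thesis
    by (rule submodule_by_smult[OF A])
      (auto simp: lin_mapD[OF g] lin_mapD[OF h] lin_map_zero[OF A B g] lin_map_zero[OF A B h])
qed

lemma kernel_submodule:
  assumes A: "module K A" and B: "module K B" and h: "h \<in> lin_map K A B"
  shows "submodule {x \<in> carrier A. h x = \<zero>\<^bsub>B\<^esub>} K A"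
proof -
  interpret B: module K B by fact
  have "(\<lambda>_. \<zero>\<^bsub>B\<^esub>) \<in> lin_map K A B" by (rule lin_mapI) auto
  from equalizer_submodule[OF A B h this] show ?thesis .
qed

lemma alg_homD:
  assumes "h \<in> alg_hom K A B"
  shows "x \<in> carrier A \<Longrightarrow> h x \<in> carrier B"
    and "\<lbrakk>x \<in> carrier A; y \<in> carrier A\<rbrakk> \<Longrightarrow> h (x \<oplus>\<^bsub>A\<^esub> y) = h x \<oplus>\<^bsub>B\<^esub> h y"
    and "\<lbrakk>x \<in> carrier A; y \<in> carrier A\<rbrakk> \<Longrightarrow> h (x \<otimes>\<^bsub>A\<^esub> y) = h x \<otimes>\<^bsub>B\<^esub> h y"
    and "\<lbrakk>c \<in> carrier K; x \<in> carrier A\<rbrakk> \<Longrightarrow> h (c \<odot>\<^bsub>A\<^esub> x) = c \<odot>\<^bsub>B\<^esub> h x"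
    and "h \<one>\<^bsub>A\<^esub> = \<one>\<^bsub>B\<^esub>"
  using assms by (auto simp: alg_hom_def ring_hom_def)

lemma alg_hom_lin_map: "h \<in> alg_hom K A B \<Longrightarrow> h \<in> lin_map K A B"
  by (rule lin_mapI) (auto simp: alg_homD)

lemma alg_homI:
  assumes "h \<in> lin_map K A B"
    and "\<And>x y. \<lbrakk>x \<in> carrier A; y \<in> carrier A\<rbrakk> \<Longrightarrow> h (x \<otimes>\<^bsub>A\<^esub> y) = h x \<otimes>\<^bsub>B\<^esub> h y"
    and "h \<one>\<^bsub>A\<^esub> = \<one>\<^bsub>B\<^esub>"
  shows "h \<in> alg_hom K A B"
  using assms by (auto simp: alg_hom_def lin_map_def intro!: ring_hom_memI)

lemma alg_hom_comp:
  assumes "h \<in> alg_hom K A B" "g \<in> alg_hom K B C"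
  shows "(\<lambda>x. g (h x)) \<in> alg_hom K A C"
  using assms by (auto intro!: alg_homI lin_mapI simp: alg_homD)

lemma alg_hom_id: "(\<lambda>x. x) \<in> alg_hom K A A"
  by (auto intro!: alg_homI lin_mapI)

lemma alg_hom_inv_into:
  assumes "assoc_algebra K A" "h \<in> alg_hom K A B" and bij: "bij_betw h (carrier A) (carrier B)"
  shows "inv_into (carrier A) h \<in> alg_hom K B A"
proof -
  interpret A: assoc_algebra K A by fact
  let ?g = "inv_into (carrier A) h"
  note h = alg_homD[OF assms(2)]
  have g: "?g y \<in> carrier A" "h (?g y) = y" if "y \<in> carrier B" for y
    using that bij by (auto simp: bij_betw_def f_inv_into_f inv_into_into)
  have gh: "?g (h x) = x" if "x \<in> carrier A" for x
    using that bij by (auto simp: bij_betw_def)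
  have "?g (x \<oplus>\<^bsub>B\<^esub> y) = ?g x \<oplus>\<^bsub>A\<^esub> ?g y" "?g (x \<otimes>\<^bsub>B\<^esub> y) = ?g x \<otimes>\<^bsub>A\<^esub> ?g y"
    if "x \<in> carrier B" "y \<in> carrier B" for x y
    using gh[of "?g x \<oplus>\<^bsub>A\<^esub> ?g y"] gh[of "?g x \<otimes>\<^bsub>A\<^esub> ?g y"] that by (auto simp: h g)
  moreover have "?g (c \<odot>\<^bsub>B\<^esub> x) = c \<odot>\<^bsub>A\<^esub> ?g x" if "c \<in> carrier K" "x \<in> carrier B" for c x
    using gh[of "c \<odot>\<^bsub>A\<^esub> ?g x"] that by (auto simp: h g)
  moreover have "?g \<one>\<^bsub>B\<^esub> = \<one>\<^bsub>A\<^esub>"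
    using gh[of "\<one>\<^bsub>A\<^esub>"] by (simp add: h)
  ultimately show ?thesis
    by (auto intro!: alg_homI lin_mapI simp: g)
qed

lemma (in assoc_algebra) assoc_algebra: "assoc_algebra K A" ..

lemma (in assoc_algebra) module: "module K A" ..

lemma assoc_algebraI:
  fixes K (structure) and A (structure)
  assumes "field K"
    and "\<And>x y. \<lbrakk>x \<in> carrier A; y \<in> carrier A\<rbrakk> \<Longrightarrow> x \<oplus>\<^bsub>A\<^esub> y \<in> carrier A"
    and "\<zero>\<^bsub>A\<^esub> \<in> carrier A"
    and "\<And>x y z. \<lbrakk>x \<in> carrier A; y \<in> carrier A; z \<in> carrier A\<rbrakk> \<Longrightarrow> (x \<oplus>\<^bsub>A\<^esub> y) \<oplus>\<^bsub>A\<^esub> z = x \<oplus>\<^bsub>A\<^esub> (y \<oplus>\<^bsub>A\<^esub> z)"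
    and "\<And>x y. \<lbrakk>x \<in> carrier A; y \<in> carrier A\<rbrakk> \<Longrightarrow> x \<oplus>\<^bsub>A\<^esub> y = y \<oplus>\<^bsub>A\<^esub> x"
    and "\<And>x. x \<in> carrier A \<Longrightarrow> \<zero>\<^bsub>A\<^esub> \<oplus>\<^bsub>A\<^esub> x = x"
    and "\<And>x. x \<in> carrier A \<Longrightarrow> \<exists>y\<in>carrier A. y \<oplus>\<^bsub>A\<^esub> x = \<zero>\<^bsub>A\<^esub>"
    and "\<And>c x. \<lbrakk>c \<in> carrier K; x \<in> carrier A\<rbrakk> \<Longrightarrow> c \<odot>\<^bsub>A\<^esub> x \<in> carrier A"
    and "\<And>c d x. \<lbrakk>c \<in> carrier K; d \<in> carrier K; x \<in> carrier A\<rbrakk> \<Longrightarrow>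
           (c \<oplus>\<^bsub>K\<^esub> d) \<odot>\<^bsub>A\<^esub> x = c \<odot>\<^bsub>A\<^esub> x \<oplus>\<^bsub>A\<^esub> d \<odot>\<^bsub>A\<^esub> x"
    and "\<And>c x y. \<lbrakk>c \<in> carrier K; x \<in> carrier A; y \<in> carrier A\<rbrakk> \<Longrightarrow>
           c \<odot>\<^bsub>A\<^esub> (x \<oplus>\<^bsub>A\<^esub> y) = c \<odot>\<^bsub>A\<^esub> x \<oplus>\<^bsub>A\<^esub> c \<odot>\<^bsub>A\<^esub> y"
    and "\<And>c d x. \<lbrakk>c \<in> carrier K; d \<in> carrier K; x \<in> carrier A\<rbrakk> \<Longrightarrow>
           (c \<otimes>\<^bsub>K\<^esub> d) \<odot>\<^bsub>A\<^esub> x = c \<odot>\<^bsub>A\<^esub> (d \<odot>\<^bsub>A\<^esub> x)"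
    and "\<And>x. x \<in> carrier A \<Longrightarrow> \<one>\<^bsub>K\<^esub> \<odot>\<^bsub>A\<^esub> x = x"
    and "\<And>x y. \<lbrakk>x \<in> carrier A; y \<in> carrier A\<rbrakk> \<Longrightarrow> x \<otimes>\<^bsub>A\<^esub> y \<in> carrier A"
    and "\<one>\<^bsub>A\<^esub> \<in> carrier A"
    and "\<And>x y z. \<lbrakk>x \<in> carrier A; y \<in> carrier A; z \<in> carrier A\<rbrakk> \<Longrightarrow> (x \<otimes>\<^bsub>A\<^esub> y) \<otimes>\<^bsub>A\<^esub> z = x \<otimes>\<^bsub>A\<^esub> (y \<otimes>\<^bsub>A\<^esub> z)"
    and "\<And>x. x \<in> carrier A \<Longrightarrow> \<one>\<^bsub>A\<^esub> \<otimes>\<^bsub>A\<^esub> x = x"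
    and "\<And>x. x \<in> carrier A \<Longrightarrow> x \<otimes>\<^bsub>A\<^esub> \<one>\<^bsub>A\<^esub> = x"
    and "\<And>x y z. \<lbrakk>x \<in> carrier A; y \<in> carrier A; z \<in> carrier A\<rbrakk> \<Longrightarrow>
           (x \<oplus>\<^bsub>A\<^esub> y) \<otimes>\<^bsub>A\<^esub> z = x \<otimes>\<^bsub>A\<^esub> z \<oplus>\<^bsub>A\<^esub> y \<otimes>\<^bsub>A\<^esub> z"
    and "\<And>x y z. \<lbrakk>x \<in> carrier A; y \<in> carrier A; z \<in> carrier A\<rbrakk> \<Longrightarrow>
           z \<otimes>\<^bsub>A\<^esub> (x \<oplus>\<^bsub>A\<^esub> y) = z \<otimes>\<^bsub>A\<^esub> x \<oplus>\<^bsub>A\<^esub> z \<otimes>\<^bsub>A\<^esub> y"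
    and "\<And>c x y. \<lbrakk>c \<in> carrier K; x \<in> carrier A; y \<in> carrier A\<rbrakk> \<Longrightarrow>
           (c \<odot>\<^bsub>A\<^esub> x) \<otimes>\<^bsub>A\<^esub> y = c \<odot>\<^bsub>A\<^esub> (x \<otimes>\<^bsub>A\<^esub> y)"
    and "\<And>c x y. \<lbrakk>c \<in> carrier K; x \<in> carrier A; y \<in> carrier A\<rbrakk> \<Longrightarrow>
           x \<otimes>\<^bsub>A\<^esub> (c \<odot>\<^bsub>A\<^esub> y) = c \<odot>\<^bsub>A\<^esub> (x \<otimes>\<^bsub>A\<^esub> y)"
  shows "assoc_algebra K A"
proof -
  interpret K: field K by fact
  have cr: "cring K" by unfold_locales
  have ag: "abelian_group A" by (rule abelian_groupI) (use assms in auto)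
  have "ring A"
    by (rule ringI) (use assms ag in \<open>auto intro!: monoidI\<close>)
  moreover have "module K A"
    by (rule moduleI) (use assms ag cr in auto)
  ultimately show ?thesis
    using assms by (auto intro!: assoc_algebra.intro assoc_algebra_axioms.intro)
qed

text \<open>All axioms of an algebra are identities, or assert the existence of an element that the map
  can transport, so they pass to surjective images.\<close>

lemma assoc_algebra_surj_image:
  assumes "assoc_algebra K A"
    and im: "p ` carrier A = carrier B"
    and add: "\<And>x y. \<lbrakk>x \<in> carrier A; y \<in> carrier A\<rbrakk> \<Longrightarrow> p (x \<oplus>\<^bsub>A\<^esub> y) = p x \<oplus>\<^bsub>B\<^esub> p y"
    and mult: "\<And>x y. \<lbrakk>x \<in> carrier A; y \<in> carrier A\<rbrakk> \<Longrightarrow> p (x \<otimes>\<^bsub>A\<^esub> y) = p x \<otimes>\<^bsub>B\<^esub> p y"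
    and smult: "\<And>c x. \<lbrakk>c \<in> carrier K; x \<in> carrier A\<rbrakk> \<Longrightarrow> p (c \<odot>\<^bsub>A\<^esub> x) = c \<odot>\<^bsub>B\<^esub> p x"
    and zero: "p \<zero>\<^bsub>A\<^esub> = \<zero>\<^bsub>B\<^esub>" and one: "p \<one>\<^bsub>A\<^esub> = \<one>\<^bsub>B\<^esub>"
  shows "assoc_algebra K B"
proof -
  interpret A: assoc_algebra K A by fact
  note ops = add[symmetric] mult[symmetric] smult[symmetric] zero[symmetric] one[symmetric]
  show ?thesis
  proof (rule assoc_algebraI, goal_cases)
    case 1 show ?case by (rule A.field_axioms)
  next
    case (7 x)
    then obtain a where a: "a \<in> carrier A" "x = p a" using im by blast
    then have "p (\<ominus>\<^bsub>A\<^esub> a) \<oplus>\<^bsub>B\<^esub> x = \<zero>\<^bsub>B\<^esub>" by (simp add: ops A.l_neg)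
    then show ?case using a im by blast
  qed (unfold im[symmetric], (elim imageE)?,
       auto simp: ops A.a_ac A.m_assoc A.smult_l_distr A.smult_r_distr A.smult_assoc1
         A.l_distr A.r_distr A.smult_mult_left A.smult_mult_right)
qed

section \<open>Linear extension to a monoid algebra\<close>

text \<open>The linear map on the free vector space that extends \<open>\<phi>\<close> from the basis.\<close>

definition lin_ext ::
  "('k, 'r) ring_scheme \<Rightarrow> ('k, 'c, 's) module_scheme \<Rightarrow> ('m \<Rightarrow> 'c) \<Rightarrow> ('m \<Rightarrow> 'k) \<Rightarrow> 'c"
  where "lin_ext K C \<phi> f = (\<Oplus>\<^bsub>C\<^esub>p\<in>{p. f p \<noteq> \<zero>\<^bsub>K\<^esub>}. f p \<odot>\<^bsub>C\<^esub> \<phi> p)"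

locale monoid_alg = K: field K + M: monoid M
  for K :: "('k, 'r) ring_scheme" and M :: "('m, 's) monoid_scheme"
begin

abbreviation F :: "('k, 'm \<Rightarrow> 'k) module" where "F \<equiv> monoid_algebra K M"

abbreviation e :: "'m \<Rightarrow> 'm \<Rightarrow> 'k" where "e \<equiv> basis_elem K"

lemma F_carrier_iff:
  "f \<in> carrier F \<longleftrightarrow> (\<forall>m\<in>carrier M. f m \<in> carrier K) \<and> (\<forall>m. m \<notin> carrier M \<longrightarrow> f m = \<zero>\<^bsub>K\<^esub>)
     \<and> finite {m. f m \<noteq> \<zero>\<^bsub>K\<^esub>}"
  by (simp add: monoid_algebra_def)

lemma F_simps:
  "(f \<oplus>\<^bsub>F\<^esub> g) m = f m \<oplus>\<^bsub>K\<^esub> g m" "(c \<odot>\<^bsub>F\<^esub> f) m = c \<otimes>\<^bsub>K\<^esub> f m" "\<zero>\<^bsub>F\<^esub> = (\<lambda>m. \<zero>\<^bsub>K\<^esub>)"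
  "\<one>\<^bsub>F\<^esub> = e \<one>\<^bsub>M\<^esub>"
  by (auto simp: monoid_algebra_def basis_elem_def)

lemma F_value: "f \<in> carrier F \<Longrightarrow> f m \<in> carrier K"
  by (cases "m \<in> carrier M") (auto simp: F_carrier_iff)

lemma F_support: "f \<in> carrier F \<Longrightarrow> f m \<noteq> \<zero>\<^bsub>K\<^esub> \<Longrightarrow> m \<in> carrier M"
  by (auto simp: F_carrier_iff)

lemma F_finite: "f \<in> carrier F \<Longrightarrow> finite {m. f m \<noteq> \<zero>\<^bsub>K\<^esub>}"
  by (auto simp: F_carrier_iff)

lemma e_closed: "m \<in> carrier M \<Longrightarrow> e m \<in> carrier F"
  by (auto simp: F_carrier_iff basis_elem_def intro: finite_subset[of _ "{m}"])

lemma F_carrierI: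
  assumes "\<And>m. f m \<in> carrier K" "finite S" "S \<subseteq> carrier M" "\<And>m. f m \<noteq> \<zero>\<^bsub>K\<^esub> \<Longrightarrow> m \<in> S"
  shows "f \<in> carrier F"
  using assms by (auto simp: F_carrier_iff intro: finite_subset[of _ S])

lemma F_add_closed:
  assumes "f \<in> carrier F" "g \<in> carrier F" shows "f \<oplus>\<^bsub>F\<^esub> g \<in> carrier F"
  using assms by (intro F_carrierI[where S = "{m. f m \<noteq> \<zero>\<^bsub>K\<^esub>} \<union> {m. g m \<noteq> \<zero>\<^bsub>K\<^esub>}"])
    (auto simp: F_simps F_value F_finite F_support)

lemma F_smult_closed:
  assumes "c \<in> carrier K" "f \<in> carrier F" shows "c \<odot>\<^bsub>F\<^esub> f \<in> carrier F"
  using assms by (intro F_carrierI[where S = "{m. f m \<noteq> \<zero>\<^bsub>K\<^esub>}"])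
    (auto simp: F_simps F_value F_finite F_support)

lemma F_module: "module K F"
proof (rule moduleI)
  show "cring K" by unfold_locales
  show "abelian_group F"
  proof (rule abelian_groupI, goal_cases)
    case (6 f)
    have "(\<lambda>m. \<ominus>\<^bsub>K\<^esub> f m) \<in> carrier F"
      using 6 by (intro F_carrierI[where S = "{m. f m \<noteq> \<zero>\<^bsub>K\<^esub>}"])
        (auto simp: F_value F_finite F_support)
    moreover have "(\<lambda>m. \<ominus>\<^bsub>K\<^esub> f m) \<oplus>\<^bsub>F\<^esub> f = \<zero>\<^bsub>F\<^esub>"
      using 6 by (auto simp: F_simps F_value K.l_neg)
    ultimately show ?case by blast
  next
    case 2 show ?case by (auto simp: F_carrier_iff F_simps)
  qed (auto simp: F_add_closed F_simps F_value K.a_ac fun_eq_iff)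
qed (auto simp: F_smult_closed F_simps F_value K.l_distr K.r_distr K.m_assoc fun_eq_iff)

lemma lin_ext_superset:
  assumes "module K C" "\<phi> \<in> carrier M \<rightarrow> carrier C" "f \<in> carrier F"
    and "finite S" "S \<subseteq> carrier M" "{m. f m \<noteq> \<zero>\<^bsub>K\<^esub>} \<subseteq> S"
  shows "lin_ext K C \<phi> f = (\<Oplus>\<^bsub>C\<^esub>p\<in>S. f p \<odot>\<^bsub>C\<^esub> \<phi> p)"
proof -
  interpret C: module K C by fact
  have "\<phi> p \<in> carrier C" if "p \<in> S" for p using assms(2,5) that by auto
  then show ?thesis unfolding lin_ext_def
    using assms by (intro C.add.finprod_mono_neutral_cong_left) (auto simp: F_value)
qed

lemma lin_ext_lin_map:
  assumes "module K C" "\<phi> \<in> carrier M \<rightarrow> carrier C"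
  shows "lin_ext K C \<phi> \<in> lin_map K F C"
proof -
  interpret C: module K C by fact
  interpret F: module K F by (rule F_module)
  have \<phi>: "\<phi> p \<in> carrier C" if "p \<in> carrier M" for p using assms(2) that by auto
  show ?thesis
  proof (rule lin_mapI)
    fix f assume f: "f \<in> carrier F"
    show "lin_ext K C \<phi> f \<in> carrier C"
      unfolding lin_ext_def using F_support[OF f] \<phi> f
      by (intro C.M.finsum_closed) (auto simp: F_value)
    { fix g assume g: "g \<in> carrier F"
      let ?S = "{m. f m \<noteq> \<zero>\<^bsub>K\<^esub>} \<union> {m. g m \<noteq> \<zero>\<^bsub>K\<^esub>}"
      have S: "finite ?S" "?S \<subseteq> carrier M"
        using f g by (auto simp: F_finite F_support)
      have "lin_ext K C \<phi> (f \<oplus>\<^bsub>F\<^esub> g) = (\<Oplus>\<^bsub>C\<^esub>p\<in>?S. (f \<oplus>\<^bsub>F\<^esub> g) p \<odot>\<^bsub>C\<^esub> \<phi> p)"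
        using f g S by (intro lin_ext_superset) (auto simp: F_simps intro!: assms)
      also have "\<dots> = (\<Oplus>\<^bsub>C\<^esub>p\<in>?S. f p \<odot>\<^bsub>C\<^esub> \<phi> p \<oplus>\<^bsub>C\<^esub> g p \<odot>\<^bsub>C\<^esub> \<phi> p)"
        using f g S \<phi> by (intro C.M.finsum_cong') (auto simp: F_simps F_value C.smult_l_distr F_support)
      also have "\<dots> = (\<Oplus>\<^bsub>C\<^esub>p\<in>?S. f p \<odot>\<^bsub>C\<^esub> \<phi> p) \<oplus>\<^bsub>C\<^esub> (\<Oplus>\<^bsub>C\<^esub>p\<in>?S. g p \<odot>\<^bsub>C\<^esub> \<phi> p)"
        using f g S \<phi> by (intro C.M.finsum_addf) (auto simp: F_value F_support)
      also have "\<dots> = lin_ext K C \<phi> f \<oplus>\<^bsub>C\<^esub> lin_ext K C \<phi> g"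
        using f g S by (simp add: lin_ext_superset[OF assms, of _ ?S] Collect_mono_iff sup.coboundedI1 sup.coboundedI2)
      finally show "lin_ext K C \<phi> (f \<oplus>\<^bsub>F\<^esub> g) = lin_ext K C \<phi> f \<oplus>\<^bsub>C\<^esub> lin_ext K C \<phi> g" . }
    fix c assume c: "c \<in> carrier K"
    let ?S = "{m. f m \<noteq> \<zero>\<^bsub>K\<^esub>}"
    have S: "finite ?S" "?S \<subseteq> carrier M"
      using f by (auto simp: F_finite F_support)
    have "lin_ext K C \<phi> (c \<odot>\<^bsub>F\<^esub> f) = (\<Oplus>\<^bsub>C\<^esub>p\<in>?S. (c \<odot>\<^bsub>F\<^esub> f) p \<odot>\<^bsub>C\<^esub> \<phi> p)"
      using f c S by (intro lin_ext_superset) (auto simp: F_simps intro!: assms)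
    also have "\<dots> = (\<Oplus>\<^bsub>C\<^esub>p\<in>?S. c \<odot>\<^bsub>C\<^esub> (f p \<odot>\<^bsub>C\<^esub> \<phi> p))"
      using f c S \<phi> by (intro C.M.finsum_cong') (auto simp: F_simps F_value C.smult_assoc1 F_support)
    also have "\<dots> = c \<odot>\<^bsub>C\<^esub> (\<Oplus>\<^bsub>C\<^esub>p\<in>?S. f p \<odot>\<^bsub>C\<^esub> \<phi> p)"
      using f c S \<phi> by (intro C.finsum_smult_ldistr[symmetric]) (auto simp: F_value F_support)
    finally show "lin_ext K C \<phi> (c \<odot>\<^bsub>F\<^esub> f) = c \<odot>\<^bsub>C\<^esub> lin_ext K C \<phi> f"
      by (simp add: lin_ext_def)
  qed
qed

lemma lin_ext_basis:
  assumes "module K C" "\<phi> \<in> carrier M \<rightarrow> carrier C" "m \<in> carrier M"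
  shows "lin_ext K C \<phi> (e m) = \<phi> m"
proof -
  interpret C: module K C by fact
  have "lin_ext K C \<phi> (e m) = (\<Oplus>\<^bsub>C\<^esub>p\<in>{m}. e m p \<odot>\<^bsub>C\<^esub> \<phi> p)"
    using assms e_closed[OF assms(3)] by (intro lin_ext_superset) (auto simp: basis_elem_def)
  also have "\<dots> = \<phi> m" using assms by (auto simp: basis_elem_def Pi_def)
  finally show ?thesis .
qed

text \<open>Remove the points of the support one at a time.\<close>

lemma basis_spans:
  assumes W: "submodule W K F" and basis: "\<And>m. m \<in> carrier M \<Longrightarrow> e m \<in> W"
    and f: "f \<in> carrier F"
  shows "f \<in> W"
proof -
  note W = submodule_closed[OF F_module W]
  have step: "finite S \<Longrightarrow> S \<subseteq> carrier M \<Longrightarrow> f \<in> carrier F \<Longrightarrow> (\<And>m. f m \<noteq> \<zero>\<^bsub>K\<^esub> \<Longrightarrow> m \<in> S) \<Longrightarrow> f \<in> W" for S f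
  proof (induction S arbitrary: f rule: finite_induct)
    case empty
    then have "f = \<zero>\<^bsub>F\<^esub>" by (auto simp: F_simps)
    then show ?case using W(2) by simp
  next
    case (insert m S)
    let ?f = "f(m := \<zero>\<^bsub>K\<^esub>)"
    have f': "?f \<in> carrier F" using insert.prems insert.hyps F_value[OF insert.prems(2)]
      by (intro F_carrierI[where S = "insert m S"]) (auto split: if_splits)
    have em: "e m \<in> W" "e m \<in> carrier F" "f m \<in> carrier K"
      using insert.prems F_value by (auto intro: e_closed basis)
    have dec: "f = ?f \<oplus>\<^bsub>F\<^esub> f m \<odot>\<^bsub>F\<^esub> e m"
      using insert.prems em F_value by (auto simp: fun_eq_iff F_simps basis_elem_def)
    have "m' \<in> S" if "?f m' \<noteq> \<zero>\<^bsub>K\<^esub>" for m'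
      using that insert.prems(3)[of m'] by (auto split: if_splits)
    then have "?f \<in> W" using insert.prems(1) f' by (intro insert.IH) blast+
    then have "?f \<oplus>\<^bsub>F\<^esub> f m \<odot>\<^bsub>F\<^esub> e m \<in> W" using em by (intro W(3) W(4))
    then show ?case using dec by metis
  qed
  have "{m. f m \<noteq> \<zero>\<^bsub>K\<^esub>} \<subseteq> carrier M" using F_support[OF f] by blast
  then show ?thesis by (rule step[OF F_finite[OF f] _ f]) simp
qed

lemma lin_map_eq_on_basis:
  assumes "module K C" "g \<in> lin_map K F C" "h \<in> lin_map K F C"
    and "\<And>m. m \<in> carrier M \<Longrightarrow> g (e m) = h (e m)"
    and "f \<in> carrier F"
  shows "g f = h f"
  using basis_spans[OF equalizer_submodule[OF F_module assms(1-3)] _ assms(5)] assms(4) e_closed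
  by blast

text \<open>Enlarging the index set of the convolution sum to a rectangle makes it visibly bilinear.\<close>

lemma F_mult_rectangle:
  assumes "f \<in> carrier F" "g \<in> carrier F" "finite S" "finite T" "{a. f a \<noteq> \<zero>\<^bsub>K\<^esub>} \<subseteq> S" "{b. g b \<noteq> \<zero>\<^bsub>K\<^esub>} \<subseteq> T"
  shows "(f \<otimes>\<^bsub>F\<^esub> g) m =
    (\<Oplus>\<^bsub>K\<^esub>p\<in>{p \<in> S \<times> T. fst p \<otimes>\<^bsub>M\<^esub> snd p = m}. f (fst p) \<otimes>\<^bsub>K\<^esub> g (snd p))"
  unfolding monoid_algebra_def partial_object.simps monoid.simps
  using assms by (intro K.add.finprod_mono_neutral_cong_left) (auto simp: F_value)

lemma F_mult_closed:
  assumes f: "f \<in> carrier F" and g: "g \<in> carrier F" shows "f \<otimes>\<^bsub>F\<^esub> g \<in> carrier F"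
proof (rule F_carrierI)
  let ?S = "{a. f a \<noteq> \<zero>\<^bsub>K\<^esub>}" and ?T = "{b. g b \<noteq> \<zero>\<^bsub>K\<^esub>}"
  note eq = F_mult_rectangle[OF f g F_finite[OF f] F_finite[OF g] order_refl order_refl]
  show "(f \<otimes>\<^bsub>F\<^esub> g) m \<in> carrier K" for m
    unfolding eq using f g by (intro K.finsum_closed) (auto simp: F_value)
  let ?U = "(\<lambda>p. fst p \<otimes>\<^bsub>M\<^esub> snd p) ` (?S \<times> ?T)"
  show "finite ?U" using f g by (auto simp: F_finite)
  show "?U \<subseteq> carrier M" using F_support[OF f] F_support[OF g] by auto
  show "m \<in> ?U" if "(f \<otimes>\<^bsub>F\<^esub> g) m \<noteq> \<zero>\<^bsub>K\<^esub>" for m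
  proof (rule ccontr)
    assume "m \<notin> ?U"
    then have "{p \<in> ?S \<times> ?T. fst p \<otimes>\<^bsub>M\<^esub> snd p = m} = {}" by blast
    then show False using that unfolding eq by (metis K.finsum_empty)
  qed
qed

lemma F_mult_left_lin_map:
  assumes g: "g \<in> carrier F" shows "(\<lambda>f. f \<otimes>\<^bsub>F\<^esub> g) \<in> lin_map K F F"
proof (rule lin_mapI)
  interpret F: module K F by (rule F_module)
  let ?T = "{b. g b \<noteq> \<zero>\<^bsub>K\<^esub>}"
  fix f assume f: "f \<in> carrier F"
  show "f \<otimes>\<^bsub>F\<^esub> g \<in> carrier F" using f g by (rule F_mult_closed)
  { fix f' assume f': "f' \<in> carrier F"
    let ?S = "{a. f a \<noteq> \<zero>\<^bsub>K\<^esub>} \<union> {a. f' a \<noteq> \<zero>\<^bsub>K\<^esub>}"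
    have eq: "(f'' \<otimes>\<^bsub>F\<^esub> g) m = (\<Oplus>\<^bsub>K\<^esub>p\<in>{p \<in> ?S \<times> ?T. fst p \<otimes>\<^bsub>M\<^esub> snd p = m}. f'' (fst p) \<otimes>\<^bsub>K\<^esub> g (snd p))"
      if "f'' \<in> carrier F" "{a. f'' a \<noteq> \<zero>\<^bsub>K\<^esub>} \<subseteq> ?S" for f'' m
      using that f f' g by (intro F_mult_rectangle) (auto simp: F_finite)
    have s: "{a. (f \<oplus>\<^bsub>F\<^esub> f') a \<noteq> \<zero>\<^bsub>K\<^esub>} \<subseteq> ?S" using f f' by (auto simp: F_simps)
    show "(f \<oplus>\<^bsub>F\<^esub> f') \<otimes>\<^bsub>F\<^esub> g = f \<otimes>\<^bsub>F\<^esub> g \<oplus>\<^bsub>F\<^esub> f' \<otimes>\<^bsub>F\<^esub> g"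
    proof
      fix m
      let ?P = "{p \<in> ?S \<times> ?T. fst p \<otimes>\<^bsub>M\<^esub> snd p = m}"
      have "(\<Oplus>\<^bsub>K\<^esub>p\<in>?P. (f \<oplus>\<^bsub>F\<^esub> f') (fst p) \<otimes>\<^bsub>K\<^esub> g (snd p)) =
        (\<Oplus>\<^bsub>K\<^esub>p\<in>?P. f (fst p) \<otimes>\<^bsub>K\<^esub> g (snd p) \<oplus>\<^bsub>K\<^esub> f' (fst p) \<otimes>\<^bsub>K\<^esub> g (snd p))"
        using f f' g by (intro K.finsum_cong') (auto simp: F_simps F_value K.l_distr)
      also have "\<dots> = (\<Oplus>\<^bsub>K\<^esub>p\<in>?P. f (fst p) \<otimes>\<^bsub>K\<^esub> g (snd p)) \<oplus>\<^bsub>K\<^esub> (\<Oplus>\<^bsub>K\<^esub>p\<in>?P. f' (fst p) \<otimes>\<^bsub>K\<^esub> g (snd p))"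
        using f f' g by (intro K.finsum_addf) (auto simp: F_value)
      finally show "((f \<oplus>\<^bsub>F\<^esub> f') \<otimes>\<^bsub>F\<^esub> g) m = (f \<otimes>\<^bsub>F\<^esub> g \<oplus>\<^bsub>F\<^esub> f' \<otimes>\<^bsub>F\<^esub> g) m"
        using f f' s by (simp add: eq F_simps(1)[of "f \<otimes>\<^bsub>F\<^esub> g"] F.a_closed)
    qed }
  fix c assume c: "c \<in> carrier K"
  let ?S = "{a. f a \<noteq> \<zero>\<^bsub>K\<^esub>}"
  have eq: "(f'' \<otimes>\<^bsub>F\<^esub> g) m = (\<Oplus>\<^bsub>K\<^esub>p\<in>{p \<in> ?S \<times> ?T. fst p \<otimes>\<^bsub>M\<^esub> snd p = m}. f'' (fst p) \<otimes>\<^bsub>K\<^esub> g (snd p))"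
    if "f'' \<in> carrier F" "{a. f'' a \<noteq> \<zero>\<^bsub>K\<^esub>} \<subseteq> ?S" for f'' m
    using that f g by (intro F_mult_rectangle) (auto simp: F_finite)
  have s: "{a. (c \<odot>\<^bsub>F\<^esub> f) a \<noteq> \<zero>\<^bsub>K\<^esub>} \<subseteq> ?S" using f c by (auto simp: F_simps)
  show "(c \<odot>\<^bsub>F\<^esub> f) \<otimes>\<^bsub>F\<^esub> g = c \<odot>\<^bsub>F\<^esub> (f \<otimes>\<^bsub>F\<^esub> g)"
  proof
    fix m
    let ?P = "{p \<in> ?S \<times> ?T. fst p \<otimes>\<^bsub>M\<^esub> snd p = m}"
    have fin: "finite ?P" using f g by (auto intro: finite_subset[of _ "?S \<times> ?T"] simp: F_finite)
    have "(\<Oplus>\<^bsub>K\<^esub>p\<in>?P. (c \<odot>\<^bsub>F\<^esub> f) (fst p) \<otimes>\<^bsub>K\<^esub> g (snd p)) =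
      (\<Oplus>\<^bsub>K\<^esub>p\<in>?P. c \<otimes>\<^bsub>K\<^esub> (f (fst p) \<otimes>\<^bsub>K\<^esub> g (snd p)))"
      using f c g by (intro K.finsum_cong') (auto simp: F_simps F_value K.m_assoc)
    also have "\<dots> = c \<otimes>\<^bsub>K\<^esub> (\<Oplus>\<^bsub>K\<^esub>p\<in>?P. f (fst p) \<otimes>\<^bsub>K\<^esub> g (snd p))"
      using f c g fin by (intro K.finsum_rdistr[symmetric]) (auto simp: F_value)
    finally show "((c \<odot>\<^bsub>F\<^esub> f) \<otimes>\<^bsub>F\<^esub> g) m = (c \<odot>\<^bsub>F\<^esub> (f \<otimes>\<^bsub>F\<^esub> g)) m"
      using f c s by (simp add: eq F_simps(2)[of c "f \<otimes>\<^bsub>F\<^esub> g"] F.smult_closed)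
  qed
qed

lemma F_mult_right_lin_map:
  assumes g: "g \<in> carrier F" shows "(\<lambda>f. g \<otimes>\<^bsub>F\<^esub> f) \<in> lin_map K F F"
proof (rule lin_mapI)
  interpret F: module K F by (rule F_module)
  let ?T = "{b. g b \<noteq> \<zero>\<^bsub>K\<^esub>}"
  fix f assume f: "f \<in> carrier F"
  show "g \<otimes>\<^bsub>F\<^esub> f \<in> carrier F" using g f by (rule F_mult_closed)
  { fix f' assume f': "f' \<in> carrier F"
    let ?S = "{a. f a \<noteq> \<zero>\<^bsub>K\<^esub>} \<union> {a. f' a \<noteq> \<zero>\<^bsub>K\<^esub>}"
    have eq: "(g \<otimes>\<^bsub>F\<^esub> f'') m = (\<Oplus>\<^bsub>K\<^esub>p\<in>{p \<in> ?T \<times> ?S. fst p \<otimes>\<^bsub>M\<^esub> snd p = m}. g (fst p) \<otimes>\<^bsub>K\<^esub> f'' (snd p))"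
      if "f'' \<in> carrier F" "{a. f'' a \<noteq> \<zero>\<^bsub>K\<^esub>} \<subseteq> ?S" for f'' m
      using that f f' g by (intro F_mult_rectangle) (auto simp: F_finite)
    have s: "{a. (f \<oplus>\<^bsub>F\<^esub> f') a \<noteq> \<zero>\<^bsub>K\<^esub>} \<subseteq> ?S" using f f' by (auto simp: F_simps)
    show "g \<otimes>\<^bsub>F\<^esub> (f \<oplus>\<^bsub>F\<^esub> f') = g \<otimes>\<^bsub>F\<^esub> f \<oplus>\<^bsub>F\<^esub> g \<otimes>\<^bsub>F\<^esub> f'"
    proof
      fix m
      let ?P = "{p \<in> ?T \<times> ?S. fst p \<otimes>\<^bsub>M\<^esub> snd p = m}"
      have "(\<Oplus>\<^bsub>K\<^esub>p\<in>?P. g (fst p) \<otimes>\<^bsub>K\<^esub> (f \<oplus>\<^bsub>F\<^esub> f') (snd p)) =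
        (\<Oplus>\<^bsub>K\<^esub>p\<in>?P. g (fst p) \<otimes>\<^bsub>K\<^esub> f (snd p) \<oplus>\<^bsub>K\<^esub> g (fst p) \<otimes>\<^bsub>K\<^esub> f' (snd p))"
        using f f' g by (intro K.finsum_cong') (auto simp: F_simps F_value K.r_distr)
      also have "\<dots> = (\<Oplus>\<^bsub>K\<^esub>p\<in>?P. g (fst p) \<otimes>\<^bsub>K\<^esub> f (snd p)) \<oplus>\<^bsub>K\<^esub> (\<Oplus>\<^bsub>K\<^esub>p\<in>?P. g (fst p) \<otimes>\<^bsub>K\<^esub> f' (snd p))"
        using f f' g by (intro K.finsum_addf) (auto simp: F_value)
      finally show "(g \<otimes>\<^bsub>F\<^esub> (f \<oplus>\<^bsub>F\<^esub> f')) m = (g \<otimes>\<^bsub>F\<^esub> f \<oplus>\<^bsub>F\<^esub> g \<otimes>\<^bsub>F\<^esub> f') m"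
        using f f' s by (simp add: eq F_simps(1)[of "g \<otimes>\<^bsub>F\<^esub> f"] F.a_closed)
    qed }
  fix c assume c: "c \<in> carrier K"
  let ?S = "{a. f a \<noteq> \<zero>\<^bsub>K\<^esub>}"
  have eq: "(g \<otimes>\<^bsub>F\<^esub> f'') m = (\<Oplus>\<^bsub>K\<^esub>p\<in>{p \<in> ?T \<times> ?S. fst p \<otimes>\<^bsub>M\<^esub> snd p = m}. g (fst p) \<otimes>\<^bsub>K\<^esub> f'' (snd p))"
    if "f'' \<in> carrier F" "{a. f'' a \<noteq> \<zero>\<^bsub>K\<^esub>} \<subseteq> ?S" for f'' m
    using that f g by (intro F_mult_rectangle) (auto simp: F_finite)
  have s: "{a. (c \<odot>\<^bsub>F\<^esub> f) a \<noteq> \<zero>\<^bsub>K\<^esub>} \<subseteq> ?S" using f c by (auto simp: F_simps)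
  show "g \<otimes>\<^bsub>F\<^esub> (c \<odot>\<^bsub>F\<^esub> f) = c \<odot>\<^bsub>F\<^esub> (g \<otimes>\<^bsub>F\<^esub> f)"
  proof
    fix m
    let ?P = "{p \<in> ?T \<times> ?S. fst p \<otimes>\<^bsub>M\<^esub> snd p = m}"
    have fin: "finite ?P" using f g by (auto intro: finite_subset[of _ "?T \<times> ?S"] simp: F_finite)
    have "(\<Oplus>\<^bsub>K\<^esub>p\<in>?P. g (fst p) \<otimes>\<^bsub>K\<^esub> (c \<odot>\<^bsub>F\<^esub> f) (snd p)) =
      (\<Oplus>\<^bsub>K\<^esub>p\<in>?P. c \<otimes>\<^bsub>K\<^esub> (g (fst p) \<otimes>\<^bsub>K\<^esub> f (snd p)))"
      using f c g by (intro K.finsum_cong') (auto simp: F_simps F_value K.m_lcomm)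
    also have "\<dots> = c \<otimes>\<^bsub>K\<^esub> (\<Oplus>\<^bsub>K\<^esub>p\<in>?P. g (fst p) \<otimes>\<^bsub>K\<^esub> f (snd p))"
      using f c g fin by (intro K.finsum_rdistr[symmetric]) (auto simp: F_value)
    finally show "(g \<otimes>\<^bsub>F\<^esub> (c \<odot>\<^bsub>F\<^esub> f)) m = (c \<odot>\<^bsub>F\<^esub> (g \<otimes>\<^bsub>F\<^esub> f)) m"
      using f c s by (simp add: eq F_simps(2)[of c "g \<otimes>\<^bsub>F\<^esub> f"] F.smult_closed)
  qed
qed

lemma e_mult:
  assumes "a \<in> carrier M" "b \<in> carrier M"
  shows "e a \<otimes>\<^bsub>F\<^esub> e b = e (a \<otimes>\<^bsub>M\<^esub> b)"
proof
  fix m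
  have "(e a \<otimes>\<^bsub>F\<^esub> e b) m =
     (\<Oplus>\<^bsub>K\<^esub>p\<in>{p \<in> {a} \<times> {b}. fst p \<otimes>\<^bsub>M\<^esub> snd p = m}. e a (fst p) \<otimes>\<^bsub>K\<^esub> e b (snd p))"
    using e_closed[OF assms(1)] e_closed[OF assms(2)]
    by (intro F_mult_rectangle) (auto simp: basis_elem_def)
  also have "{p \<in> {a} \<times> {b}. fst p \<otimes>\<^bsub>M\<^esub> snd p = m} = (if a \<otimes>\<^bsub>M\<^esub> b = m then {(a, b)} else {})"
    by auto
  finally show "(e a \<otimes>\<^bsub>F\<^esub> e b) m = e (a \<otimes>\<^bsub>M\<^esub> b) m"
    by (auto simp: basis_elem_def)
qed

lemma bilin_eq_on_basis:
  assumes "module K C"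
    and "\<And>g. g \<in> carrier F \<Longrightarrow> (\<lambda>f. \<phi> f g) \<in> lin_map K F C"
    and "\<And>f. f \<in> carrier F \<Longrightarrow> (\<lambda>g. \<phi> f g) \<in> lin_map K F C"
    and "\<And>g. g \<in> carrier F \<Longrightarrow> (\<lambda>f. \<psi> f g) \<in> lin_map K F C"
    and "\<And>f. f \<in> carrier F \<Longrightarrow> (\<lambda>g. \<psi> f g) \<in> lin_map K F C"
    and "\<And>a b. \<lbrakk>a \<in> carrier M; b \<in> carrier M\<rbrakk> \<Longrightarrow> \<phi> (e a) (e b) = \<psi> (e a) (e b)"
    and f: "f \<in> carrier F" and g: "g \<in> carrier F"
  shows "\<phi> f g = \<psi> f g"
proof -
  have "\<phi> (e a) g = \<psi> (e a) g" if "a \<in> carrier M" for a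
    using lin_map_eq_on_basis[OF assms(1) assms(3)[OF e_closed] assms(5)[OF e_closed]] that assms(6) g
    by blast
  then show ?thesis
    using lin_map_eq_on_basis[OF assms(1) assms(2) assms(4)] f g by blast
qed

text \<open>Associativity is an equality of trilinear maps, so it holds because it holds for basis elements,
  where it is associativity in the monoid.\<close>

lemma F_assoc_algebra: "assoc_algebra K F"
proof -
  interpret F: module K F by (rule F_module)
  note L = lin_mapD[OF F_mult_left_lin_map] and R = lin_mapD[OF F_mult_right_lin_map]
  have one: "\<one>\<^bsub>F\<^esub> \<in> carrier F" by (simp add: F_simps e_closed)
  have id: "(\<lambda>f. f) \<in> lin_map K F F" by (auto intro: lin_mapI)
  note comp = lin_map_comp[of _ K F F _ F]
  have assoc_basis: "(e a \<otimes>\<^bsub>F\<^esub> g) \<otimes>\<^bsub>F\<^esub> h = e a \<otimes>\<^bsub>F\<^esub> (g \<otimes>\<^bsub>F\<^esub> h)"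
    if a: "a \<in> carrier M" and g: "g \<in> carrier F" and h: "h \<in> carrier F" for a g h
  proof (rule bilin_eq_on_basis[OF F_module _ _ _ _ _ g h])
    note ea = e_closed[OF a]
    fix f assume f: "f \<in> carrier F"
    show "(\<lambda>g. e a \<otimes>\<^bsub>F\<^esub> g \<otimes>\<^bsub>F\<^esub> f) \<in> lin_map K F F"
      by (rule comp[OF F_mult_right_lin_map[OF ea] F_mult_left_lin_map[OF f]])
    show "(\<lambda>g. e a \<otimes>\<^bsub>F\<^esub> f \<otimes>\<^bsub>F\<^esub> g) \<in> lin_map K F F"
      by (rule F_mult_right_lin_map[OF F_mult_closed[OF ea f]])
    show "(\<lambda>g. e a \<otimes>\<^bsub>F\<^esub> (g \<otimes>\<^bsub>F\<^esub> f)) \<in> lin_map K F F"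
      by (rule comp[OF F_mult_left_lin_map[OF f] F_mult_right_lin_map[OF ea]])
    show "(\<lambda>g. e a \<otimes>\<^bsub>F\<^esub> (f \<otimes>\<^bsub>F\<^esub> g)) \<in> lin_map K F F"
      by (rule comp[OF F_mult_right_lin_map[OF f] F_mult_right_lin_map[OF ea]])
  qed (simp add: e_mult M.m_assoc a)
  have assoc: "(f \<otimes>\<^bsub>F\<^esub> g) \<otimes>\<^bsub>F\<^esub> h = f \<otimes>\<^bsub>F\<^esub> (g \<otimes>\<^bsub>F\<^esub> h)"
    if f: "f \<in> carrier F" and g: "g \<in> carrier F" and h: "h \<in> carrier F" for f g h
  proof (rule lin_map_eq_on_basis[OF F_module _ _ _ f])
    show "(\<lambda>f. f \<otimes>\<^bsub>F\<^esub> g \<otimes>\<^bsub>F\<^esub> h) \<in> lin_map K F F"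
      by (rule comp[OF F_mult_left_lin_map[OF g] F_mult_left_lin_map[OF h]])
    show "(\<lambda>f. f \<otimes>\<^bsub>F\<^esub> (g \<otimes>\<^bsub>F\<^esub> h)) \<in> lin_map K F F"
      by (rule F_mult_left_lin_map[OF F_mult_closed[OF g h]])
  qed (rule assoc_basis[OF _ g h])
  have unit: "\<one>\<^bsub>F\<^esub> \<otimes>\<^bsub>F\<^esub> f = f" "f \<otimes>\<^bsub>F\<^esub> \<one>\<^bsub>F\<^esub> = f" if f: "f \<in> carrier F" for f
    by (rule lin_map_eq_on_basis[OF F_module F_mult_right_lin_map[OF one] id _ f],
        simp add: e_mult F_simps(4))
      (rule lin_map_eq_on_basis[OF F_module F_mult_left_lin_map[OF one] id _ f],
        simp add: e_mult F_simps(4))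
  show ?thesis
  proof (rule assoc_algebra.intro)
    show "ring F"
      by (rule ringI) (auto intro!: monoidI F.abelian_group_axioms simp: assoc one unit L(2) R(2) F_mult_closed)
    show "assoc_algebra_axioms K F"
      by (rule assoc_algebra_axioms.intro) (simp_all add: L(3) R(3))
  qed (rule K.field_axioms F_module)+
qed

text \<open>Three functions on the monoid are allowed so that the statement applies to families of maps that are
  multiplicative only jointly, such as the associator with a fixed third factor.\<close>

lemma lin_ext_mult:
  assumes "assoc_algebra K C" "\<phi> \<in> carrier M \<rightarrow> carrier C"
    "\<phi>1 \<in> carrier M \<rightarrow> carrier C" "\<phi>2 \<in> carrier M \<rightarrow> carrier C"
    and "\<And>a b. \<lbrakk>a \<in> carrier M; b \<in> carrier M\<rbrakk> \<Longrightarrow> \<phi> (a \<otimes>\<^bsub>M\<^esub> b) = \<phi>1 a \<otimes>\<^bsub>C\<^esub> \<phi>2 b"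
    and "f \<in> carrier F" "g \<in> carrier F"
  shows "lin_ext K C \<phi> (f \<otimes>\<^bsub>F\<^esub> g) = lin_ext K C \<phi>1 f \<otimes>\<^bsub>C\<^esub> lin_ext K C \<phi>2 g"
proof -
  interpret C: assoc_algebra K C by fact
  note L = lin_ext_lin_map[OF C.module]
  note Ld = lin_mapD[OF L]
  have left: "(\<lambda>f. lin_ext K C \<phi>1 f \<otimes>\<^bsub>C\<^esub> lin_ext K C \<phi>2 g) \<in> lin_map K F C"
    and right: "(\<lambda>f. lin_ext K C \<phi>1 g \<otimes>\<^bsub>C\<^esub> lin_ext K C \<phi>2 f) \<in> lin_map K F C"
    if "g \<in> carrier F" for g
    using Ld[OF assms(3)] Ld[OF assms(4)] that
    by (intro lin_mapI; simp add: C.l_distr C.r_distr C.smult_mult_left C.smult_mult_right)+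
  note comp = lin_map_comp[OF _ L[OF assms(2)], of _ F]
  show ?thesis
  proof (rule bilin_eq_on_basis[OF C.module _ _ left right _ assms(6,7)])
    show "(\<lambda>f. lin_ext K C \<phi> (f \<otimes>\<^bsub>F\<^esub> g)) \<in> lin_map K F C"
      "(\<lambda>f. lin_ext K C \<phi> (g \<otimes>\<^bsub>F\<^esub> f)) \<in> lin_map K F C" if "g \<in> carrier F" for g
      by (rule comp[OF F_mult_left_lin_map[OF that]]) (rule comp[OF F_mult_right_lin_map[OF that]])
  qed (simp_all add: e_mult lin_ext_basis[OF C.module] assms(2-5))
qed

end

section \<open>Quotient algebras\<close>

lemma (in abelian_group) minus_eq_zero_iff:
  assumes "x \<in> carrier G" "y \<in> carrier G"
  shows "x \<ominus> y = \<zero> \<longleftrightarrow> x = y"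
  using assms by (metis add.inv_solve_right' l_zero minus_eq r_neg zero_closed)

context assoc_algebra begin

lemma ideal_smult_closed:
  assumes "ideal I A" "c \<in> carrier K" "i \<in> I" shows "c \<odot>\<^bsub>A\<^esub> i \<in> I"
proof -
  interpret I: ideal I A by fact
  have "i \<in> carrier A" using assms by simp
  then have "c \<odot>\<^bsub>A\<^esub> i = (c \<odot>\<^bsub>A\<^esub> \<one>\<^bsub>A\<^esub>) \<otimes>\<^bsub>A\<^esub> i"
    using assms by (simp add: smult_mult_left)
  then show ?thesis using assms by (simp add: I.I_l_closed)
qed

lemma quotient_algebra_carrier:
  "carrier (quotient_algebra A I) = (\<lambda>x. I +>\<^bsub>A\<^esub> x) ` carrier A"
  by (auto simp: quotient_algebra_def FactRing_def A_RCOSETS_def')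

lemma quotient_algebra_smult:
  assumes "ideal I A" "c \<in> carrier K" "x \<in> carrier A"
  shows "c \<odot>\<^bsub>quotient_algebra A I\<^esub> (I +>\<^bsub>A\<^esub> x) = I +>\<^bsub>A\<^esub> (c \<odot>\<^bsub>A\<^esub> x)"
proof -
  interpret I: ideal I A by fact
  have const: "I +>\<^bsub>A\<^esub> (c \<odot>\<^bsub>A\<^esub> y) = I +>\<^bsub>A\<^esub> (c \<odot>\<^bsub>A\<^esub> x)" if y: "y \<in> I +>\<^bsub>A\<^esub> x" for y
  proof -
    obtain i where i: "i \<in> I" "y = i \<oplus>\<^bsub>A\<^esub> x"
      using y by (auto simp: a_r_coset_def')
    then have "c \<odot>\<^bsub>A\<^esub> y = c \<odot>\<^bsub>A\<^esub> i \<oplus>\<^bsub>A\<^esub> c \<odot>\<^bsub>A\<^esub> x"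
      using assms by (simp add: smult_r_distr)
    then have "c \<odot>\<^bsub>A\<^esub> y \<in> I +>\<^bsub>A\<^esub> (c \<odot>\<^bsub>A\<^esub> x)"
      using i assms ideal_smult_closed by (auto simp: a_r_coset_def')
    then show ?thesis
      by (intro I.a_repr_independence'[symmetric]) (use assms in auto)
  qed
  have "x \<in> I +>\<^bsub>A\<^esub> x" using assms by (simp add: I.a_rcos_self)
  moreover have "(\<Union>y\<in>I +>\<^bsub>A\<^esub> x. I +>\<^bsub>A\<^esub> (c \<odot>\<^bsub>A\<^esub> y)) = (\<Union>y\<in>I +>\<^bsub>A\<^esub> x. I +>\<^bsub>A\<^esub> (c \<odot>\<^bsub>A\<^esub> x))"
    by (rule SUP_cong[OF refl]) (rule const)
  ultimately show ?thesis
    by (auto simp del: UN_iff simp: quotient_algebra_def UN_constant)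
qed

lemma quotient_proj_alg_hom:
  assumes "ideal I A"
  shows "(\<lambda>x. I +>\<^bsub>A\<^esub> x) \<in> alg_hom K A (quotient_algebra A I)"
proof (rule alg_homI)
  interpret I: ideal I A by fact
  show "(\<lambda>x. I +>\<^bsub>A\<^esub> x) \<in> lin_map K A (quotient_algebra A I)"
  proof (rule lin_mapI)
    show "I +>\<^bsub>A\<^esub> (x \<oplus>\<^bsub>A\<^esub> y) = (I +>\<^bsub>A\<^esub> x) \<oplus>\<^bsub>quotient_algebra A I\<^esub> (I +>\<^bsub>A\<^esub> y)"
      if "x \<in> carrier A" "y \<in> carrier A" for x y
      using ring_hom_add[OF I.rcos_ring_hom that] by (simp add: quotient_algebra_def)
  qed (simp_all add: quotient_algebra_carrier quotient_algebra_smult[OF assms])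
qed (simp_all add: quotient_algebra_def ideal.rcos_ring_hom[OF assms] ring_hom_mult ring_hom_one)

lemma quotient_assoc_algebra:
  assumes "ideal I A"
  shows "assoc_algebra K (quotient_algebra A I)"
proof (rule assoc_algebra_surj_image[OF assoc_algebra, where p = "\<lambda>x. I +>\<^bsub>A\<^esub> x"])
  interpret I: ideal I A by fact
  show "I +>\<^bsub>A\<^esub> \<zero>\<^bsub>A\<^esub> = \<zero>\<^bsub>quotient_algebra A I\<^esub>"
    by (simp add: quotient_algebra_def FactRing_def a_rcos_zero assms)
qed (auto simp: quotient_algebra_carrier alg_homD[OF quotient_proj_alg_hom[OF assms]])

lemma quotient_proj_eq_zero:
  assumes "ideal I A" "i \<in> I"
  shows "I +>\<^bsub>A\<^esub> i = \<zero>\<^bsub>quotient_algebra A I\<^esub>"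
  using assms by (simp add: quotient_algebra_def FactRing_def a_rcos_zero)

lemma quotient_proj_eq:
  assumes "ideal I A" "x \<in> carrier A" "y \<in> carrier A" "x \<ominus>\<^bsub>A\<^esub> y \<in> I"
  shows "I +>\<^bsub>A\<^esub> x = I +>\<^bsub>A\<^esub> y"
proof -
  let ?Q = "quotient_algebra A I" and ?p = "\<lambda>x. I +>\<^bsub>A\<^esub> x"
  interpret Q: assoc_algebra K ?Q by (rule quotient_assoc_algebra) fact
  have "?p x \<ominus>\<^bsub>?Q\<^esub> ?p y = \<zero>\<^bsub>?Q\<^esub>"
    using lin_map_diff[OF module Q.module alg_hom_lin_map[OF quotient_proj_alg_hom[OF assms(1)]] assms(2,3)]
      quotient_proj_eq_zero[OF assms(1,4)] by simp
  then show ?thesis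
    using assms(2,3) alg_homD(1)[OF quotient_proj_alg_hom[OF assms(1)]]
    by (simp add: Q.M.minus_eq_zero_iff)
qed

end

text \<open>The choice of representative is the one made by \<^const>\<open>tensor_lift\<close>, so that the linear maps on a
  tensor product are instances of linear maps on a quotient.\<close>

definition coset_lift :: "('a \<Rightarrow> 'b) \<Rightarrow> 'a set \<Rightarrow> 'b"
  where "coset_lift h X = h (SOME x. x \<in> X)"

context
  fixes K :: "('k, 'r) ring_scheme" and A :: "('k, 'a, 's) module_scheme"
    and B :: "('k, 'b, 't) module_scheme" and I h
  assumes A: "assoc_algebra K A" and B: "module K B" and I: "ideal I A"
    and h: "h \<in> lin_map K A B" and vanish: "\<And>i. i \<in> I \<Longrightarrow> h i = \<zero>\<^bsub>B\<^esub>"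
begin

interpretation A: assoc_algebra K A by (rule A)
interpretation B: module K B by (rule B)
interpretation I: ideal I A by (rule I)

lemma coset_lift_eq:
  assumes x: "x \<in> carrier A" shows "coset_lift h (I +>\<^bsub>A\<^esub> x) = h x"
proof -
  have "(SOME y. y \<in> I +>\<^bsub>A\<^esub> x) \<in> I +>\<^bsub>A\<^esub> x"
    by (rule someI) (rule I.a_rcos_self[OF x])
  then obtain i where i: "i \<in> I" "(SOME y. y \<in> I +>\<^bsub>A\<^esub> x) = i \<oplus>\<^bsub>A\<^esub> x"
    by (auto simp: a_r_coset_def')
  then show ?thesis
    using x by (simp add: coset_lift_def lin_mapD[OF h] vanish)
qed

lemma coset_lift_lin_map: "coset_lift h \<in> lin_map K (quotient_algebra A I) B"
proof -
  note p = alg_homD(2-5)[OF A.quotient_proj_alg_hom[OF I], symmetric]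
  show ?thesis
    by (rule lin_mapI) (auto simp: A.quotient_algebra_carrier p(1,3) coset_lift_eq lin_mapD[OF h])
qed

end

lemma coset_lift_alg_hom:
  assumes "assoc_algebra K A" "assoc_algebra K B" "ideal I A" "h \<in> alg_hom K A B"
    and "\<And>i. i \<in> I \<Longrightarrow> h i = \<zero>\<^bsub>B\<^esub>"
  shows "coset_lift h \<in> alg_hom K (quotient_algebra A I) B"
proof -
  interpret A: assoc_algebra K A by fact
  interpret B: assoc_algebra K B by fact
  note hl = alg_hom_lin_map[OF assms(4)]
  note eq = coset_lift_eq[OF A.assoc_algebra B.module assms(3) hl assms(5)]
  note p = alg_homD(2-5)[OF A.quotient_proj_alg_hom[OF assms(3)], symmetric]
  show ?thesis
    by (rule alg_homI[OF coset_lift_lin_map[OF A.assoc_algebra B.module assms(3) hl assms(5)]])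
      (auto simp: A.quotient_algebra_carrier p(2,4) eq alg_homD[OF assms(4)])
qed

section \<open>Free algebras and Clifford algebras\<close>

definition word_eval :: "('b, 's) monoid_scheme \<Rightarrow> ('g \<Rightarrow> 'b) \<Rightarrow> 'g list \<Rightarrow> 'b"
  where "word_eval B v w = foldr (\<lambda>s y. v s \<otimes>\<^bsub>B\<^esub> y) w \<one>\<^bsub>B\<^esub>"

lemma word_monoid_is_monoid: "monoid (word_monoid S)"
  by (rule monoidI) (auto simp: word_monoid_def)

lemma free_monoid_alg: "field K \<Longrightarrow> monoid_alg K (word_monoid S)"
  by (intro monoid_alg.intro word_monoid_is_monoid)

lemma free_assoc_algebra: "field K \<Longrightarrow> assoc_algebra K (free_algebra K S)"
  unfolding free_algebra_def by (intro monoid_alg.F_assoc_algebra free_monoid_alg)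

lemma free_gen_closed: "field K \<Longrightarrow> s \<in> S \<Longrightarrow> free_gen K s \<in> carrier (free_algebra K S)"
  unfolding free_algebra_def free_gen_def
  by (intro monoid_alg.e_closed free_monoid_alg) (auto simp: word_monoid_def)

lemma free_algebra_hom:
  assumes "assoc_algebra K B" "v \<in> S \<rightarrow> carrier B"
  obtains h where "h \<in> alg_hom K (free_algebra K S) B" "\<And>s. s \<in> S \<Longrightarrow> h (free_gen K s) = v s"
proof -
  interpret B: assoc_algebra K B by fact
  interpret W: monoid_alg K "word_monoid S" by (rule free_monoid_alg[OF B.field_axioms])
  have v: "v s \<in> carrier B" if "s \<in> S" for s using assms that by auto
  have closed: "word_eval B v w \<in> carrier B" if "w \<in> lists S" for w
    using that by (induction w) (auto simp: word_eval_def v)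
  have app: "word_eval B v (w @ u) = word_eval B v w \<otimes>\<^bsub>B\<^esub> word_eval B v u"
    if "w \<in> lists S" "u \<in> lists S" for w u
    using that(1) closed[OF that(2)]
  proof (induction w)
    case (Cons s w)
    then have "v s \<in> carrier B" "word_eval B v w \<in> carrier B" by (auto intro: v closed)
    then show ?case using Cons by (simp add: word_eval_def B.m_assoc)
  qed (simp add: word_eval_def)
  have \<phi>: "word_eval B v \<in> carrier (word_monoid S) \<rightarrow> carrier B"
    by (auto simp: word_monoid_def closed)
  have one: "\<one>\<^bsub>word_monoid S\<^esub> = []" by (simp add: word_monoid_def)
  have gen: "[s] \<in> carrier (word_monoid S)" if "s \<in> S" for s
    using that by (simp add: word_monoid_def)
  note basis = W.lin_ext_basis[OF B.module \<phi>]
  have "lin_ext K B (word_eval B v) \<in> alg_hom K (free_algebra K S) B"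
    unfolding free_algebra_def
  proof (rule alg_homI[OF W.lin_ext_lin_map[OF B.module \<phi>]])
    show "lin_ext K B (word_eval B v) \<one>\<^bsub>W.F\<^esub> = \<one>\<^bsub>B\<^esub>"
      using basis[OF W.M.one_closed] by (simp add: W.F_simps) (simp add: one word_eval_def)
  qed (rule W.lin_ext_mult[OF assms(1) \<phi> \<phi> \<phi>], auto simp: word_monoid_def app)
  then show ?thesis
    by (rule that) (simp add: free_gen_def basis gen, simp add: word_eval_def v)
qed

lemma free_algebra_hom_eq:
  assumes "assoc_algebra K B" "g \<in> alg_hom K (free_algebra K S) B" "h \<in> alg_hom K (free_algebra K S) B"
    and eq: "\<And>s. s \<in> S \<Longrightarrow> g (free_gen K s) = h (free_gen K s)"
    and x: "x \<in> carrier (free_algebra K S)"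
  shows "g x = h x"
proof -
  interpret B: assoc_algebra K B by fact
  interpret W: monoid_alg K "word_monoid S" by (rule free_monoid_alg[OF B.field_axioms])
  have words: "g (W.e w) = h (W.e w)" if "w \<in> lists S" for w
    using that
  proof (induction w)
    case Nil
    have "W.e [] = \<one>\<^bsub>free_algebra K S\<^esub>"
      unfolding free_algebra_def W.F_simps by (simp add: word_monoid_def)
    then show ?case by (simp add: alg_homD(5)[OF assms(2)] alg_homD(5)[OF assms(3)])
  next
    case (Cons s w)
    then have c: "[s] \<in> carrier (word_monoid S)" "w \<in> carrier (word_monoid S)"
      by (auto simp: word_monoid_def)
    have "W.e (s # w) = free_gen K s \<otimes>\<^bsub>free_algebra K S\<^esub> W.e w"
      using W.e_mult[OF c] by (simp add: free_gen_def free_algebra_def) (simp add: word_monoid_def)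
    moreover have "free_gen K s \<in> carrier (free_algebra K S)" "W.e w \<in> carrier (free_algebra K S)"
      using W.e_closed[OF c(1)] W.e_closed[OF c(2)] by (simp_all add: free_gen_def free_algebra_def)
    ultimately show ?case
      using Cons by (simp add: alg_homD(3)[OF assms(2)] alg_homD(3)[OF assms(3)] eq)
  qed
  show ?thesis
    using alg_hom_lin_map[OF assms(2)] alg_hom_lin_map[OF assms(3)] x words
    unfolding free_algebra_def
    by (intro W.lin_map_eq_on_basis[OF B.module, of g h x]) (auto simp: word_monoid_def)
qed

definition clifford_family ::
  "('k, 'r) ring_scheme \<Rightarrow> ('k, 'b, 's) module_scheme \<Rightarrow> nat \<Rightarrow> 'k \<Rightarrow> (nat \<Rightarrow> 'k) \<Rightarrow> (nat \<Rightarrow> 'k)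
    \<Rightarrow> (nat \<Rightarrow> nat \<Rightarrow> 'k) \<Rightarrow> (clifford_gen \<Rightarrow> 'b) \<Rightarrow> bool"
  where "clifford_family K B n \<alpha> \<beta> \<gamma> l v \<longleftrightarrow>
    v \<in> clifford_gens n \<rightarrow> carrier B
    \<and> v Gen_G \<otimes>\<^bsub>B\<^esub> v Gen_G = \<alpha> \<odot>\<^bsub>B\<^esub> \<one>\<^bsub>B\<^esub>
    \<and> (\<forall>i. 1 \<le> i \<and> i \<le> n \<longrightarrow> v (Gen_X i) \<otimes>\<^bsub>B\<^esub> v (Gen_X i) = \<beta> i \<odot>\<^bsub>B\<^esub> \<one>\<^bsub>B\<^esub>)
    \<and> (\<forall>i. 1 \<le> i \<and> i \<le> n \<longrightarrow>
         v Gen_G \<otimes>\<^bsub>B\<^esub> v (Gen_X i) \<oplus>\<^bsub>B\<^esub> v (Gen_X i) \<otimes>\<^bsub>B\<^esub> v Gen_G = \<gamma> i \<odot>\<^bsub>B\<^esub> \<one>\<^bsub>B\<^esub>)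
    \<and> (\<forall>i j. 1 \<le> i \<and> i < j \<and> j \<le> n \<longrightarrow>
         v (Gen_X i) \<otimes>\<^bsub>B\<^esub> v (Gen_X j) \<oplus>\<^bsub>B\<^esub> v (Gen_X j) \<otimes>\<^bsub>B\<^esub> v (Gen_X i) = l i j \<odot>\<^bsub>B\<^esub> \<one>\<^bsub>B\<^esub>)"

locale clifford_data = K: field K
  for K :: "('k, 'r) ring_scheme" and n :: nat and \<alpha> :: 'k and \<beta> \<gamma> :: "nat \<Rightarrow> 'k"
    and l :: "nat \<Rightarrow> nat \<Rightarrow> 'k" +
  assumes \<alpha>: "\<alpha> \<in> carrier K"
    and \<beta>: "\<And>i. 1 \<le> i \<Longrightarrow> i \<le> n \<Longrightarrow> \<beta> i \<in> carrier K"
    and \<gamma>: "\<And>i. 1 \<le> i \<Longrightarrow> i \<le> n \<Longrightarrow> \<gamma> i \<in> carrier K"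
    and l: "\<And>i j. 1 \<le> i \<Longrightarrow> i < j \<Longrightarrow> j \<le> n \<Longrightarrow> l i j \<in> carrier K"
begin

abbreviation Fr where "Fr \<equiv> free_algebra K (clifford_gens n)"
abbreviation rels where "rels \<equiv> clifford_rels K n \<alpha> \<beta> \<gamma> l"
abbreviation Cl where "Cl \<equiv> clifford K n \<alpha> \<beta> \<gamma> l"

definition cl_gen :: "clifford_gen \<Rightarrow> (clifford_gen list \<Rightarrow> 'k) set"
  where "cl_gen s = (Idl\<^bsub>Fr\<^esub> rels) +>\<^bsub>Fr\<^esub> free_gen K s"

sublocale Fr: assoc_algebra K Fr by (rule free_assoc_algebra[OF K.field_axioms])

lemma X_in_gens: "1 \<le> i \<Longrightarrow> i \<le> n \<Longrightarrow> Gen_X i \<in> clifford_gens n"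
  and G_in_gens: "Gen_G \<in> clifford_gens n"
  by (auto simp: clifford_gens_def)

lemma gens_closed:
  "free_gen K Gen_G \<in> carrier Fr"
  "1 \<le> i \<Longrightarrow> i \<le> n \<Longrightarrow> free_gen K (Gen_X i) \<in> carrier Fr"
  by (auto intro!: free_gen_closed[OF K.field_axioms] X_in_gens G_in_gens)

lemma rels_closed: "rels \<subseteq> carrier Fr"
  by (auto simp: clifford_rels_def Let_def gens_closed \<alpha> \<beta> \<gamma> l intro!: Fr.minus_closed)

lemma ideal_rels: "ideal (Idl\<^bsub>Fr\<^esub> rels) Fr"
  by (rule Fr.genideal_ideal[OF rels_closed])

lemma Cl_eq: "Cl = quotient_algebra Fr (Idl\<^bsub>Fr\<^esub> rels)"
  by (simp add: clifford_def Let_def)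

lemma Cl_assoc_algebra: "assoc_algebra K Cl"
  unfolding Cl_eq by (rule Fr.quotient_assoc_algebra[OF ideal_rels])

lemma proj_hom: "(\<lambda>x. (Idl\<^bsub>Fr\<^esub> rels) +>\<^bsub>Fr\<^esub> x) \<in> alg_hom K Fr Cl"
  unfolding Cl_eq by (rule Fr.quotient_proj_alg_hom[OF ideal_rels])

lemma cl_gen_closed: "s \<in> clifford_gens n \<Longrightarrow> cl_gen s \<in> carrier Cl"
  unfolding cl_gen_def by (intro alg_homD(1)[OF proj_hom] free_gen_closed K.field_axioms)

lemma cl_gen_family: "clifford_family K Cl n \<alpha> \<beta> \<gamma> l cl_gen"
proof -
  let ?p = "\<lambda>x. (Idl\<^bsub>Fr\<^esub> rels) +>\<^bsub>Fr\<^esub> x"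
  note p = alg_homD(2-5)[OF proj_hom, symmetric]
  have rel: "?p x = ?p y" if "x \<ominus>\<^bsub>Fr\<^esub> y \<in> rels" "x \<in> carrier Fr" "y \<in> carrier Fr" for x y
    using that Fr.genideal_self[OF rels_closed]
    by (intro Fr.quotient_proj_eq[OF ideal_rels]) auto
  have "cl_gen \<in> clifford_gens n \<rightarrow> carrier Cl" by (simp add: cl_gen_closed)
  moreover have "cl_gen Gen_G \<otimes>\<^bsub>Cl\<^esub> cl_gen Gen_G = \<alpha> \<odot>\<^bsub>Cl\<^esub> \<one>\<^bsub>Cl\<^esub>"
    unfolding cl_gen_def
    by (simp add: p gens_closed \<alpha>, rule rel) (simp_all add: gens_closed \<alpha> clifford_rels_def Let_def)
  moreover have "cl_gen (Gen_X i) \<otimes>\<^bsub>Cl\<^esub> cl_gen (Gen_X i) = \<beta> i \<odot>\<^bsub>Cl\<^esub> \<one>\<^bsub>Cl\<^esub>" if "1 \<le> i" "i \<le> n" for i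
    unfolding cl_gen_def using that
    by (simp add: p gens_closed \<beta>, intro rel)
      (auto simp: gens_closed \<beta> clifford_rels_def Let_def)
  moreover have "cl_gen Gen_G \<otimes>\<^bsub>Cl\<^esub> cl_gen (Gen_X i) \<oplus>\<^bsub>Cl\<^esub> cl_gen (Gen_X i) \<otimes>\<^bsub>Cl\<^esub> cl_gen Gen_G
      = \<gamma> i \<odot>\<^bsub>Cl\<^esub> \<one>\<^bsub>Cl\<^esub>" if "1 \<le> i" "i \<le> n" for i
    unfolding cl_gen_def using that
    by (simp add: p gens_closed \<gamma>, intro rel)
      (auto simp: gens_closed \<gamma> clifford_rels_def Let_def)
  moreover have "cl_gen (Gen_X i) \<otimes>\<^bsub>Cl\<^esub> cl_gen (Gen_X j) \<oplus>\<^bsub>Cl\<^esub> cl_gen (Gen_X j) \<otimes>\<^bsub>Cl\<^esub> cl_gen (Gen_X i)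
      = l i j \<odot>\<^bsub>Cl\<^esub> \<one>\<^bsub>Cl\<^esub>" if "1 \<le> i" "i < j" "j \<le> n" for i j
    unfolding cl_gen_def using that
    by (simp add: p gens_closed l, intro rel)
      (auto simp: gens_closed l clifford_rels_def Let_def)
  ultimately show ?thesis
    unfolding clifford_family_def by simp
qed

lemma clifford_universal:
  assumes "assoc_algebra K B" and v: "clifford_family K B n \<alpha> \<beta> \<gamma> l v"
  obtains h where "h \<in> alg_hom K Cl B" "\<And>s. s \<in> clifford_gens n \<Longrightarrow> h (cl_gen s) = v s"
proof -
  interpret B: assoc_algebra K B by fact
  have vc: "v \<in> clifford_gens n \<rightarrow> carrier B" using v by (simp add: clifford_family_def)
  then have vc': "v s \<in> carrier B" if "s \<in> clifford_gens n" for s using that by auto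
  obtain h where h: "h \<in> alg_hom K Fr B" and hs: "\<And>s. s \<in> clifford_gens n \<Longrightarrow> h (free_gen K s) = v s"
    using free_algebra_hom[OF assms(1) vc] by metis
  note hD = alg_homD[OF h] and hl = alg_hom_lin_map[OF h]
  let ?N = "{x \<in> carrier Fr. h x = \<zero>\<^bsub>B\<^esub>}"
  have N: "ideal ?N Fr"
  proof (rule idealI[OF Fr.ring_axioms])
    show "subgroup ?N (add_monoid Fr)"
      using kernel_submodule[OF Fr.module B.module hl] by (rule submodule.axioms)
  qed (auto simp: hD)
  have "h r = \<zero>\<^bsub>B\<^esub>" if r: "r \<in> rels" for r
  proof -
    note diff = lin_map_diff[OF Fr.module B.module hl]
    note simps = diff hD gens_closed \<alpha> \<beta> \<gamma> l hs X_in_gens G_in_gens vc' B.M.minus_eq_zero_iff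
    note fam = v[unfolded clifford_family_def]
    show ?thesis
      using r unfolding clifford_rels_def Let_def
      by (elim UnE CollectE exE conjE singletonE) (use fam in \<open>simp_all add: simps\<close>)
  qed
  then have "rels \<subseteq> ?N" using rels_closed by auto
  then have van: "h i = \<zero>\<^bsub>B\<^esub>" if "i \<in> Idl\<^bsub>Fr\<^esub> rels" for i
    using Fr.genideal_minimal[OF N] that by auto
  show ?thesis
  proof
    show "coset_lift h \<in> alg_hom K Cl B"
      unfolding Cl_eq
      by (rule coset_lift_alg_hom[OF Fr.assoc_algebra assms(1) ideal_rels h van])
    show "coset_lift h (cl_gen s) = v s" if "s \<in> clifford_gens n" for s
      unfolding cl_gen_def
      using coset_lift_eq[OF Fr.assoc_algebra B.module ideal_rels hl van] that
      by (simp add: hs free_gen_closed[OF K.field_axioms])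
  qed
qed

lemma clifford_hom_eq:
  assumes "assoc_algebra K B" "g \<in> alg_hom K Cl B" "h \<in> alg_hom K Cl B"
    and "\<And>s. s \<in> clifford_gens n \<Longrightarrow> g (cl_gen s) = h (cl_gen s)"
    and "x \<in> carrier Cl"
  shows "g x = h x"
proof -
  obtain y where y: "y \<in> carrier Fr" "x = (Idl\<^bsub>Fr\<^esub> rels) +>\<^bsub>Fr\<^esub> y"
    using assms(5) unfolding Cl_eq Fr.quotient_algebra_carrier by blast
  show ?thesis
    unfolding y(2)
    by (rule free_algebra_hom_eq[OF assms(1) alg_hom_comp[OF proj_hom assms(2)]
          alg_hom_comp[OF proj_hom assms(3)] _ y(1)])
      (use assms(4) in \<open>simp add: cl_gen_def\<close>)
qed

end

section \<open>Tensor products of algebras\<close>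

lemma linear_span_superset: "S \<subseteq> linear_span K V S"
  by (auto simp: linear_span_def)

lemma linear_span_minimal: "submodule W K V \<Longrightarrow> S \<subseteq> W \<Longrightarrow> linear_span K V S \<subseteq> W"
  by (auto simp: linear_span_def)

lemma linear_span_submodule:
  assumes V: "module K V" and S: "S \<subseteq> carrier V"
  shows "submodule (linear_span K V S) K V"
proof -
  interpret V: module K V by fact
  note sm = submodule_closed[OF V]
  have "linear_span K V S \<subseteq> carrier V"
    by (rule linear_span_minimal[OF V.carrier_is_submodule S])
  then show ?thesis
    by (intro submodule_by_smult[OF V]) (auto simp: linear_span_def sm)
qed

definition bilin ::
  "('k, 'r) ring_scheme \<Rightarrow> ('k, 'a, 's) module_scheme \<Rightarrow> ('k, 'b, 't) module_scheme
    \<Rightarrow> ('k, 'c, 'u) module_scheme \<Rightarrow> ('a \<Rightarrow> 'b \<Rightarrow> 'c) \<Rightarrow> bool"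
  where "bilin K A B C \<phi> \<longleftrightarrow>
    (\<forall>b\<in>carrier B. (\<lambda>a. \<phi> a b) \<in> lin_map K A C) \<and> (\<forall>a\<in>carrier A. \<phi> a \<in> lin_map K B C)"

lemma bilinI:
  assumes "\<And>b. b \<in> carrier B \<Longrightarrow> (\<lambda>a. \<phi> a b) \<in> lin_map K A C"
    and "\<And>a. a \<in> carrier A \<Longrightarrow> (\<lambda>b. \<phi> a b) \<in> lin_map K B C"
  shows "bilin K A B C \<phi>"
  using assms by (simp add: bilin_def)

lemma bilinD:
  assumes "bilin K A B C \<phi>"
  shows "b \<in> carrier B \<Longrightarrow> (\<lambda>a. \<phi> a b) \<in> lin_map K A C"
    and "a \<in> carrier A \<Longrightarrow> (\<lambda>b. \<phi> a b) \<in> lin_map K B C"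
  using assms by (simp_all add: bilin_def)

lemma bilin_simps:
  assumes "bilin K A B C \<phi>" "a \<in> carrier A" "b \<in> carrier B"
  shows "\<phi> a b \<in> carrier C"
    and "a' \<in> carrier A \<Longrightarrow> \<phi> (a \<oplus>\<^bsub>A\<^esub> a') b = \<phi> a b \<oplus>\<^bsub>C\<^esub> \<phi> a' b"
    and "b' \<in> carrier B \<Longrightarrow> \<phi> a (b \<oplus>\<^bsub>B\<^esub> b') = \<phi> a b \<oplus>\<^bsub>C\<^esub> \<phi> a b'"
    and "c \<in> carrier K \<Longrightarrow> \<phi> (c \<odot>\<^bsub>A\<^esub> a) b = c \<odot>\<^bsub>C\<^esub> \<phi> a b"
    and "c \<in> carrier K \<Longrightarrow> \<phi> a (c \<odot>\<^bsub>B\<^esub> b) = c \<odot>\<^bsub>C\<^esub> \<phi> a b"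
  using lin_mapD[OF bilinD(1)[OF assms(1,3)]] lin_mapD[OF bilinD(2)[OF assms(1,2)]] assms(2,3)
  by simp_all

lemma bilin_comp:
  assumes \<phi>: "bilin K A B C \<phi>" and f: "f \<in> lin_map K A' A" and g: "g \<in> lin_map K B' B"
  shows "bilin K A' B' C (\<lambda>a b. \<phi> (f a) (g b))"
  using lin_map_comp[OF f bilinD(1)[OF \<phi>]] lin_map_comp[OF g bilinD(2)[OF \<phi>]]
    lin_mapD(1)[OF f] lin_mapD(1)[OF g]
  by (intro bilinI) blast+

lemma lin_map_plus:
  assumes "module K C" "g \<in> lin_map K A C" "h \<in> lin_map K A C"
  shows "(\<lambda>x. g x \<oplus>\<^bsub>C\<^esub> h x) \<in> lin_map K A C"
proof -
  interpret C: module K C by fact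
  note g = lin_mapD[OF assms(2)] and h = lin_mapD[OF assms(3)]
  show ?thesis
    by (rule lin_mapI) (simp_all add: g h C.M.a_ac C.smult_r_distr)
qed

lemma lin_map_smult:
  assumes "module K C" "g \<in> lin_map K A C" "c \<in> carrier K"
  shows "(\<lambda>x. c \<odot>\<^bsub>C\<^esub> g x) \<in> lin_map K A C"
proof -
  interpret C: module K C by fact
  note g = lin_mapD[OF assms(2)]
  show ?thesis
    by (rule lin_mapI) (simp_all add: g assms(3) C.smult_r_distr C.smult_assoc1[symmetric] C.R.m_comm)
qed

text \<open>The tensor lift descends the linear extension of \<open>\<phi>\<close> from the free vector space on pairs.\<close>

lemma tensor_lift_eq_coset_lift:
  "tensor_lift K C \<phi> = coset_lift (lin_ext K C (\<lambda>p. \<phi> (fst p) (snd p)))"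
  by (simp add: tensor_lift_def coset_lift_def lin_ext_def Let_def fun_eq_iff)

locale tensor_pair = A: assoc_algebra K A + B: assoc_algebra K B
  for K :: "('k, 'r) ring_scheme" and A :: "('k, 'a, 's) module_scheme"
    and B :: "('k, 'b, 't) module_scheme"
begin

sublocale P: monoid_alg K "A \<times>\<times> B"
  by (intro monoid_alg.intro DirProd_monoid A.field_axioms A.monoid_axioms B.monoid_axioms)

abbreviation N where "N \<equiv> tensor_null K A B"
abbreviation T where "T \<equiv> tensor K A B"
abbreviation pt where "pt \<equiv> pure_tensor K A B"

sublocale PF: assoc_algebra K P.F by (rule P.F_assoc_algebra)

lemma e_closed: "a \<in> carrier A \<Longrightarrow> b \<in> carrier B \<Longrightarrow> P.e (a, b) \<in> carrier P.F"
  by (rule P.e_closed) simp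

lemma bilinear_rels_intros:
  assumes "a \<in> carrier A" "b \<in> carrier B"
  shows "a' \<in> carrier A \<Longrightarrow>
      P.e (a \<oplus>\<^bsub>A\<^esub> a', b) \<ominus>\<^bsub>P.F\<^esub> (P.e (a, b) \<oplus>\<^bsub>P.F\<^esub> P.e (a', b)) \<in> bilinear_rels K A B"
    and "b' \<in> carrier B \<Longrightarrow>
      P.e (a, b \<oplus>\<^bsub>B\<^esub> b') \<ominus>\<^bsub>P.F\<^esub> (P.e (a, b) \<oplus>\<^bsub>P.F\<^esub> P.e (a, b')) \<in> bilinear_rels K A B"
    and "c \<in> carrier K \<Longrightarrow> P.e (c \<odot>\<^bsub>A\<^esub> a, b) \<ominus>\<^bsub>P.F\<^esub> c \<odot>\<^bsub>P.F\<^esub> P.e (a, b) \<in> bilinear_rels K A B"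
    and "c \<in> carrier K \<Longrightarrow> P.e (a, c \<odot>\<^bsub>B\<^esub> b) \<ominus>\<^bsub>P.F\<^esub> c \<odot>\<^bsub>P.F\<^esub> P.e (a, b) \<in> bilinear_rels K A B"
proof -
  show "P.e (a \<oplus>\<^bsub>A\<^esub> a', b) \<ominus>\<^bsub>P.F\<^esub> (P.e (a, b) \<oplus>\<^bsub>P.F\<^esub> P.e (a', b)) \<in> bilinear_rels K A B"
    if "a' \<in> carrier A"
    unfolding bilinear_rels_def Let_def
    by (rule UnI1, rule UnI1, rule UnI1) (use assms that in blast)
  show "P.e (a, b \<oplus>\<^bsub>B\<^esub> b') \<ominus>\<^bsub>P.F\<^esub> (P.e (a, b) \<oplus>\<^bsub>P.F\<^esub> P.e (a, b')) \<in> bilinear_rels K A B"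
    if "b' \<in> carrier B"
    unfolding bilinear_rels_def Let_def
    by (rule UnI1, rule UnI1, rule UnI2) (use assms that in blast)
  show "P.e (c \<odot>\<^bsub>A\<^esub> a, b) \<ominus>\<^bsub>P.F\<^esub> c \<odot>\<^bsub>P.F\<^esub> P.e (a, b) \<in> bilinear_rels K A B"
    if "c \<in> carrier K"
    unfolding bilinear_rels_def Let_def
    by (rule UnI1, rule UnI2) (use assms that in blast)
  show "P.e (a, c \<odot>\<^bsub>B\<^esub> b) \<ominus>\<^bsub>P.F\<^esub> c \<odot>\<^bsub>P.F\<^esub> P.e (a, b) \<in> bilinear_rels K A B"
    if "c \<in> carrier K"
    unfolding bilinear_rels_def Let_def
    by (rule UnI2) (use assms that in blast)
qed

lemma bilinear_rels_cases [consumes 1]: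
  assumes "r \<in> bilinear_rels K A B"
  obtains a a' b where "a \<in> carrier A" "a' \<in> carrier A" "b \<in> carrier B"
      "r = P.e (a \<oplus>\<^bsub>A\<^esub> a', b) \<ominus>\<^bsub>P.F\<^esub> (P.e (a, b) \<oplus>\<^bsub>P.F\<^esub> P.e (a', b))"
    | a b b' where "a \<in> carrier A" "b \<in> carrier B" "b' \<in> carrier B"
      "r = P.e (a, b \<oplus>\<^bsub>B\<^esub> b') \<ominus>\<^bsub>P.F\<^esub> (P.e (a, b) \<oplus>\<^bsub>P.F\<^esub> P.e (a, b'))"
    | c a b where "c \<in> carrier K" "a \<in> carrier A" "b \<in> carrier B"
      "r = P.e (c \<odot>\<^bsub>A\<^esub> a, b) \<ominus>\<^bsub>P.F\<^esub> c \<odot>\<^bsub>P.F\<^esub> P.e (a, b)"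
    | c a b where "c \<in> carrier K" "a \<in> carrier A" "b \<in> carrier B"
      "r = P.e (a, c \<odot>\<^bsub>B\<^esub> b) \<ominus>\<^bsub>P.F\<^esub> c \<odot>\<^bsub>P.F\<^esub> P.e (a, b)"
  using assms unfolding bilinear_rels_def Let_def
  by (elim UnE CollectE exE conjE) (erule (3) that)+

lemma bilinear_rels_closed: "bilinear_rels K A B \<subseteq> carrier P.F"
proof
  fix r assume "r \<in> bilinear_rels K A B"
  then show "r \<in> carrier P.F"
    by (cases rule: bilinear_rels_cases) (simp_all add: e_closed)
qed

lemma null_submodule: "submodule N K P.F"
  unfolding tensor_null_def by (rule linear_span_submodule[OF PF.module bilinear_rels_closed])

lemma null_closed: "N \<subseteq> carrier P.F"
  by (rule submodule_closed(1)[OF PF.module null_submodule])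

lemma rels_null: "r \<in> bilinear_rels K A B \<Longrightarrow> r \<in> N"
  unfolding tensor_null_def by (rule subsetD[OF linear_span_superset])

lemma null_vimage:
  assumes h: "h \<in> lin_map K P.F C" and C: "module K C" and W: "submodule W K C"
    and rels: "\<And>r. r \<in> bilinear_rels K A B \<Longrightarrow> h r \<in> W" and x: "x \<in> N"
  shows "h x \<in> W"
proof -
  have "N \<subseteq> {x \<in> carrier P.F. h x \<in> W}"
    unfolding tensor_null_def
  proof (rule linear_span_minimal[OF vimage_submodule[OF PF.module C h W]], rule subsetI)
    fix r assume r: "r \<in> bilinear_rels K A B"
    then show "r \<in> {x \<in> carrier P.F. h x \<in> W}"
      using rels[OF r] subsetD[OF bilinear_rels_closed r] by simp
  qed
  from subsetD[OF this x] show ?thesis by simp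
qed

text \<open>Multiplication by a basis element acts linearly on each of the two factors, so it maps an
  instance of a bilinearity relation to another instance of it.\<close>

lemma rels_mult_basis:
  assumes "a0 \<in> carrier A" "b0 \<in> carrier B" "r \<in> bilinear_rels K A B"
  shows "P.e (a0, b0) \<otimes>\<^bsub>P.F\<^esub> r \<in> bilinear_rels K A B" "r \<otimes>\<^bsub>P.F\<^esub> P.e (a0, b0) \<in> bilinear_rels K A B"
proof -
  have e0: "P.e (a0, b0) \<in> carrier P.F" using assms by (simp add: e_closed)
  note l = P.F_mult_right_lin_map[OF e0] and r = P.F_mult_left_lin_map[OF e0]
  have ee: "P.e (a, b) \<otimes>\<^bsub>P.F\<^esub> P.e (a', b') = P.e (a \<otimes>\<^bsub>A\<^esub> a', b \<otimes>\<^bsub>B\<^esub> b')"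
    if "a \<in> carrier A" "b \<in> carrier B" "a' \<in> carrier A" "b' \<in> carrier B" for a b a' b'
    using P.e_mult[of "(a, b)" "(a', b')"] that by simp
  note simps = lin_map_diff[OF PF.module PF.module l] lin_map_diff[OF PF.module PF.module r]
    lin_mapD[OF l] lin_mapD[OF r] ee e_closed assms(1,2) A.r_distr B.r_distr A.l_distr B.l_distr
    A.smult_mult_left B.smult_mult_left A.smult_mult_right B.smult_mult_right
  show "P.e (a0, b0) \<otimes>\<^bsub>P.F\<^esub> r \<in> bilinear_rels K A B"
    using assms(3)
    by (cases rule: bilinear_rels_cases) (simp_all add: simps bilinear_rels_intros)
  show "r \<otimes>\<^bsub>P.F\<^esub> P.e (a0, b0) \<in> bilinear_rels K A B"
    using assms(3)
    by (cases rule: bilinear_rels_cases) (simp_all add: simps bilinear_rels_intros)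
qed

text \<open>The span of the relations is closed under multiplication by basis elements, and these span
  the algebra.\<close>

lemma null_ideal: "ideal N P.F"
proof (rule idealI[OF PF.ring_axioms])
  show "subgroup N (add_monoid P.F)" using null_submodule by (rule submodule.axioms)
next
  fix x f assume x: "x \<in> N" and f: "f \<in> carrier P.F"
  then have xc: "x \<in> carrier P.F" using null_closed by blast
  note l = P.F_mult_right_lin_map[OF P.e_closed] and r = P.F_mult_left_lin_map[OF P.e_closed]
  note sub = PF.module PF.module and null = null_submodule
  have mult: "P.e m \<otimes>\<^bsub>P.F\<^esub> x \<in> N" "x \<otimes>\<^bsub>P.F\<^esub> P.e m \<in> N" if m: "m \<in> carrier (A \<times>\<times> B)" for m
  proof -
    obtain a b where ab: "m = (a, b)" "a \<in> carrier A" "b \<in> carrier B" using m by auto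
    show "P.e m \<otimes>\<^bsub>P.F\<^esub> x \<in> N"
      by (rule null_vimage[OF l[OF m] PF.module null _ x])
        (unfold ab(1), rule rels_null[OF rels_mult_basis(1)[OF ab(2,3)]])
    show "x \<otimes>\<^bsub>P.F\<^esub> P.e m \<in> N"
      by (rule null_vimage[OF r[OF m] PF.module null _ x])
        (unfold ab(1), rule rels_null[OF rels_mult_basis(2)[OF ab(2,3)]])
  qed
  have "f \<in> {f \<in> carrier P.F. f \<otimes>\<^bsub>P.F\<^esub> x \<in> N}"
    by (rule P.basis_spans[OF vimage_submodule[OF sub P.F_mult_left_lin_map[OF xc] null] _ f])
      (simp add: P.e_closed mult)
  then show "f \<otimes>\<^bsub>P.F\<^esub> x \<in> N" by simp
  have "f \<in> {f \<in> carrier P.F. x \<otimes>\<^bsub>P.F\<^esub> f \<in> N}"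
    by (rule P.basis_spans[OF vimage_submodule[OF sub P.F_mult_right_lin_map[OF xc] null] _ f])
      (simp add: P.e_closed mult)
  then show "x \<otimes>\<^bsub>P.F\<^esub> f \<in> N" by simp
qed

lemma T_assoc_algebra: "assoc_algebra K T"
  unfolding tensor_def by (rule PF.quotient_assoc_algebra[OF null_ideal])

sublocale T: assoc_algebra K T by (rule T_assoc_algebra)

abbreviation proj where "proj \<equiv> (\<lambda>f. N +>\<^bsub>P.F\<^esub> f)"

lemma proj_hom: "proj \<in> alg_hom K P.F T"
  unfolding tensor_def by (rule PF.quotient_proj_alg_hom[OF null_ideal])

lemma T_carrier: "carrier T = proj ` carrier P.F"
  unfolding tensor_def by (rule PF.quotient_algebra_carrier)

lemma proj_rel:
  "\<lbrakk>x \<ominus>\<^bsub>P.F\<^esub> y \<in> bilinear_rels K A B; x \<in> carrier P.F; y \<in> carrier P.F\<rbrakk> \<Longrightarrow> proj x = proj y"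
  by (rule PF.quotient_proj_eq[OF null_ideal]) (auto intro: rels_null)

lemma pt_bilin: "bilin K A B T pt"
proof -
  note p = alg_homD(2,4)[OF proj_hom, symmetric] alg_homD(1)[OF proj_hom]
  note simps = pure_tensor_def p e_closed proj_rel[OF bilinear_rels_intros(1)]
    proj_rel[OF bilinear_rels_intros(2)] proj_rel[OF bilinear_rels_intros(3)]
    proj_rel[OF bilinear_rels_intros(4)]
  show ?thesis
    by (intro bilinI lin_mapI) (simp_all add: simps)
qed

lemmas pt_simps = bilin_simps[OF pt_bilin]

lemma pt_mult:
  assumes "a \<in> carrier A" "b \<in> carrier B" "a' \<in> carrier A" "b' \<in> carrier B"
  shows "pt a b \<otimes>\<^bsub>T\<^esub> pt a' b' = pt (a \<otimes>\<^bsub>A\<^esub> a') (b \<otimes>\<^bsub>B\<^esub> b')"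
  using P.e_mult[of "(a, b)" "(a', b')"] assms
  by (simp add: pure_tensor_def alg_homD(3)[OF proj_hom, symmetric] e_closed)

lemma T_one: "\<one>\<^bsub>T\<^esub> = pt \<one>\<^bsub>A\<^esub> \<one>\<^bsub>B\<^esub>"
  using alg_homD(5)[OF proj_hom] by (simp add: pure_tensor_def P.F_simps)

lemma lin_eq_on_pure:
  assumes C: "module K C" and g: "g \<in> lin_map K T C" and h: "h \<in> lin_map K T C"
    and eq: "\<And>a b. \<lbrakk>a \<in> carrier A; b \<in> carrier B\<rbrakk> \<Longrightarrow> g (pt a b) = h (pt a b)"
    and t: "t \<in> carrier T"
  shows "g t = h t"
proof -
  obtain f where f: "f \<in> carrier P.F" "t = proj f" using t T_carrier by blast
  note p = alg_hom_lin_map[OF proj_hom]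
  show ?thesis
    unfolding f(2)
    by (rule P.lin_map_eq_on_basis[OF C lin_map_comp[OF p g] lin_map_comp[OF p h] _ f(1)])
      (use eq in \<open>auto simp: pure_tensor_def\<close>)
qed

lemma lin_ext_bilin:
  assumes C: "module K C" and \<phi>: "bilin K A B C \<phi>"
  shows "lin_ext K C (\<lambda>p. \<phi> (fst p) (snd p)) \<in> lin_map K P.F C"
    and "i \<in> N \<Longrightarrow> lin_ext K C (\<lambda>p. \<phi> (fst p) (snd p)) i = \<zero>\<^bsub>C\<^esub>"
    and "\<lbrakk>a \<in> carrier A; b \<in> carrier B\<rbrakk> \<Longrightarrow> lin_ext K C (\<lambda>p. \<phi> (fst p) (snd p)) (P.e (a, b)) = \<phi> a b"
proof -
  interpret C: module K C by fact
  let ?L = "lin_ext K C (\<lambda>p. \<phi> (fst p) (snd p))"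
  have \<phi>c: "(\<lambda>p. \<phi> (fst p) (snd p)) \<in> carrier (A \<times>\<times> B) \<rightarrow> carrier C"
    using bilin_simps(1)[OF \<phi>] by auto
  show L: "?L \<in> lin_map K P.F C" by (rule P.lin_ext_lin_map[OF C \<phi>c])
  have basis: "?L (P.e (a, b)) = \<phi> a b" if "a \<in> carrier A" "b \<in> carrier B" for a b
    using P.lin_ext_basis[OF C \<phi>c, of "(a, b)"] that by simp
  then show "\<lbrakk>a \<in> carrier A; b \<in> carrier B\<rbrakk> \<Longrightarrow> ?L (P.e (a, b)) = \<phi> a b" .
  have zero: "submodule {\<zero>\<^bsub>C\<^esub>} K C" by (rule submodule_by_smult[OF C]) auto
  note simps = lin_map_diff[OF PF.module C L] lin_mapD[OF L] basis e_closed bilin_simps[OF \<phi>]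
    C.M.minus_eq_zero_iff
  have "?L r \<in> {\<zero>\<^bsub>C\<^esub>}" if "r \<in> bilinear_rels K A B" for r
    using that by (cases rule: bilinear_rels_cases) (simp_all add: simps)
  from null_vimage[OF L C zero this] show "?L i = \<zero>\<^bsub>C\<^esub>" if "i \<in> N"
    using that by simp
qed

lemma tensor_lift_proj:
  assumes "module K C" "bilin K A B C \<phi>" "f \<in> carrier P.F"
  shows "tensor_lift K C \<phi> (proj f) = lin_ext K C (\<lambda>p. \<phi> (fst p) (snd p)) f"
  unfolding tensor_lift_eq_coset_lift
  by (rule coset_lift_eq[OF PF.assoc_algebra assms(1) null_ideal lin_ext_bilin(1,2)[OF assms(1,2)] assms(3)])

lemma tensor_lift_lin_map:
  assumes "module K C" "bilin K A B C \<phi>"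
  shows "tensor_lift K C \<phi> \<in> lin_map K T C"
  unfolding tensor_lift_eq_coset_lift tensor_def
  by (rule coset_lift_lin_map[OF PF.assoc_algebra assms(1) null_ideal lin_ext_bilin(1,2)[OF assms]])

lemma tensor_lift_pure:
  assumes "module K C" "bilin K A B C \<phi>" "a \<in> carrier A" "b \<in> carrier B"
  shows "tensor_lift K C \<phi> (pt a b) = \<phi> a b"
  unfolding pure_tensor_def tensor_lift_proj[OF assms(1,2) e_closed[OF assms(3,4)]]
  by (rule lin_ext_bilin(3)[OF assms])

lemma tensor_lift_mult:
  assumes C: "assoc_algebra K C"
    and \<phi>: "bilin K A B C \<phi>" and \<phi>1: "bilin K A B C \<phi>1" and \<phi>2: "bilin K A B C \<phi>2"
    and mult: "\<And>a b a' b'. \<lbrakk>a \<in> carrier A; b \<in> carrier B; a' \<in> carrier A; b' \<in> carrier B\<rbrakk> \<Longrightarrow>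
      \<phi> (a \<otimes>\<^bsub>A\<^esub> a') (b \<otimes>\<^bsub>B\<^esub> b') = \<phi>1 a b \<otimes>\<^bsub>C\<^esub> \<phi>2 a' b'"
    and "t \<in> carrier T" "u \<in> carrier T"
  shows "tensor_lift K C \<phi> (t \<otimes>\<^bsub>T\<^esub> u) = tensor_lift K C \<phi>1 t \<otimes>\<^bsub>C\<^esub> tensor_lift K C \<phi>2 u"
proof -
  interpret C: assoc_algebra K C by fact
  obtain f where f: "f \<in> carrier P.F" "t = proj f" using assms(6) T_carrier by blast
  obtain g where g: "g \<in> carrier P.F" "u = proj g" using assms(7) T_carrier by blast
  have \<phi>c: "(\<lambda>p. \<psi> (fst p) (snd p)) \<in> carrier (A \<times>\<times> B) \<rightarrow> carrier C" if "bilin K A B C \<psi>" for \<psi>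
    by (rule funcsetI) (simp add: bilin_simps(1)[OF that] mem_Times_iff)
  have "lin_ext K C (\<lambda>p. \<phi> (fst p) (snd p)) (f \<otimes>\<^bsub>P.F\<^esub> g) =
      lin_ext K C (\<lambda>p. \<phi>1 (fst p) (snd p)) f \<otimes>\<^bsub>C\<^esub> lin_ext K C (\<lambda>p. \<phi>2 (fst p) (snd p)) g"
    by (rule P.lin_ext_mult[OF C \<phi>c[OF \<phi>] \<phi>c[OF \<phi>1] \<phi>c[OF \<phi>2] _ f(1) g(1)])
      (simp add: mult_DirProd' mult mem_Times_iff)
  then show ?thesis
    unfolding f(2) g(2) alg_homD(3)[OF proj_hom f(1) g(1), symmetric]
      tensor_lift_proj[OF C.module \<phi> PF.m_closed[OF f(1) g(1)]]
      tensor_lift_proj[OF C.module \<phi>1 f(1)] tensor_lift_proj[OF C.module \<phi>2 g(1)] .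
qed

lemma tensor_lift_alg_hom:
  assumes C: "assoc_algebra K C" and \<phi>: "bilin K A B C \<phi>" and one: "\<phi> \<one>\<^bsub>A\<^esub> \<one>\<^bsub>B\<^esub> = \<one>\<^bsub>C\<^esub>"
    and mult: "\<And>a b a' b'. \<lbrakk>a \<in> carrier A; b \<in> carrier B; a' \<in> carrier A; b' \<in> carrier B\<rbrakk> \<Longrightarrow>
      \<phi> (a \<otimes>\<^bsub>A\<^esub> a') (b \<otimes>\<^bsub>B\<^esub> b') = \<phi> a b \<otimes>\<^bsub>C\<^esub> \<phi> a' b'"
  shows "tensor_lift K C \<phi> \<in> alg_hom K T C"
proof -
  interpret C: assoc_algebra K C by fact
  show ?thesis
  proof (rule alg_homI[OF tensor_lift_lin_map[OF C.module \<phi>]])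
    show "tensor_lift K C \<phi> (t \<otimes>\<^bsub>T\<^esub> u) = tensor_lift K C \<phi> t \<otimes>\<^bsub>C\<^esub> tensor_lift K C \<phi> u"
      if "t \<in> carrier T" "u \<in> carrier T" for t u
      by (rule tensor_lift_mult[OF C \<phi> \<phi> \<phi> mult that])
    show "tensor_lift K C \<phi> \<one>\<^bsub>T\<^esub> = \<one>\<^bsub>C\<^esub>"
      by (simp add: T_one tensor_lift_pure[OF C.module \<phi>] one)
  qed
qed

end

lemma tensor_pairI: "assoc_algebra K A \<Longrightarrow> assoc_algebra K B \<Longrightarrow> tensor_pair K A B"
  by (rule tensor_pair.intro)

text \<open>The homomorphism \<open>f \<otimes> g\<close>, in the form in which the bialgebra axioms mention \<open>\<Delta> \<otimes> id\<close> and \<open>id \<otimes> \<Delta>\<close>.\<close>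

lemma tensor_map_alg_hom:
  assumes A: "assoc_algebra K A" and B: "assoc_algebra K B"
    and A': "assoc_algebra K A'" and B': "assoc_algebra K B'"
    and f: "f \<in> alg_hom K A A'" and g: "g \<in> alg_hom K B B'"
  shows "tensor_lift K (tensor K A' B') (\<lambda>a b. pure_tensor K A' B' (f a) (g b))
           \<in> alg_hom K (tensor K A B) (tensor K A' B')" (is ?hom)
    and "\<lbrakk>a \<in> carrier A; b \<in> carrier B\<rbrakk> \<Longrightarrow>
      tensor_lift K (tensor K A' B') (\<lambda>a b. pure_tensor K A' B' (f a) (g b)) (pure_tensor K A B a b)
        = pure_tensor K A' B' (f a) (g b)"
proof -
  interpret S: tensor_pair K A B using A B by (rule tensor_pairI)
  interpret T: tensor_pair K A' B' using A' B' by (rule tensor_pairI)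
  note bl = bilin_comp[OF T.pt_bilin alg_hom_lin_map[OF f] alg_hom_lin_map[OF g]]
  show ?hom
    by (rule S.tensor_lift_alg_hom[OF T.T_assoc_algebra bl])
      (simp_all add: alg_homD[OF f] alg_homD[OF g] T.T_one T.pt_mult)
  show "\<lbrakk>a \<in> carrier A; b \<in> carrier B\<rbrakk> \<Longrightarrow>
      tensor_lift K (tensor K A' B') (\<lambda>a b. pure_tensor K A' B' (f a) (g b)) (pure_tensor K A B a b)
        = pure_tensor K A' B' (f a) (g b)"
    by (rule S.tensor_lift_pure[OF T.T.module bl])
qed

text \<open>For a fixed third factor \<open>c\<close> the map \<open>a \<otimes> b \<mapsto> a \<otimes> (b \<otimes> c)\<close> is only linear; multiplicativity
  of the associator relates the maps for \<open>c\<close>, \<open>c'\<close> and \<open>c c'\<close>.\<close>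

lemma tensor_assoc_alg_hom:
  assumes A: "assoc_algebra K A"
  shows "tensor_assoc K A \<in>
      alg_hom K (tensor K (tensor K A A) A) (tensor K A (tensor K A A))" (is ?hom)
    and "\<lbrakk>a \<in> carrier A; b \<in> carrier A; c \<in> carrier A\<rbrakk> \<Longrightarrow>
      tensor_assoc K A (pure_tensor K (tensor K A A) A (pure_tensor K A A a b) c) =
      pure_tensor K A (tensor K A A) a (pure_tensor K A A b c)"
proof -
  interpret AA: tensor_pair K A A using A A by (rule tensor_pairI)
  interpret L: tensor_pair K AA.T A using AA.T_assoc_algebra A by (rule tensor_pairI)
  interpret R: tensor_pair K A AA.T using A AA.T_assoc_algebra by (rule tensor_pairI)
  let ?\<phi> = "\<lambda>c a b. R.pt a (AA.pt b c)"
  let ?\<Phi> = "\<lambda>t c. tensor_lift K R.T (?\<phi> c) t"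
  note C = R.T.module and sm = R.pt_simps AA.pt_simps
  have \<phi>: "bilin K A A R.T (?\<phi> c)" if "c \<in> carrier A" for c
    using that by (intro bilinI lin_mapI) (simp_all add: sm)
  note lin = AA.tensor_lift_lin_map[OF C \<phi>] and pure = AA.tensor_lift_pure[OF C \<phi>]
  have \<Phi>: "bilin K AA.T A R.T ?\<Phi>"
  proof (intro bilinI lin)
    fix t assume t: "t \<in> carrier AA.T"
    show "?\<Phi> t \<in> lin_map K A R.T"
    proof (rule lin_mapI)
      fix c c' assume c: "c \<in> carrier A" and c': "c' \<in> carrier A"
      then have cc: "c \<oplus>\<^bsub>A\<^esub> c' \<in> carrier A" by (rule AA.A.M.a_closed)
      show "?\<Phi> t (c \<oplus>\<^bsub>A\<^esub> c') = ?\<Phi> t c \<oplus>\<^bsub>R.T\<^esub> ?\<Phi> t c'"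
        by (rule AA.lin_eq_on_pure[OF C lin[OF cc] lin_map_plus[OF C lin[OF c] lin[OF c']] _ t])
          (simp add: pure sm c c')
    next
      fix c k assume c: "c \<in> carrier A" and k: "k \<in> carrier K"
      from k c have kc: "k \<odot>\<^bsub>A\<^esub> c \<in> carrier A" by (rule AA.A.smult_closed)
      show "?\<Phi> t (k \<odot>\<^bsub>A\<^esub> c) = k \<odot>\<^bsub>R.T\<^esub> ?\<Phi> t c"
        by (rule AA.lin_eq_on_pure[OF C lin[OF kc] lin_map_smult[OF C lin[OF c] k] _ t])
          (simp add: pure sm c k)
    qed (rule lin_mapD(1)[OF lin t])
  qed
  have eq: "tensor_assoc K A = tensor_lift K R.T ?\<Phi>"
    by (simp add: tensor_assoc_def Let_def)
  show ?hom
    unfolding eq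
  proof (rule L.tensor_lift_alg_hom[OF R.T_assoc_algebra \<Phi>])
    fix t c u d assume t: "t \<in> carrier AA.T" and c: "c \<in> carrier A"
      and u: "u \<in> carrier AA.T" and d: "d \<in> carrier A"
    from c d have cd: "c \<otimes>\<^bsub>A\<^esub> d \<in> carrier A" by (rule AA.A.m_closed)
    show "?\<Phi> (t \<otimes>\<^bsub>AA.T\<^esub> u) (c \<otimes>\<^bsub>A\<^esub> d) = ?\<Phi> t c \<otimes>\<^bsub>R.T\<^esub> ?\<Phi> u d"
      by (rule AA.tensor_lift_mult[OF R.T_assoc_algebra \<phi>[OF cd] \<phi>[OF c] \<phi>[OF d] _ t u])
        (simp add: R.pt_mult AA.pt_mult sm c d)
  qed (simp add: AA.T_one R.T_one pure)
  show "\<lbrakk>a \<in> carrier A; b \<in> carrier A; c \<in> carrier A\<rbrakk> \<Longrightarrow>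
    tensor_assoc K A (L.pt (AA.pt a b) c) = R.pt a (AA.pt b c)"
    unfolding eq by (simp add: L.tensor_lift_pure[OF C \<Phi>] AA.pt_simps pure)
qed

section \<open>Clifford algebras of forms of rank at most one\<close>

lemma (in cring) double_product_expand:
  assumes "p \<in> carrier R" "p' \<in> carrier R" "q \<in> carrier R" "q' \<in> carrier R"
    and "x \<in> carrier R" "y \<in> carrier R" "z \<in> carrier R"
  shows "p' \<otimes> (p \<otimes> (x \<otimes> x \<oplus> x \<otimes> x)) \<oplus> p' \<otimes> (q \<otimes> (y \<otimes> x \<oplus> y \<otimes> x))
      \<oplus> (q' \<otimes> (p \<otimes> (x \<otimes> z \<oplus> x \<otimes> z)) \<oplus> q' \<otimes> (q \<otimes> (y \<otimes> z \<oplus> y \<otimes> z)))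
    = (p \<otimes> x \<oplus> q \<otimes> y) \<otimes> (p' \<otimes> x \<oplus> q' \<otimes> z) \<oplus> (p \<otimes> x \<oplus> q \<otimes> y) \<otimes> (p' \<otimes> x \<oplus> q' \<otimes> z)"
  using assms by (simp add: l_distr r_distr m_ac a_ac)

context assoc_algebra begin

definition acomm :: "'c \<Rightarrow> 'c \<Rightarrow> 'c"
  where "acomm x y = x \<otimes>\<^bsub>A\<^esub> y \<oplus>\<^bsub>A\<^esub> y \<otimes>\<^bsub>A\<^esub> x"

lemma acomm_closed: "\<lbrakk>x \<in> carrier A; y \<in> carrier A\<rbrakk> \<Longrightarrow> acomm x y \<in> carrier A"
  by (simp add: acomm_def)

lemma acomm_commute: "\<lbrakk>x \<in> carrier A; y \<in> carrier A\<rbrakk> \<Longrightarrow> acomm x y = acomm y x"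
  by (simp add: acomm_def M.a_comm)

lemma acomm_add_left:
  "\<lbrakk>x \<in> carrier A; y \<in> carrier A; z \<in> carrier A\<rbrakk> \<Longrightarrow> acomm (x \<oplus>\<^bsub>A\<^esub> y) z = acomm x z \<oplus>\<^bsub>A\<^esub> acomm y z"
  by (simp add: acomm_def l_distr r_distr M.a_ac)

lemma acomm_add_right:
  "\<lbrakk>x \<in> carrier A; y \<in> carrier A; z \<in> carrier A\<rbrakk> \<Longrightarrow> acomm z (x \<oplus>\<^bsub>A\<^esub> y) = acomm z x \<oplus>\<^bsub>A\<^esub> acomm z y"
  by (simp add: acomm_def l_distr r_distr M.a_ac)

lemma acomm_smult_left:
  "\<lbrakk>c \<in> carrier K; x \<in> carrier A; y \<in> carrier A\<rbrakk> \<Longrightarrow> acomm (c \<odot>\<^bsub>A\<^esub> x) y = c \<odot>\<^bsub>A\<^esub> acomm x y"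
  by (simp add: acomm_def smult_mult_left smult_mult_right smult_r_distr)

lemma acomm_smult_right:
  "\<lbrakk>c \<in> carrier K; x \<in> carrier A; y \<in> carrier A\<rbrakk> \<Longrightarrow> acomm y (c \<odot>\<^bsub>A\<^esub> x) = c \<odot>\<^bsub>A\<^esub> acomm y x"
  by (simp add: acomm_def smult_mult_left smult_mult_right smult_r_distr)

lemma double_cancel:
  assumes two: "\<one>\<^bsub>K\<^esub> \<oplus>\<^bsub>K\<^esub> \<one>\<^bsub>K\<^esub> \<noteq> \<zero>\<^bsub>K\<^esub>" and "x \<in> carrier A" "y \<in> carrier A" "x \<oplus>\<^bsub>A\<^esub> x = y \<oplus>\<^bsub>A\<^esub> y"
  shows "x = y"
proof -
  let ?t = "\<one>\<^bsub>K\<^esub> \<oplus>\<^bsub>K\<^esub> \<one>\<^bsub>K\<^esub>"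
  have t: "?t \<in> Units K" using two by (simp add: field_Units)
  have "z = inv\<^bsub>K\<^esub> ?t \<odot>\<^bsub>A\<^esub> (z \<oplus>\<^bsub>A\<^esub> z)" if "z \<in> carrier A" for z
  proof -
    have "z \<oplus>\<^bsub>A\<^esub> z = ?t \<odot>\<^bsub>A\<^esub> z" using that by (simp add: smult_l_distr)
    then show ?thesis using that t by (simp add: smult_assoc1[symmetric])
  qed
  then show ?thesis using assms by metis
qed

text \<open>Generators whose span carries the quadratic form \<open>v \<mapsto> v\<^sup>2\<close>, the square of the linear form with
  values \<open>c s\<close>: every anticommutator is twice a product of two values.\<close>

definition rank_one_family :: "'g set \<Rightarrow> ('g \<Rightarrow> 'a) \<Rightarrow> ('g \<Rightarrow> 'c) \<Rightarrow> bool"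
  where "rank_one_family S c v \<longleftrightarrow> v \<in> S \<rightarrow> carrier A \<and>
    (\<forall>s\<in>S. \<forall>t\<in>S. acomm (v s) (v t) = (c s \<otimes>\<^bsub>K\<^esub> c t \<oplus>\<^bsub>K\<^esub> c s \<otimes>\<^bsub>K\<^esub> c t) \<odot>\<^bsub>A\<^esub> \<one>\<^bsub>A\<^esub>)"

text \<open>The anticommutator is bilinear, so the square of a linear form stays one on any linear combinations.
  Those of a fixed generator \<open>m\<close> with one other generator cover the change of variables to \<open>E(n)\<close> and its
  inverse.\<close>

lemma rank_one_substitution:
  assumes v: "rank_one_family S c v" and c: "\<And>s. s \<in> S \<Longrightarrow> c s \<in> carrier K"
    and p: "\<And>s. s \<in> S' \<Longrightarrow> p s \<in> carrier K" and q: "\<And>s. s \<in> S' \<Longrightarrow> q s \<in> carrier K"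
    and m: "m \<in> S" and b: "\<And>s. s \<in> S' \<Longrightarrow> b s \<in> S"
    and c': "\<And>s. s \<in> S' \<Longrightarrow> c' s = p s \<otimes>\<^bsub>K\<^esub> c m \<oplus>\<^bsub>K\<^esub> q s \<otimes>\<^bsub>K\<^esub> c (b s)"
  shows "rank_one_family S' c' (\<lambda>s. p s \<odot>\<^bsub>A\<^esub> v m \<oplus>\<^bsub>A\<^esub> q s \<odot>\<^bsub>A\<^esub> v (b s))"
proof -
  have vc: "v s \<in> carrier A" if "s \<in> S" for s
    using v that by (auto simp: rank_one_family_def)
  have ac: "acomm (v s) (v t) = (c s \<otimes>\<^bsub>K\<^esub> c t \<oplus>\<^bsub>K\<^esub> c s \<otimes>\<^bsub>K\<^esub> c t) \<odot>\<^bsub>A\<^esub> \<one>\<^bsub>A\<^esub>" if "s \<in> S" "t \<in> S" for s t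
    using v that by (simp add: rank_one_family_def)
  have "acomm (p s \<odot>\<^bsub>A\<^esub> v m \<oplus>\<^bsub>A\<^esub> q s \<odot>\<^bsub>A\<^esub> v (b s)) (p t \<odot>\<^bsub>A\<^esub> v m \<oplus>\<^bsub>A\<^esub> q t \<odot>\<^bsub>A\<^esub> v (b t))
      = (c' s \<otimes>\<^bsub>K\<^esub> c' t \<oplus>\<^bsub>K\<^esub> c' s \<otimes>\<^bsub>K\<^esub> c' t) \<odot>\<^bsub>A\<^esub> \<one>\<^bsub>A\<^esub>" (is "?l = _ \<odot>\<^bsub>A\<^esub> _")
    if s: "s \<in> S'" and t: "t \<in> S'" for s t
  proof -
    note sc = p[OF s] p[OF t] q[OF s] q[OF t] c[OF m] c[OF b[OF s]] c[OF b[OF t]]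
    note vs = vc[OF m] vc[OF b[OF s]] vc[OF b[OF t]]
    let ?two = "\<lambda>x y. x \<otimes>\<^bsub>K\<^esub> y \<oplus>\<^bsub>K\<^esub> x \<otimes>\<^bsub>K\<^esub> y"
    have "?l = (p t \<otimes>\<^bsub>K\<^esub> (p s \<otimes>\<^bsub>K\<^esub> ?two (c m) (c m)) \<oplus>\<^bsub>K\<^esub> p t \<otimes>\<^bsub>K\<^esub> (q s \<otimes>\<^bsub>K\<^esub> ?two (c (b s)) (c m))
        \<oplus>\<^bsub>K\<^esub> (q t \<otimes>\<^bsub>K\<^esub> (p s \<otimes>\<^bsub>K\<^esub> ?two (c m) (c (b t))) \<oplus>\<^bsub>K\<^esub> q t \<otimes>\<^bsub>K\<^esub> (q s \<otimes>\<^bsub>K\<^esub> ?two (c (b s)) (c (b t))))) \<odot>\<^bsub>A\<^esub> \<one>\<^bsub>A\<^esub>"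
      by (simp add: acomm_add_left acomm_add_right acomm_smult_left acomm_smult_right acomm_closed
          ac sc vs m b s t smult_l_distr smult_assoc1 smult_r_distr)
    also have "\<dots> = (c' s \<otimes>\<^bsub>K\<^esub> c' t \<oplus>\<^bsub>K\<^esub> c' s \<otimes>\<^bsub>K\<^esub> c' t) \<odot>\<^bsub>A\<^esub> \<one>\<^bsub>A\<^esub>"
      using double_product_expand[OF sc] by (simp add: c' s t)
    finally show ?thesis .
  qed
  then show ?thesis
    by (simp add: rank_one_family_def p q vc m b)
qed

text \<open>Off the diagonal the two sets of relations are the same; on the diagonal one divides by two.\<close>

lemma clifford_family_iff_rank_one:
  assumes two: "\<one>\<^bsub>K\<^esub> \<oplus>\<^bsub>K\<^esub> \<one>\<^bsub>K\<^esub> \<noteq> \<zero>\<^bsub>K\<^esub>"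
    and c: "\<And>s. s \<in> clifford_gens n \<Longrightarrow> c s \<in> carrier K"
    and \<alpha>: "\<alpha> = c Gen_G \<otimes>\<^bsub>K\<^esub> c Gen_G"
    and \<beta>: "\<And>i. 1 \<le> i \<Longrightarrow> i \<le> n \<Longrightarrow> \<beta> i = c (Gen_X i) \<otimes>\<^bsub>K\<^esub> c (Gen_X i)"
    and \<gamma>: "\<And>i. 1 \<le> i \<Longrightarrow> i \<le> n \<Longrightarrow>
      \<gamma> i = c Gen_G \<otimes>\<^bsub>K\<^esub> c (Gen_X i) \<oplus>\<^bsub>K\<^esub> c Gen_G \<otimes>\<^bsub>K\<^esub> c (Gen_X i)"
    and l: "\<And>i j. 1 \<le> i \<Longrightarrow> i < j \<Longrightarrow> j \<le> n \<Longrightarrow>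
      l i j = c (Gen_X i) \<otimes>\<^bsub>K\<^esub> c (Gen_X j) \<oplus>\<^bsub>K\<^esub> c (Gen_X i) \<otimes>\<^bsub>K\<^esub> c (Gen_X j)"
  shows "clifford_family K A n \<alpha> \<beta> \<gamma> l v \<longleftrightarrow> rank_one_family (clifford_gens n) c v"
proof (cases "v \<in> clifford_gens n \<rightarrow> carrier A")
  case True
  let ?S = "clifford_gens n"
  let ?R = "\<lambda>s t. acomm (v s) (v t) = (c s \<otimes>\<^bsub>K\<^esub> c t \<oplus>\<^bsub>K\<^esub> c s \<otimes>\<^bsub>K\<^esub> c t) \<odot>\<^bsub>A\<^esub> \<one>\<^bsub>A\<^esub>"
  have vc: "v s \<in> carrier A" if "s \<in> ?S" for s using True that by auto
  have G: "Gen_G \<in> ?S" and X: "1 \<le> i \<Longrightarrow> i \<le> n \<Longrightarrow> Gen_X i \<in> ?S" for i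
    by (auto simp: clifford_gens_def)
  have sym: "?R s t \<longleftrightarrow> ?R t s" if "s \<in> ?S" "t \<in> ?S" for s t
    using that by (simp add: acomm_commute[of "v s"] vc c m_comm[of "c s"])
  have diag: "v s \<otimes>\<^bsub>A\<^esub> v s = (c s \<otimes>\<^bsub>K\<^esub> c s) \<odot>\<^bsub>A\<^esub> \<one>\<^bsub>A\<^esub> \<longleftrightarrow> ?R s s" if s: "s \<in> ?S" for s
  proof -
    have "?R s s \<longleftrightarrow> v s \<otimes>\<^bsub>A\<^esub> v s \<oplus>\<^bsub>A\<^esub> v s \<otimes>\<^bsub>A\<^esub> v s =
        (c s \<otimes>\<^bsub>K\<^esub> c s) \<odot>\<^bsub>A\<^esub> \<one>\<^bsub>A\<^esub> \<oplus>\<^bsub>A\<^esub> (c s \<otimes>\<^bsub>K\<^esub> c s) \<odot>\<^bsub>A\<^esub> \<one>\<^bsub>A\<^esub>"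
      using s by (simp add: acomm_def c smult_l_distr)
    then show ?thesis
      using double_cancel[OF two, of "v s \<otimes>\<^bsub>A\<^esub> v s" "(c s \<otimes>\<^bsub>K\<^esub> c s) \<odot>\<^bsub>A\<^esub> \<one>\<^bsub>A\<^esub>"] s by (auto simp: vc c)
  qed
  have fam: "clifford_family K A n \<alpha> \<beta> \<gamma> l v \<longleftrightarrow>
      ?R Gen_G Gen_G \<and> (\<forall>i. 1 \<le> i \<and> i \<le> n \<longrightarrow> ?R (Gen_X i) (Gen_X i))
      \<and> (\<forall>i. 1 \<le> i \<and> i \<le> n \<longrightarrow> ?R Gen_G (Gen_X i))
      \<and> (\<forall>i j. 1 \<le> i \<and> i < j \<and> j \<le> n \<longrightarrow> ?R (Gen_X i) (Gen_X j))"
    using True by (simp add: clifford_family_def diag G X \<alpha> \<beta> \<gamma> l acomm_def[symmetric] cong: conj_cong imp_cong)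
  have rk: "rank_one_family ?S c v \<longleftrightarrow> (\<forall>s\<in>?S. \<forall>t\<in>?S. ?R s t)"
    using True by (simp add: rank_one_family_def)
  show ?thesis
  proof
    assume "clifford_family K A n \<alpha> \<beta> \<gamma> l v"
    then have GG: "?R Gen_G Gen_G" and XX: "\<And>i. 1 \<le> i \<Longrightarrow> i \<le> n \<Longrightarrow> ?R (Gen_X i) (Gen_X i)"
      and GX: "\<And>i. 1 \<le> i \<Longrightarrow> i \<le> n \<Longrightarrow> ?R Gen_G (Gen_X i)"
      and XY: "\<And>i j. 1 \<le> i \<Longrightarrow> i < j \<Longrightarrow> j \<le> n \<Longrightarrow> ?R (Gen_X i) (Gen_X j)"
      unfolding fam by blast+
    have XY': "?R (Gen_X i) (Gen_X j)" if "1 \<le> i" "i \<le> n" "1 \<le> j" "j \<le> n" for i j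
      using XX[of i] XY[of i j] XY[of j i] sym[OF X X, of i j] that
      by (cases i j rule: linorder_cases) auto
    have GX': "?R (Gen_X i) Gen_G" if "1 \<le> i" "i \<le> n" for i
      using GX[OF that] sym[OF G X[OF that]] by blast
    show "rank_one_family ?S c v"
      unfolding rk using GG GX GX' XY' by (auto simp: clifford_gens_def)
  next
    assume "rank_one_family ?S c v"
    then show "clifford_family K A n \<alpha> \<beta> \<gamma> l v"
      unfolding rk fam using G X by auto
  qed
qed (auto simp: clifford_family_def rank_one_family_def)

lemma clifford_family_image:
  assumes "assoc_algebra K B" "h \<in> alg_hom K A B" "clifford_family K A n \<alpha> \<beta> \<gamma> l v"
    and sc: "\<alpha> \<in> carrier K" "\<And>i. 1 \<le> i \<Longrightarrow> i \<le> n \<Longrightarrow> \<beta> i \<in> carrier K"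
      "\<And>i. 1 \<le> i \<Longrightarrow> i \<le> n \<Longrightarrow> \<gamma> i \<in> carrier K"
      "\<And>i j. 1 \<le> i \<Longrightarrow> i < j \<Longrightarrow> j \<le> n \<Longrightarrow> l i j \<in> carrier K"
  shows "clifford_family K B n \<alpha> \<beta> \<gamma> l (\<lambda>s. h (v s))"
proof -
  note f = assms(3)[unfolded clifford_family_def]
  have G: "v Gen_G \<in> carrier A" and X: "1 \<le> i \<Longrightarrow> i \<le> n \<Longrightarrow> v (Gen_X i) \<in> carrier A" for i
    using f by (auto simp: clifford_gens_def)
  note h = alg_homD[OF assms(2)] and hs = alg_homD(2-5)[OF assms(2), symmetric]
  show ?thesis
    unfolding clifford_family_def
    using f by (simp add: hs G X sc) (simp add: Pi_iff h)
qed

end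

lemma base_assoc_algebra: "field K \<Longrightarrow> assoc_algebra K (base_algebra K)"
proof -
  assume "field K"
  then interpret K: field K .
  show ?thesis
  proof (rule assoc_algebraI[OF K.field_axioms], goal_cases)
    case (6 x)
    then show ?case
      by (intro bexI[of _ "\<ominus>\<^bsub>K\<^esub> x"]) (simp_all add: base_algebra_def K.l_neg)
  qed (simp_all add: base_algebra_def K.a_ac K.m_ac K.l_distr K.r_distr)
qed

lemma base_simps [simp]:
  "carrier (base_algebra K) = carrier K" "\<zero>\<^bsub>base_algebra K\<^esub> = \<zero>\<^bsub>K\<^esub>" "\<one>\<^bsub>base_algebra K\<^esub> = \<one>\<^bsub>K\<^esub>"
  "x \<oplus>\<^bsub>base_algebra K\<^esub> y = x \<oplus>\<^bsub>K\<^esub> y" "x \<otimes>\<^bsub>base_algebra K\<^esub> y = x \<otimes>\<^bsub>K\<^esub> y" "x \<odot>\<^bsub>base_algebra K\<^esub> y = x \<otimes>\<^bsub>K\<^esub> y"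
  by (simp_all add: base_algebra_def)

text \<open>The linear form whose square is the quadratic form of \<open>E(n)\<close>.\<close>

definition unit_form :: "('k, 'r) ring_scheme \<Rightarrow> clifford_gen \<Rightarrow> 'k"
  where "unit_form K s = (if s = Gen_G then \<one>\<^bsub>K\<^esub> else \<zero>\<^bsub>K\<^esub>)"

lemma E_clifford_data: "field K \<Longrightarrow> clifford_data K n \<one>\<^bsub>K\<^esub> (\<lambda>i. \<zero>\<^bsub>K\<^esub>) (\<lambda>i. \<zero>\<^bsub>K\<^esub>) (\<lambda>i j. \<zero>\<^bsub>K\<^esub>)"
proof -
  assume "field K"
  then interpret K: field K .
  show ?thesis by unfold_locales auto
qed

lemma (in assoc_algebra) E_family_iff:
  assumes "\<one>\<^bsub>K\<^esub> \<oplus>\<^bsub>K\<^esub> \<one>\<^bsub>K\<^esub> \<noteq> \<zero>\<^bsub>K\<^esub>"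
  shows "clifford_family K A n \<one>\<^bsub>K\<^esub> (\<lambda>i. \<zero>\<^bsub>K\<^esub>) (\<lambda>i. \<zero>\<^bsub>K\<^esub>) (\<lambda>i j. \<zero>\<^bsub>K\<^esub>) v
    \<longleftrightarrow> rank_one_family (clifford_gens n) (unit_form K) v"
  by (rule clifford_family_iff_rank_one[OF assms]) (simp_all add: unit_form_def)

text \<open>If the form is the square of a nonzero linear form \<open>c\<close>, say \<open>c m \<noteq> 0\<close>, then moving \<open>m\<close> to the
  place of \<open>G\<close> and subtracting multiples of it from the other generators gives generators of \<open>E(n)\<close>.
  Both directions of this change of variables are substitutions of generators, so they define
  mutually inverse homomorphisms.\<close>

lemma (in clifford_data) isomorphic_E_algebra:
  assumes two: "\<one>\<^bsub>K\<^esub> \<oplus>\<^bsub>K\<^esub> \<one>\<^bsub>K\<^esub> \<noteq> \<zero>\<^bsub>K\<^esub>"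
    and c: "\<And>s. s \<in> clifford_gens n \<Longrightarrow> c s \<in> carrier K"
    and \<alpha>c: "\<alpha> = c Gen_G \<otimes>\<^bsub>K\<^esub> c Gen_G"
    and \<beta>c: "\<And>i. 1 \<le> i \<Longrightarrow> i \<le> n \<Longrightarrow> \<beta> i = c (Gen_X i) \<otimes>\<^bsub>K\<^esub> c (Gen_X i)"
    and \<gamma>c: "\<And>i. 1 \<le> i \<Longrightarrow> i \<le> n \<Longrightarrow>
      \<gamma> i = c Gen_G \<otimes>\<^bsub>K\<^esub> c (Gen_X i) \<oplus>\<^bsub>K\<^esub> c Gen_G \<otimes>\<^bsub>K\<^esub> c (Gen_X i)"
    and lc: "\<And>i j. 1 \<le> i \<Longrightarrow> i < j \<Longrightarrow> j \<le> n \<Longrightarrow>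
      l i j = c (Gen_X i) \<otimes>\<^bsub>K\<^esub> c (Gen_X j) \<oplus>\<^bsub>K\<^esub> c (Gen_X i) \<otimes>\<^bsub>K\<^esub> c (Gen_X j)"
    and m: "m \<in> clifford_gens n" "c m \<noteq> \<zero>\<^bsub>K\<^esub>"
  shows "alg_isomorphic K Cl (E_algebra K n)"
proof -
  interpret E: clifford_data K n "\<one>\<^bsub>K\<^esub>" "\<lambda>i. \<zero>\<^bsub>K\<^esub>" "\<lambda>i. \<zero>\<^bsub>K\<^esub>" "\<lambda>i j. \<zero>\<^bsub>K\<^esub>"
    by (rule E_clifford_data[OF K.field_axioms])
  interpret C: assoc_algebra K Cl by (rule Cl_assoc_algebra)
  interpret D: assoc_algebra K E.Cl by (rule E.Cl_assoc_algebra)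
  let ?S = "clifford_gens n" and ?\<sigma> = "transpose Gen_G m"
  let ?Y = cl_gen and ?Z = E.cl_gen
  have G: "Gen_G \<in> ?S" by (rule G_in_gens)
  have \<sigma>: "?\<sigma> s \<in> ?S" if "s \<in> ?S" for s
    using that G m by (auto simp: transpose_def)
  have \<sigma>G: "?\<sigma> s = Gen_G \<longleftrightarrow> s = m" and \<sigma>m: "?\<sigma> s = m \<longleftrightarrow> s = Gen_G" for s
    by (auto simp: transpose_def)
  have cm: "c m \<in> carrier K" "inv\<^bsub>K\<^esub> c m \<in> carrier K" "c m \<otimes>\<^bsub>K\<^esub> inv\<^bsub>K\<^esub> c m = \<one>\<^bsub>K\<^esub>" "inv\<^bsub>K\<^esub> c m \<otimes>\<^bsub>K\<^esub> c m = \<one>\<^bsub>K\<^esub>"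
    using m c[OF m(1)] by (simp_all add: K.field_Units)
  have Y: "?Y s \<in> carrier Cl" and Z: "?Z s \<in> carrier E.Cl" if "s \<in> ?S" for s
    using that by (auto intro: cl_gen_closed E.cl_gen_closed)
  have fam: "clifford_family K Cl n \<alpha> \<beta> \<gamma> l v \<longleftrightarrow> C.rank_one_family ?S c v" for v
    by (rule C.clifford_family_iff_rank_one[OF two c \<alpha>c \<beta>c \<gamma>c lc])
  have fam': "clifford_family K E.Cl n \<alpha> \<beta> \<gamma> l v \<longleftrightarrow> D.rank_one_family ?S c v" for v
    by (rule D.clifford_family_iff_rank_one[OF two c \<alpha>c \<beta>c \<gamma>c lc])
  \<comment> \<open>\<open>W s = c s Z G + Z (\<sigma> s)\<close>, without the second term for \<open>s = m\<close>, has value \<open>c s\<close> under the form of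
    \<open>E(n)\<close>.  Solving for \<open>Z\<close> gives \<open>V G = Y m / c m\<close> and \<open>V s = Y (\<sigma> s) - (c (\<sigma> s) / c m) Y m\<close>.\<close>
  define q where "q s = (if s = m then \<zero>\<^bsub>K\<^esub> else \<one>\<^bsub>K\<^esub>)" for s
  define p' where "p' s = (if s = Gen_G then inv\<^bsub>K\<^esub> c m else \<ominus>\<^bsub>K\<^esub> (inv\<^bsub>K\<^esub> c m \<otimes>\<^bsub>K\<^esub> c (?\<sigma> s)))" for s
  define q' where "q' s = (if s = Gen_G then \<zero>\<^bsub>K\<^esub> else \<one>\<^bsub>K\<^esub>)" for s :: clifford_gen
  define W where "W s = c s \<odot>\<^bsub>E.Cl\<^esub> ?Z Gen_G \<oplus>\<^bsub>E.Cl\<^esub> q s \<odot>\<^bsub>E.Cl\<^esub> ?Z (?\<sigma> s)" for s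
  define V where "V s = p' s \<odot>\<^bsub>Cl\<^esub> ?Y m \<oplus>\<^bsub>Cl\<^esub> q' s \<odot>\<^bsub>Cl\<^esub> ?Y (?\<sigma> s)" for s
  have sc: "q s \<in> carrier K" "p' s \<in> carrier K" "q' s \<in> carrier K" if "s \<in> ?S" for s
    using that cm c \<sigma> by (auto simp: q_def p'_def q'_def)
  have uf: "unit_form K s \<in> carrier K" for s by (simp add: unit_form_def)
  have p'm: "p' s \<otimes>\<^bsub>K\<^esub> c m = \<ominus>\<^bsub>K\<^esub> c (?\<sigma> s)" if s: "s \<in> ?S" and "s \<noteq> Gen_G" for s
  proof -
    have "p' s \<otimes>\<^bsub>K\<^esub> c m = \<ominus>\<^bsub>K\<^esub> (c (?\<sigma> s) \<otimes>\<^bsub>K\<^esub> (inv\<^bsub>K\<^esub> c m \<otimes>\<^bsub>K\<^esub> c m))"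
      using that(2) cm(1,2) c[OF \<sigma>[OF s]] by (simp add: p'_def K.l_minus K.r_minus K.m_ac)
    then show ?thesis using cm c[OF \<sigma>[OF s]] by simp
  qed
  have Wfam: "D.rank_one_family ?S c W"
    unfolding W_def
    by (rule D.rank_one_substitution[OF E.cl_gen_family[unfolded D.E_family_iff[OF two]]])
      (auto simp: uf c sc G \<sigma>, simp add: unit_form_def q_def \<sigma>G c)
  have Vfam: "C.rank_one_family ?S (unit_form K) V"
    unfolding V_def
  proof (rule C.rank_one_substitution[OF cl_gen_family[unfolded fam]])
    fix s assume s: "s \<in> ?S"
    show "unit_form K s = p' s \<otimes>\<^bsub>K\<^esub> c m \<oplus>\<^bsub>K\<^esub> q' s \<otimes>\<^bsub>K\<^esub> c (?\<sigma> s)"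
      using cm c \<sigma> s p'm[OF s] by (cases "s = Gen_G") (simp_all add: unit_form_def q'_def K.l_neg, simp add: p'_def)
  qed (use c sc m \<sigma> in auto)
  obtain f where f: "f \<in> alg_hom K Cl E.Cl" and fY: "\<And>s. s \<in> ?S \<Longrightarrow> f (?Y s) = W s"
    using clifford_universal[OF E.Cl_assoc_algebra Wfam[folded fam']] by metis
  obtain g where g: "g \<in> alg_hom K E.Cl Cl" and gZ: "\<And>s. s \<in> ?S \<Longrightarrow> g (?Z s) = V s"
    using E.clifford_universal[OF Cl_assoc_algebra Vfam[folded C.E_family_iff[OF two]]] by metis
  note fD = alg_homD[OF f] and gD = alg_homD[OF g]
  have VG: "V Gen_G = inv\<^bsub>K\<^esub> c m \<odot>\<^bsub>Cl\<^esub> ?Y m"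
    using cm m Y by (simp add: V_def p'_def q'_def)
  have Wm: "W m = c m \<odot>\<^bsub>E.Cl\<^esub> ?Z Gen_G"
    using cm G Z by (simp add: W_def q_def)
  have "g (f (?Y s)) = ?Y s" if s: "s \<in> ?S" for s
  proof -
    have "g (f (?Y s)) = c s \<odot>\<^bsub>Cl\<^esub> V Gen_G \<oplus>\<^bsub>Cl\<^esub> q s \<odot>\<^bsub>Cl\<^esub> V (?\<sigma> s)"
      using s by (simp add: fY W_def gD Z G \<sigma> c sc gZ)
    also have "\<dots> = ?Y s"
    proof (cases "s = m")
      case True
      then show ?thesis
        using s G c cm Y by (simp add: VG q_def C.smult_assoc1[symmetric])
    next
      case False
      then have p: "p' (?\<sigma> s) = \<ominus>\<^bsub>K\<^esub> (inv\<^bsub>K\<^esub> c m \<otimes>\<^bsub>K\<^esub> c s)" "q' (?\<sigma> s) = \<one>\<^bsub>K\<^esub>"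
        by (simp_all add: p'_def q'_def \<sigma>G)
      have k: "c s \<otimes>\<^bsub>K\<^esub> inv\<^bsub>K\<^esub> c m \<in> carrier K" using c[OF s] cm by simp
      have "c s \<odot>\<^bsub>Cl\<^esub> V Gen_G \<oplus>\<^bsub>Cl\<^esub> q s \<odot>\<^bsub>Cl\<^esub> V (?\<sigma> s) =
        (c s \<otimes>\<^bsub>K\<^esub> inv\<^bsub>K\<^esub> c m) \<odot>\<^bsub>Cl\<^esub> ?Y m \<oplus>\<^bsub>Cl\<^esub> (\<ominus>\<^bsub>Cl\<^esub> ((c s \<otimes>\<^bsub>K\<^esub> inv\<^bsub>K\<^esub> c m) \<odot>\<^bsub>Cl\<^esub> ?Y m) \<oplus>\<^bsub>Cl\<^esub> ?Y s)"
        using False s c[OF s] cm Y m k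
        by (simp add: VG q_def V_def[of "?\<sigma> s"] p C.smult_assoc1 K.m_comm[of "inv\<^bsub>K\<^esub> c m"] C.smult_l_minus)
      also have "\<dots> = ?Y s" using k m(1) s Y by (simp add: C.M.r_neg1 C.M.r_neg2)
      finally show ?thesis .
    qed
    finally show ?thesis .
  qed
  then have gf: "g (f x) = x" if "x \<in> carrier Cl" for x
    by (rule clifford_hom_eq[OF Cl_assoc_algebra alg_hom_comp[OF f g] alg_hom_id _ that])
  have "f (g (?Z s)) = ?Z s" if s: "s \<in> ?S" for s
  proof -
    have "f (g (?Z s)) = p' s \<odot>\<^bsub>E.Cl\<^esub> W m \<oplus>\<^bsub>E.Cl\<^esub> q' s \<odot>\<^bsub>E.Cl\<^esub> W (?\<sigma> s)"
      using s by (simp add: gZ V_def fD Y m(1) \<sigma> c sc fY)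
    also have "\<dots> = ?Z s"
    proof (cases "s = Gen_G")
      case True
      have "W (?\<sigma> s) \<in> carrier E.Cl" using G Z s by (simp add: W_def sc c \<sigma>)
      then show ?thesis
        using True s G c cm Z by (simp add: Wm p'_def q'_def D.smult_assoc1[symmetric])
    next
      case False
      note p = p'm[OF s False]
      have k: "c (?\<sigma> s) \<in> carrier K" using c[OF \<sigma>[OF s]] .
      have "p' s \<odot>\<^bsub>E.Cl\<^esub> W m \<oplus>\<^bsub>E.Cl\<^esub> q' s \<odot>\<^bsub>E.Cl\<^esub> W (?\<sigma> s) =
        \<ominus>\<^bsub>E.Cl\<^esub> (c (?\<sigma> s) \<odot>\<^bsub>E.Cl\<^esub> ?Z Gen_G) \<oplus>\<^bsub>E.Cl\<^esub> (c (?\<sigma> s) \<odot>\<^bsub>E.Cl\<^esub> ?Z Gen_G \<oplus>\<^bsub>E.Cl\<^esub> ?Z s)"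
        using False s cm Z G k sc[OF s]
        by (simp add: Wm D.smult_assoc1[symmetric] p D.smult_l_minus q'_def W_def[of "?\<sigma> s"] q_def \<sigma>m)
      also have "\<dots> = ?Z s" using k G s Z by (simp add: D.M.r_neg1 D.M.r_neg2)
      finally show ?thesis .
    qed
    finally show ?thesis .
  qed
  then have fg: "f (g x) = x" if "x \<in> carrier E.Cl" for x
    by (rule E.clifford_hom_eq[OF E.Cl_assoc_algebra alg_hom_comp[OF g f] alg_hom_id _ that])
  have "bij_betw f (carrier Cl) (carrier E.Cl)"
    by (rule bij_betwI[of _ _ _ g]) (auto simp: fD gD gf fg)
  then show ?thesis
    unfolding alg_isomorphic_def E_algebra_def using f by blast
qed

section \<open>Exterior algebras are not bialgebras\<close>

text \<open>Apply \<open>\<delta> \<otimes> \<delta>\<close> to \<open>(\<Delta> x)\<^sup>2 = 0\<close>.  By the Leibniz rule the value of \<open>\<delta> \<otimes> \<delta>\<close> on a square is expressed by the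
  values of \<open>\<epsilon> \<otimes> \<epsilon>\<close>, \<open>\<epsilon> \<otimes> \<delta>\<close>, \<open>\<delta> \<otimes> \<epsilon>\<close> and \<open>\<delta> \<otimes> \<delta>\<close>.  On \<open>\<Delta> x\<close> the counit axioms make the first
  three equal to \<open>\<epsilon> x = 0\<close>, \<open>\<delta> x = 1\<close> and \<open>\<delta> x = 1\<close>, and the last occurs with the factor \<open>\<epsilon> \<otimes> \<epsilon>\<close>.\<close>

lemma no_comultiplication_square_zero:
  fixes A :: "('k, 'a, 's) module_scheme"
  assumes A: "assoc_algebra K A" and \<epsilon>: "\<epsilon> \<in> alg_hom K A (base_algebra K)"
    and \<delta>: "\<delta> \<in> lin_map K A (base_algebra K)"
    and leibniz: "\<And>x y. \<lbrakk>x \<in> carrier A; y \<in> carrier A\<rbrakk> \<Longrightarrow>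
      \<delta> (x \<otimes>\<^bsub>A\<^esub> y) = \<epsilon> x \<otimes>\<^bsub>K\<^esub> \<delta> y \<oplus>\<^bsub>K\<^esub> \<delta> x \<otimes>\<^bsub>K\<^esub> \<epsilon> y"
    and x: "x \<in> carrier A" "x \<otimes>\<^bsub>A\<^esub> x = \<zero>\<^bsub>A\<^esub>" "\<epsilon> x = \<zero>\<^bsub>K\<^esub>" "\<delta> x = \<one>\<^bsub>K\<^esub>"
    and \<Delta>: "\<Delta> \<in> alg_hom K A (tensor K A A)"
    and left: "tensor_lift K A (\<lambda>a b. \<epsilon> a \<odot>\<^bsub>A\<^esub> b) (\<Delta> x) = x"
    and right: "tensor_lift K A (\<lambda>a b. \<epsilon> b \<odot>\<^bsub>A\<^esub> a) (\<Delta> x) = x"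
  shows "\<one>\<^bsub>K\<^esub> \<oplus>\<^bsub>K\<^esub> \<one>\<^bsub>K\<^esub> = \<zero>\<^bsub>K\<^esub>"
proof -
  interpret K: field K by (rule assoc_algebra.axioms[OF A])
  interpret TT: tensor_pair K A A using A A by (rule tensor_pairI)
  interpret B: assoc_algebra K "base_algebra K" by (rule base_assoc_algebra[OF K.field_axioms])
  note \<epsilon>l = alg_hom_lin_map[OF \<epsilon>]
  let ?L = "\<lambda>u v. tensor_lift K (base_algebra K) (\<lambda>a b. u a \<otimes>\<^bsub>K\<^esub> v b)"
  have bl: "bilin K A A (base_algebra K) (\<lambda>a b. u a \<otimes>\<^bsub>K\<^esub> v b)"
    if u: "u \<in> lin_map K A (base_algebra K)" and v: "v \<in> lin_map K A (base_algebra K)" for u v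
    using lin_mapD[OF u] lin_mapD[OF v]
    by (intro bilinI lin_mapI) (simp_all add: K.l_distr K.r_distr K.m_ac)
  note lin = TT.tensor_lift_lin_map[OF B.module bl]
  note linD = lin_mapD[OF lin, simplified]
  note pure = TT.tensor_lift_pure[OF B.module bl]
  note d = lin_mapD[OF \<delta>, simplified] and e = alg_homD[OF \<epsilon>, simplified]
  \<comment> \<open>The Leibniz rule applied in both factors.\<close>
  let ?R = "\<lambda>t u. (?L \<epsilon> \<epsilon> t \<otimes>\<^bsub>K\<^esub> ?L \<delta> \<delta> u \<oplus>\<^bsub>K\<^esub> ?L \<epsilon> \<delta> t \<otimes>\<^bsub>K\<^esub> ?L \<delta> \<epsilon> u)
      \<oplus>\<^bsub>K\<^esub> (?L \<delta> \<epsilon> t \<otimes>\<^bsub>K\<^esub> ?L \<epsilon> \<delta> u \<oplus>\<^bsub>K\<^esub> ?L \<delta> \<delta> t \<otimes>\<^bsub>K\<^esub> ?L \<epsilon> \<epsilon> u)"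
  have Rl: "(\<lambda>t. ?R t u) \<in> lin_map K TT.T (base_algebra K)"
    and Rr: "?R u \<in> lin_map K TT.T (base_algebra K)" if u: "u \<in> carrier TT.T" for u
    by (intro lin_mapI; simp add: linD \<epsilon>l \<delta> u K.l_distr K.r_distr K.m_ac K.a_ac)+
  have ml: "(\<lambda>t. ?L \<delta> \<delta> (t \<otimes>\<^bsub>TT.T\<^esub> u)) \<in> lin_map K TT.T (base_algebra K)"
    and mr: "(\<lambda>t. ?L \<delta> \<delta> (u \<otimes>\<^bsub>TT.T\<^esub> t)) \<in> lin_map K TT.T (base_algebra K)"
    if u: "u \<in> carrier TT.T" for u
    by (intro lin_mapI; simp add: linD \<delta> u TT.T.l_distr TT.T.r_distr TT.T.smult_mult_left
        TT.T.smult_mult_right)+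
  have pp: "?L \<delta> \<delta> (TT.pt a b \<otimes>\<^bsub>TT.T\<^esub> TT.pt a' b') = ?R (TT.pt a b) (TT.pt a' b')"
    if "a \<in> carrier A" "b \<in> carrier A" "a' \<in> carrier A" "b' \<in> carrier A" for a b a' b'
    using that
    by (simp add: TT.pt_mult pure \<epsilon>l \<delta> leibniz e d K.l_distr K.r_distr K.m_ac K.a_ac)
  have pu: "?L \<delta> \<delta> (TT.pt a b \<otimes>\<^bsub>TT.T\<^esub> u) = ?R (TT.pt a b) u"
    if a: "a \<in> carrier A" and b: "b \<in> carrier A" and u: "u \<in> carrier TT.T" for a b u
    by (rule TT.lin_eq_on_pure[OF B.module mr[OF TT.pt_simps(1)[OF a b]] Rr[OF TT.pt_simps(1)[OF a b]] pp[OF a b] u])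
  have mult: "?L \<delta> \<delta> (t \<otimes>\<^bsub>TT.T\<^esub> u) = ?R t u" if t: "t \<in> carrier TT.T" and u: "u \<in> carrier TT.T" for t u
    by (rule TT.lin_eq_on_pure[OF B.module ml[OF u] Rl[OF u] pu[OF _ _ u] t])
  have \<Delta>x: "\<Delta> x \<in> carrier TT.T" by (rule alg_homD(1)[OF \<Delta> x(1)])
  have bll: "bilin K A A A (\<lambda>a b. \<epsilon> a \<odot>\<^bsub>A\<^esub> b)" and blr: "bilin K A A A (\<lambda>a b. \<epsilon> b \<odot>\<^bsub>A\<^esub> a)"
    by (intro bilinI lin_mapI; simp add: e TT.A.smult_l_distr TT.A.smult_r_distr TT.A.smult_assoc1[symmetric] K.m_ac)+
  have cl: "?L \<epsilon> u (\<Delta> x) = u x" if u: "u \<in> lin_map K A (base_algebra K)" for u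
  proof -
    have "?L \<epsilon> u (\<Delta> x) = u (tensor_lift K A (\<lambda>a b. \<epsilon> a \<odot>\<^bsub>A\<^esub> b) (\<Delta> x))"
      by (rule TT.lin_eq_on_pure[OF B.module lin[OF \<epsilon>l u] lin_map_comp[OF TT.tensor_lift_lin_map[OF TT.A.module bll] u] _ \<Delta>x])
        (simp add: pure[OF \<epsilon>l u] TT.tensor_lift_pure[OF TT.A.module bll] lin_mapD(3)[OF u] e)
    then show ?thesis by (simp add: left)
  qed
  have cr: "?L \<delta> \<epsilon> (\<Delta> x) = \<delta> x"
  proof -
    have "?L \<delta> \<epsilon> (\<Delta> x) = \<delta> (tensor_lift K A (\<lambda>a b. \<epsilon> b \<odot>\<^bsub>A\<^esub> a) (\<Delta> x))"
      by (rule TT.lin_eq_on_pure[OF B.module lin[OF \<delta> \<epsilon>l] lin_map_comp[OF TT.tensor_lift_lin_map[OF TT.A.module blr] \<delta>] _ \<Delta>x])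
        (simp add: pure[OF \<delta> \<epsilon>l] TT.tensor_lift_pure[OF TT.A.module blr] lin_mapD(3)[OF \<delta>] e d K.m_comm)
    then show ?thesis by (simp add: right)
  qed
  have "\<Delta> x \<otimes>\<^bsub>TT.T\<^esub> \<Delta> x = \<zero>\<^bsub>TT.T\<^esub>"
    using alg_homD(3)[OF \<Delta> x(1) x(1)] lin_map_zero[OF TT.A.module TT.T.module alg_hom_lin_map[OF \<Delta>]]
    by (simp add: x(2))
  then have "\<zero>\<^bsub>K\<^esub> = ?L \<delta> \<delta> (\<Delta> x \<otimes>\<^bsub>TT.T\<^esub> \<Delta> x)"
    using lin_map_zero[OF TT.T.module B.module lin[OF \<delta> \<delta>]] by simp
  also have "\<dots> = \<one>\<^bsub>K\<^esub> \<oplus>\<^bsub>K\<^esub> \<one>\<^bsub>K\<^esub>"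
    unfolding mult[OF \<Delta>x \<Delta>x] by (simp add: cl[OF \<epsilon>l] cl[OF \<delta>] cr x linD(1)[OF \<delta> \<delta> \<Delta>x])
  finally show ?thesis by simp
qed

text \<open>The algebra \<open>K[t]/(t\<^sup>2)\<close>, with \<open>(a, b)\<close> for \<open>a + b t\<close>.\<close>

definition dual_numbers :: "('k, 'r) ring_scheme \<Rightarrow> ('k, 'k \<times> 'k) module"
  where "dual_numbers K =
    \<lparr>carrier = carrier K \<times> carrier K,
     mult = (\<lambda>x y. (fst x \<otimes>\<^bsub>K\<^esub> fst y, fst x \<otimes>\<^bsub>K\<^esub> snd y \<oplus>\<^bsub>K\<^esub> snd x \<otimes>\<^bsub>K\<^esub> fst y)),
     one = (\<one>\<^bsub>K\<^esub>, \<zero>\<^bsub>K\<^esub>), zero = (\<zero>\<^bsub>K\<^esub>, \<zero>\<^bsub>K\<^esub>),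
     add = (\<lambda>x y. (fst x \<oplus>\<^bsub>K\<^esub> fst y, snd x \<oplus>\<^bsub>K\<^esub> snd y)),
     smult = (\<lambda>c x. (c \<otimes>\<^bsub>K\<^esub> fst x, c \<otimes>\<^bsub>K\<^esub> snd x))\<rparr>"

lemma dual_numbers_assoc_algebra: "field K \<Longrightarrow> assoc_algebra K (dual_numbers K)"
proof -
  assume "field K"
  then interpret K: field K .
  show ?thesis
  proof (rule assoc_algebraI[OF K.field_axioms], goal_cases)
    case (6 x)
    then show ?case
      by (intro bexI[of _ "(\<ominus>\<^bsub>K\<^esub> fst x, \<ominus>\<^bsub>K\<^esub> snd x)"]) (auto simp: dual_numbers_def K.l_neg)
  qed (auto simp: dual_numbers_def K.a_ac K.m_ac K.l_distr K.r_distr)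
qed

text \<open>The dual numbers supply the derivation: the first component of the homomorphism \<open>\<pi>\<close> sending \<open>G\<close> to \<open>t\<close> and every
  \<open>X\<^sub>i\<close> to 0 is the counit, because both vanish on the generators; hence the second
  component is an \<open>\<epsilon>\<close>-derivation.\<close>

lemma (in clifford_data) no_bialgebra_if_counit_vanishes:
  assumes two: "\<one>\<^bsub>K\<^esub> \<oplus>\<^bsub>K\<^esub> \<one>\<^bsub>K\<^esub> \<noteq> \<zero>\<^bsub>K\<^esub>" and bi: "bialgebra K Cl \<Delta> \<epsilon>"
    and van: "\<And>s. s \<in> clifford_gens n \<Longrightarrow> \<epsilon> (cl_gen s) = \<zero>\<^bsub>K\<^esub>"
    and \<alpha>c: "\<alpha> = \<zero>\<^bsub>K\<^esub>" and \<beta>c: "\<And>i. 1 \<le> i \<Longrightarrow> i \<le> n \<Longrightarrow> \<beta> i = \<zero>\<^bsub>K\<^esub>"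
    and \<gamma>c: "\<And>i. 1 \<le> i \<Longrightarrow> i \<le> n \<Longrightarrow> \<gamma> i = \<zero>\<^bsub>K\<^esub>"
    and lc: "\<And>i j. 1 \<le> i \<Longrightarrow> i < j \<Longrightarrow> j \<le> n \<Longrightarrow> l i j = \<zero>\<^bsub>K\<^esub>"
  shows False
proof -
  interpret C: assoc_algebra K Cl by (rule Cl_assoc_algebra)
  interpret D: assoc_algebra K "dual_numbers K" by (rule dual_numbers_assoc_algebra[OF K.field_axioms])
  note bi = bi[unfolded bialgebra_def Let_def]
  have \<epsilon>: "\<epsilon> \<in> alg_hom K Cl (base_algebra K)" using bi by blast
  define v where "v s = (\<zero>\<^bsub>K\<^esub>, if s = Gen_G then \<one>\<^bsub>K\<^esub> else \<zero>\<^bsub>K\<^esub>)" for s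
  have "clifford_family K (dual_numbers K) n \<alpha> \<beta> \<gamma> l v"
    by (simp add: clifford_family_def v_def dual_numbers_def \<alpha>c \<beta>c \<gamma>c lc)
  then obtain \<pi> where \<pi>: "\<pi> \<in> alg_hom K Cl (dual_numbers K)"
    and \<pi>v: "\<And>s. s \<in> clifford_gens n \<Longrightarrow> \<pi> (cl_gen s) = v s"
    using clifford_universal[OF D.assoc_algebra] by metis
  note p = alg_homD[OF \<pi>]
  have pc: "fst (\<pi> x) \<in> carrier K" "snd (\<pi> x) \<in> carrier K" if "x \<in> carrier Cl" for x
    using p(1)[OF that] by (auto simp: dual_numbers_def)
  have fst: "(\<lambda>x. fst (\<pi> x)) \<in> alg_hom K Cl (base_algebra K)"
    and \<delta>: "(\<lambda>x. snd (\<pi> x)) \<in> lin_map K Cl (base_algebra K)"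
    by (intro alg_homI lin_mapI; simp add: pc p(2-5); simp add: dual_numbers_def)+
  have fst_eq: "fst (\<pi> x) = \<epsilon> x" if "x \<in> carrier Cl" for x
    by (rule clifford_hom_eq[OF base_assoc_algebra[OF K.field_axioms] fst \<epsilon> _ that])
      (simp add: \<pi>v van v_def)
  let ?G = "cl_gen Gen_G"
  have G: "?G \<in> carrier Cl" by (rule cl_gen_closed[OF G_in_gens])
  have "?G \<otimes>\<^bsub>Cl\<^esub> ?G = \<alpha> \<odot>\<^bsub>Cl\<^esub> \<one>\<^bsub>Cl\<^esub>"
    using cl_gen_family by (simp add: clifford_family_def)
  then have GG: "?G \<otimes>\<^bsub>Cl\<^esub> ?G = \<zero>\<^bsub>Cl\<^esub>"
    using C.smult_l_null[OF C.one_closed, folded \<alpha>c] by (rule trans)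
  have "\<one>\<^bsub>K\<^esub> \<oplus>\<^bsub>K\<^esub> \<one>\<^bsub>K\<^esub> = \<zero>\<^bsub>K\<^esub>"
  proof (rule no_comultiplication_square_zero[OF Cl_assoc_algebra \<epsilon> \<delta> _ G GG])
    show "snd (\<pi> (x \<otimes>\<^bsub>Cl\<^esub> y)) = \<epsilon> x \<otimes>\<^bsub>K\<^esub> snd (\<pi> y) \<oplus>\<^bsub>K\<^esub> snd (\<pi> x) \<otimes>\<^bsub>K\<^esub> \<epsilon> y"
      if "x \<in> carrier Cl" "y \<in> carrier Cl" for x y
      using that by (simp add: p fst_eq[symmetric]) (simp add: dual_numbers_def)
    show "\<Delta> \<in> alg_hom K Cl (tensor K Cl Cl)" using bi by blast
    show "tensor_lift K Cl (\<lambda>a b. \<epsilon> a \<odot>\<^bsub>Cl\<^esub> b) (\<Delta> ?G) = ?G" using bi G by blast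
    show "tensor_lift K Cl (\<lambda>a b. \<epsilon> b \<odot>\<^bsub>Cl\<^esub> a) (\<Delta> ?G) = ?G" using bi G by blast
  qed (simp_all add: van G_in_gens \<pi>v v_def)
  with two show False by contradiction
qed

section \<open>The bialgebra structure on copies of \<open>E(n)\<close>\<close>

locale E_copy = E: clifford_data K n "\<one>\<^bsub>K\<^esub>" "\<lambda>i. \<zero>\<^bsub>K\<^esub>" "\<lambda>i. \<zero>\<^bsub>K\<^esub>" "\<lambda>i j. \<zero>\<^bsub>K\<^esub>" + A: assoc_algebra K A
  for K :: "('k, 'r) ring_scheme" and n and A :: "('k, 'a, 's) module_scheme" +
  fixes h
  assumes two: "\<one>\<^bsub>K\<^esub> \<oplus>\<^bsub>K\<^esub> \<one>\<^bsub>K\<^esub> \<noteq> \<zero>\<^bsub>K\<^esub>"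
    and h: "h \<in> alg_hom K A E.Cl" and bij: "bij_betw h (carrier A) (carrier E.Cl)"
begin

abbreviation g where "g \<equiv> inv_into (carrier A) h"
definition Y :: "clifford_gen \<Rightarrow> 'a" where "Y s = g (E.cl_gen s)"

lemma g_hom: "g \<in> alg_hom K E.Cl A"
  by (rule alg_hom_inv_into[OF A.assoc_algebra h bij])

lemma Y_closed: "s \<in> clifford_gens n \<Longrightarrow> Y s \<in> carrier A"
  unfolding Y_def by (intro alg_homD(1)[OF g_hom] E.cl_gen_closed)

lemma Y_family: "clifford_family K A n \<one>\<^bsub>K\<^esub> (\<lambda>i. \<zero>\<^bsub>K\<^esub>) (\<lambda>i. \<zero>\<^bsub>K\<^esub>) (\<lambda>i j. \<zero>\<^bsub>K\<^esub>) Y"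
proof -
  interpret C: assoc_algebra K E.Cl by (rule E.Cl_assoc_algebra)
  show ?thesis
    unfolding Y_def
    by (rule C.clifford_family_image[OF A.assoc_algebra g_hom E.cl_gen_family]) simp_all
qed

text \<open>Transport along \<open>h\<close> makes the elements \<open>Y s\<close> universal generators of \<open>A\<close>: homomorphisms out of \<open>A\<close>
  exist and are unique as for \<open>E(n)\<close>.\<close>

lemma extend:
  assumes "assoc_algebra K B" "assoc_algebra.rank_one_family K B (clifford_gens n) (unit_form K) v"
  obtains \<phi> where "\<phi> \<in> alg_hom K A B" "\<And>s. s \<in> clifford_gens n \<Longrightarrow> \<phi> (Y s) = v s"
proof -
  interpret B: assoc_algebra K B by fact
  obtain \<phi> where \<phi>: "\<phi> \<in> alg_hom K E.Cl B" "\<And>s. s \<in> clifford_gens n \<Longrightarrow> \<phi> (E.cl_gen s) = v s"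
    using E.clifford_universal[OF assms(1) assms(2)[folded B.E_family_iff[OF two]]] by metis
  have "h (Y s) = E.cl_gen s" if "s \<in> clifford_gens n" for s
    unfolding Y_def using bij_betw_inv_into_right[OF bij E.cl_gen_closed[OF that]] .
  then show ?thesis
    by (intro that[OF alg_hom_comp[OF h \<phi>(1)]]) (simp add: \<phi>(2))
qed

lemma unique:
  assumes "assoc_algebra K B" "\<phi> \<in> alg_hom K A B" "\<psi> \<in> alg_hom K A B"
    and eq: "\<And>s. s \<in> clifford_gens n \<Longrightarrow> \<phi> (Y s) = \<psi> (Y s)" and x: "x \<in> carrier A"
  shows "\<phi> x = \<psi> x"
proof -
  have "\<phi> (g (h x)) = \<psi> (g (h x))"
    by (rule E.clifford_hom_eq[OF assms(1) alg_hom_comp[OF g_hom assms(2)] alg_hom_comp[OF g_hom assms(3)]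
          _ alg_homD(1)[OF h x]]) (rule eq[unfolded Y_def])
  then show ?thesis using bij_betw_inv_into_left[OF bij x] by simp
qed

lemma Y_relations:
  "Y Gen_G \<otimes>\<^bsub>A\<^esub> Y Gen_G = \<one>\<^bsub>A\<^esub>"
  "\<lbrakk>s \<in> clifford_gens n; t \<in> clifford_gens n; s \<noteq> Gen_G \<or> t \<noteq> Gen_G\<rbrakk> \<Longrightarrow> A.acomm (Y s) (Y t) = \<zero>\<^bsub>A\<^esub>"
proof -
  show "Y Gen_G \<otimes>\<^bsub>A\<^esub> Y Gen_G = \<one>\<^bsub>A\<^esub>"
    using Y_family by (simp add: clifford_family_def)
  have "A.rank_one_family (clifford_gens n) (unit_form K) Y"
    using Y_family A.E_family_iff[OF two] by blast
  then show "\<lbrakk>s \<in> clifford_gens n; t \<in> clifford_gens n; s \<noteq> Gen_G \<or> t \<noteq> Gen_G\<rbrakk> \<Longrightarrow>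
      A.acomm (Y s) (Y t) = \<zero>\<^bsub>A\<^esub>"
    by (auto simp: A.rank_one_family_def unit_form_def)
qed

sublocale AA: tensor_pair K A A
  by (rule tensor_pairI[OF A.assoc_algebra A.assoc_algebra])

lemma acomm_pure_left:
  assumes "a \<in> carrier A" "a' \<in> carrier A" "b \<in> carrier A" "b' \<in> carrier A" "b' \<otimes>\<^bsub>A\<^esub> b = b \<otimes>\<^bsub>A\<^esub> b'"
  shows "AA.T.acomm (AA.pt a b) (AA.pt a' b') = AA.pt (A.acomm a a') (b \<otimes>\<^bsub>A\<^esub> b')"
  using assms by (simp add: AA.T.acomm_def A.acomm_def AA.pt_mult AA.pt_simps)

lemma acomm_pure_right:
  assumes "a \<in> carrier A" "a' \<in> carrier A" "b \<in> carrier A" "b' \<in> carrier A" "a' \<otimes>\<^bsub>A\<^esub> a = a \<otimes>\<^bsub>A\<^esub> a'"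
  shows "AA.T.acomm (AA.pt a b) (AA.pt a' b') = AA.pt (a \<otimes>\<^bsub>A\<^esub> a') (A.acomm b b')"
  using assms by (simp add: AA.T.acomm_def A.acomm_def AA.pt_mult AA.pt_simps)

definition comult_gen :: "clifford_gen \<Rightarrow> ('a \<times> 'a \<Rightarrow> 'k) set"
  where "comult_gen s = (if s = Gen_G then AA.pt (Y Gen_G) (Y Gen_G)
    else AA.pt (Y s) (Y Gen_G) \<oplus>\<^bsub>AA.T\<^esub> AA.pt \<one>\<^bsub>A\<^esub> (Y s))"

lemma comult_gen_closed: "s \<in> clifford_gens n \<Longrightarrow> comult_gen s \<in> carrier AA.T"
  by (simp add: comult_gen_def AA.pt_simps Y_closed E.G_in_gens)

text \<open>In each anticommutator of pure tensors that occurs, one of the two factors commutes, so that the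
  anticommutator is a pure tensor with an anticommutator of the generators \<open>Y s\<close> in the other factor.\<close>

lemma comult_gen_rank_one: "AA.T.rank_one_family (clifford_gens n) (unit_form K) comult_gen"
proof -
  let ?S = "clifford_gens n"
  note c = Y_closed Y_closed[OF E.G_in_gens]
  have pt0: "AA.pt \<zero>\<^bsub>A\<^esub> a = \<zero>\<^bsub>AA.T\<^esub>" "AA.pt a \<zero>\<^bsub>A\<^esub> = \<zero>\<^bsub>AA.T\<^esub>" if "a \<in> carrier A" for a
    using lin_map_zero[OF A.module AA.T.module bilinD(1)[OF AA.pt_bilin that]]
      lin_map_zero[OF A.module AA.T.module bilinD(2)[OF AA.pt_bilin that]] by simp_all
  note simps = comult_gen_def AA.T.acomm_add_left AA.T.acomm_add_right acomm_pure_left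
    acomm_pure_right c AA.pt_simps Y_relations E.G_in_gens pt0
  have XY: "AA.T.acomm (comult_gen s) (comult_gen t) = \<zero>\<^bsub>AA.T\<^esub>"
    if "s \<in> ?S" "t \<in> ?S" "s \<noteq> Gen_G" "t \<noteq> Gen_G" for s t
    using that by (simp add: simps)
  have GX: "AA.T.acomm (comult_gen Gen_G) (comult_gen s) = \<zero>\<^bsub>AA.T\<^esub>"
    if "s \<in> ?S" "s \<noteq> Gen_G" for s
    using that by (simp add: simps)
  have XG: "AA.T.acomm (comult_gen s) (comult_gen Gen_G) = \<zero>\<^bsub>AA.T\<^esub>"
    if "s \<in> ?S" "s \<noteq> Gen_G" for s
    using that GX[OF that] AA.T.acomm_commute comult_gen_closed E.G_in_gens by metis
  have GG: "AA.T.acomm (comult_gen Gen_G) (comult_gen Gen_G) = \<one>\<^bsub>AA.T\<^esub> \<oplus>\<^bsub>AA.T\<^esub> \<one>\<^bsub>AA.T\<^esub>"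
    by (simp add: comult_gen_def AA.T.acomm_def AA.pt_mult c Y_relations AA.T_one)
  have one: "(\<one>\<^bsub>K\<^esub> \<oplus>\<^bsub>K\<^esub> \<one>\<^bsub>K\<^esub>) \<odot>\<^bsub>AA.T\<^esub> \<one>\<^bsub>AA.T\<^esub> = \<one>\<^bsub>AA.T\<^esub> \<oplus>\<^bsub>AA.T\<^esub> \<one>\<^bsub>AA.T\<^esub>"
    by (simp add: AA.T.smult_l_distr)
  have "AA.T.acomm (comult_gen s) (comult_gen t) =
      (unit_form K s \<otimes>\<^bsub>K\<^esub> unit_form K t \<oplus>\<^bsub>K\<^esub> unit_form K s \<otimes>\<^bsub>K\<^esub> unit_form K t) \<odot>\<^bsub>AA.T\<^esub> \<one>\<^bsub>AA.T\<^esub>"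
    if "s \<in> ?S" "t \<in> ?S" for s t
    using that by (cases "s = Gen_G"; cases "t = Gen_G") (simp_all add: unit_form_def XY GX XG GG one)
  then show ?thesis
    by (simp add: AA.T.rank_one_family_def comult_gen_closed)
qed

text \<open>The grouplike \<open>g\<close> and the skew-primitive \<open>x\<close>: \<open>\<Delta> g = g \<otimes> g\<close> and \<open>\<Delta> x = x \<otimes> g + 1 \<otimes> x\<close>.  Every bialgebra
  axiom equates two algebra homomorphisms, so it is enough to compare them on generators.\<close>

lemma bialgebra_exists: "\<exists>\<Delta> \<epsilon>. bialgebra K A \<Delta> \<epsilon>"
proof -
  note c = Y_closed Y_closed[OF E.G_in_gens] E.G_in_gens
  interpret B: assoc_algebra K "base_algebra K" by (rule base_assoc_algebra[OF E.K.field_axioms])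
  interpret L: tensor_pair K AA.T A by (rule tensor_pairI[OF AA.T_assoc_algebra A.assoc_algebra])
  interpret R: tensor_pair K A AA.T by (rule tensor_pairI[OF A.assoc_algebra AA.T_assoc_algebra])
  obtain \<Delta> where \<Delta>: "\<Delta> \<in> alg_hom K A AA.T" and \<Delta>Y: "\<And>s. s \<in> clifford_gens n \<Longrightarrow> \<Delta> (Y s) = comult_gen s"
    using extend[OF AA.T_assoc_algebra comult_gen_rank_one] by metis
  have "B.rank_one_family (clifford_gens n) (unit_form K) (unit_form K)"
    by (auto simp: B.rank_one_family_def B.acomm_def unit_form_def)
  then obtain \<epsilon> where \<epsilon>: "\<epsilon> \<in> alg_hom K A (base_algebra K)"
    and \<epsilon>Y: "\<And>s. s \<in> clifford_gens n \<Longrightarrow> \<epsilon> (Y s) = unit_form K s"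
    using extend[OF B.assoc_algebra] by metis
  note e = alg_homD[OF \<epsilon>, simplified]
  have \<Delta>G: "\<Delta> (Y Gen_G) = AA.pt (Y Gen_G) (Y Gen_G)"
    and \<Delta>X: "\<lbrakk>s \<in> clifford_gens n; s \<noteq> Gen_G\<rbrakk> \<Longrightarrow> \<Delta> (Y s) = AA.pt (Y s) (Y Gen_G) \<oplus>\<^bsub>AA.T\<^esub> AA.pt \<one>\<^bsub>A\<^esub> (Y s)" for s
    by (simp_all add: \<Delta>Y c comult_gen_def)

  have bll: "bilin K A A A (\<lambda>a b. \<epsilon> a \<odot>\<^bsub>A\<^esub> b)" and blr: "bilin K A A A (\<lambda>a b. \<epsilon> b \<odot>\<^bsub>A\<^esub> a)"
    by (intro bilinI lin_mapI; simp add: e A.smult_l_distr A.smult_r_distr A.smult_assoc1[symmetric] E.K.m_ac)+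
  have El: "tensor_lift K A (\<lambda>a b. \<epsilon> a \<odot>\<^bsub>A\<^esub> b) \<in> alg_hom K AA.T A"
    by (rule AA.tensor_lift_alg_hom[OF A.assoc_algebra bll])
      (simp_all add: e A.smult_mult_left A.smult_mult_right A.smult_assoc1[symmetric] E.K.m_comm)
  have Er: "tensor_lift K A (\<lambda>a b. \<epsilon> b \<odot>\<^bsub>A\<^esub> a) \<in> alg_hom K AA.T A"
    by (rule AA.tensor_lift_alg_hom[OF A.assoc_algebra blr])
      (simp_all add: e A.smult_mult_left A.smult_mult_right A.smult_assoc1[symmetric] E.K.m_comm)
  note lp = AA.tensor_lift_pure[OF A.module bll] and rp = AA.tensor_lift_pure[OF A.module blr]
  have counit_l: "tensor_lift K A (\<lambda>a b. \<epsilon> a \<odot>\<^bsub>A\<^esub> b) (\<Delta> x) = x" if "x \<in> carrier A" for x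
  proof (rule unique[OF A.assoc_algebra alg_hom_comp[OF \<Delta> El] alg_hom_id _ that])
    show "tensor_lift K A (\<lambda>a b. \<epsilon> a \<odot>\<^bsub>A\<^esub> b) (\<Delta> (Y s)) = Y s" if s: "s \<in> clifford_gens n" for s
      using s by (cases "s = Gen_G")
        (simp_all add: \<Delta>G \<Delta>X alg_homD(2)[OF El] lp c AA.pt_simps \<epsilon>Y unit_form_def e)
  qed
  have counit_r: "tensor_lift K A (\<lambda>a b. \<epsilon> b \<odot>\<^bsub>A\<^esub> a) (\<Delta> x) = x" if "x \<in> carrier A" for x
  proof (rule unique[OF A.assoc_algebra alg_hom_comp[OF \<Delta> Er] alg_hom_id _ that])
    show "tensor_lift K A (\<lambda>a b. \<epsilon> b \<odot>\<^bsub>A\<^esub> a) (\<Delta> (Y s)) = Y s" if s: "s \<in> clifford_gens n" for s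
      using s by (cases "s = Gen_G")
        (simp_all add: \<Delta>G \<Delta>X alg_homD(2)[OF Er] rp c AA.pt_simps \<epsilon>Y unit_form_def e)
  qed

  let ?\<Delta>I = "tensor_lift K L.T (\<lambda>a b. L.pt (\<Delta> a) b)" and ?I\<Delta> = "tensor_lift K R.T (\<lambda>a b. R.pt a (\<Delta> b))"
  note l = tensor_map_alg_hom[OF A.assoc_algebra A.assoc_algebra AA.T_assoc_algebra A.assoc_algebra \<Delta> alg_hom_id]
  note r = tensor_map_alg_hom[OF A.assoc_algebra A.assoc_algebra A.assoc_algebra AA.T_assoc_algebra alg_hom_id \<Delta>]
  note s = tensor_assoc_alg_hom[OF A.assoc_algebra]
  have one: "\<Delta> \<one>\<^bsub>A\<^esub> = AA.pt \<one>\<^bsub>A\<^esub> \<one>\<^bsub>A\<^esub>" by (simp add: alg_homD(5)[OF \<Delta>] AA.T_one)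
  have coassoc: "tensor_assoc K A (?\<Delta>I (\<Delta> x)) = ?I\<Delta> (\<Delta> x)" if "x \<in> carrier A" for x
  proof (rule unique[OF R.T_assoc_algebra alg_hom_comp[OF alg_hom_comp[OF \<Delta> l(1)] s(1)] alg_hom_comp[OF \<Delta> r(1)] _ that])
    fix t assume t: "t \<in> clifford_gens n"
    show "tensor_assoc K A (?\<Delta>I (\<Delta> (Y t))) = ?I\<Delta> (\<Delta> (Y t))"
    proof (cases "t = Gen_G")
      case True
      then show ?thesis by (simp add: \<Delta>G l(2) r(2) s(2) c)
    next
      case False
      then show ?thesis
        using t by (simp add: \<Delta>X \<Delta>G one l(2) r(2) s(2) alg_homD(2)[OF l(1)] alg_homD(2)[OF r(1)]
            alg_homD(2)[OF s(1)] AA.pt_simps L.pt_simps R.pt_simps c R.T.M.a_assoc)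
    qed
  qed
  have "bialgebra K A \<Delta> \<epsilon>"
    unfolding bialgebra_def Let_def
    by (intro conjI ballI A.assoc_algebra \<Delta> \<epsilon>) (erule coassoc counit_l counit_r)+
  then show ?thesis by blast
qed

end

section \<open>Clifford algebras that are bialgebras\<close>

theorem theorem3p9:
  fixes K :: "('k, 'r) ring_scheme" and n :: nat
    and \<alpha> :: 'k and \<beta> \<gamma> :: "nat \<Rightarrow> 'k" and l :: "nat \<Rightarrow> nat \<Rightarrow> 'k"
  assumes "field K"
    and "\<one>\<^bsub>K\<^esub> \<oplus>\<^bsub>K\<^esub> \<one>\<^bsub>K\<^esub> \<noteq> \<zero>\<^bsub>K\<^esub>"
    and "\<alpha> \<in> carrier K"
    and "\<And>i. 1 \<le> i \<Longrightarrow> i \<le> n \<Longrightarrow> \<beta> i \<in> carrier K"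
    and "\<And>i. 1 \<le> i \<Longrightarrow> i \<le> n \<Longrightarrow> \<gamma> i \<in> carrier K"
    and "\<And>i j. 1 \<le> i \<Longrightarrow> i < j \<Longrightarrow> j \<le> n \<Longrightarrow> l i j \<in> carrier K"
  shows "(\<exists>\<Delta> \<epsilon>. bialgebra K (clifford K n \<alpha> \<beta> \<gamma> l) \<Delta> \<epsilon>)
    \<longleftrightarrow> alg_isomorphic K (clifford K n \<alpha> \<beta> \<gamma> l) (E_algebra K n)"
proof -
  interpret clifford_data K n \<alpha> \<beta> \<gamma> l
    by (intro clifford_data.intro clifford_data_axioms.intro assms)
  interpret C: assoc_algebra K Cl by (rule Cl_assoc_algebra)
  show ?thesis
  proof
    assume "\<exists>\<Delta> \<epsilon>. bialgebra K Cl \<Delta> \<epsilon>"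
    then obtain \<Delta> \<epsilon> where bi: "bialgebra K Cl \<Delta> \<epsilon>" by blast
    then have \<epsilon>: "\<epsilon> \<in> alg_hom K Cl (base_algebra K)" by (simp add: bialgebra_def Let_def)
    define c where "c s = \<epsilon> (cl_gen s)" for s
    have c: "c s \<in> carrier K" if "s \<in> clifford_gens n" for s
      using alg_homD(1)[OF \<epsilon> cl_gen_closed[OF that]] by (simp add: c_def)
    have "clifford_family K (base_algebra K) n \<alpha> \<beta> \<gamma> l c"
      unfolding c_def
      by (rule C.clifford_family_image[OF base_assoc_algebra[OF assms(1)] \<epsilon> cl_gen_family])
        (rule assms; assumption)+
    then have \<alpha>c: "\<alpha> = c Gen_G \<otimes>\<^bsub>K\<^esub> c Gen_G"
      and \<beta>c: "\<And>i. 1 \<le> i \<Longrightarrow> i \<le> n \<Longrightarrow> \<beta> i = c (Gen_X i) \<otimes>\<^bsub>K\<^esub> c (Gen_X i)"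
      and \<gamma>c: "\<And>i. 1 \<le> i \<Longrightarrow> i \<le> n \<Longrightarrow>
        \<gamma> i = c Gen_G \<otimes>\<^bsub>K\<^esub> c (Gen_X i) \<oplus>\<^bsub>K\<^esub> c Gen_G \<otimes>\<^bsub>K\<^esub> c (Gen_X i)"
      and lc: "\<And>i j. 1 \<le> i \<Longrightarrow> i < j \<Longrightarrow> j \<le> n \<Longrightarrow>
        l i j = c (Gen_X i) \<otimes>\<^bsub>K\<^esub> c (Gen_X j) \<oplus>\<^bsub>K\<^esub> c (Gen_X i) \<otimes>\<^bsub>K\<^esub> c (Gen_X j)"
      using assms(3-6) c
      by (simp_all add: clifford_family_def X_in_gens G_in_gens K.m_comm)
    show "alg_isomorphic K Cl (E_algebra K n)"
    proof (cases "\<exists>m\<in>clifford_gens n. c m \<noteq> \<zero>\<^bsub>K\<^esub>")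
      case True
      then obtain m where m: "m \<in> clifford_gens n" "c m \<noteq> \<zero>\<^bsub>K\<^esub>" by blast
      show ?thesis
        by (rule isomorphic_E_algebra[OF assms(2) c \<alpha>c \<beta>c \<gamma>c lc m])
    next
      case False
      then have "\<epsilon> (cl_gen s) = \<zero>\<^bsub>K\<^esub>" if "s \<in> clifford_gens n" for s
        using that by (auto simp: c_def)
      then have False
        by (rule no_bialgebra_if_counit_vanishes[OF assms(2) bi])
          (use False in \<open>simp_all add: \<alpha>c \<beta>c \<gamma>c lc X_in_gens G_in_gens\<close>)
      then show ?thesis ..
    qed
  next
    assume "alg_isomorphic K Cl (E_algebra K n)"
    then obtain h where h: "h \<in> alg_hom K Cl (E_algebra K n)"
      "bij_betw h (carrier Cl) (carrier (E_algebra K n))"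
      by (auto simp: alg_isomorphic_def)
    interpret E_copy K n Cl h
      using h assms(2) E_clifford_data[OF assms(1)] Cl_assoc_algebra
      by (intro E_copy.intro E_copy_axioms.intro) (simp_all add: E_algebra_def)
    show "\<exists>\<Delta> \<epsilon>. bialgebra K Cl \<Delta> \<epsilon>" by (rule bialgebra_exists)
  qed
qed

end
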